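(* Let $\Gamma\subset\mathrm{SL}_2(\mathbb{R})$ be a Fuchsian group acting freely and properly discontinuously on $\mathbb{H}$, and let $k$ be an integer. The map $$\mathrm{Z}^1(\Gamma,\mathbb{D}_k)\longrightarrow\bigoplus_{i=1}^n\mathrm{Z}^1(\Gamma,\mathfrak{d}_k),\qquad A_\bullet\longmapsto(a_{\bullet,1},\dots,a_{\bullet,n}),$$ where $a_{\gamma,i}$ is the coefficient of $\rho_i$ in $A_\gamma$, is surjective. That is, given $a_{\bullet,i}\in\mathrm{Z}^1(\Gamma,\mathfrak{d}_k)$ for $i=1,\dots,n$, there exists $A_\bullet\in\mathrm{Z}^1(\Gamma,\mathbb{D}_k)$ with $A_\bullet=1+\sum_{i=1}^n a_{\bullet,i}\rho_i+O(\rho^2)$.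
   Context: $j_\gamma(\tau)=c\tau+d$. $\Gamma$ acts on power series in commuting variables $\rho_1,\dots,\rho_n$ with coefficients in linear differential operators on $\mathbb{H}$ by $(A\|_k\gamma)(\tau,\partial_\tau)=j_\gamma(\tau)^{-k}A(\gamma\tau,\partial_{\gamma\tau})j_\gamma(\tau)^k$, $\partial_{\gamma\tau}=j_\gamma(\tau)^2\partial_\tau$. $\mathfrak{d}_k=\{2p\partial_\tau+kp':p\in\mathbb{C}[\tau],\deg p\le2\}$ (a $\Gamma$-module and Lie algebra under commutator). $\mathrm{Z}^1(\Gamma,\mathfrak{d}_k)$ is the set of maps $a:\Gamma\to\mathfrak{d}_k$ with $a_{\gamma\delta}=a_\gamma\|_k\delta+a_\delta$. $\mathfrak{d}_k^\rho=(\rho)\mathfrak{d}_k[[\rho_1,\dots,\rho_n]]$ where $(\rho)$ is the ideal generated by the $\rho_i$, $\mathbb{D}_k=\exp(\mathfrak{d}_k^\rho)$, and $\mathrm{Z}^1(\Gamma,\mathbb{D}_k)$ is the set of maps $A:\Gamma\to\mathbb{D}_k$ with $A_{\gamma\delta}=(A_\gamma\|_k\delta)A_\delta$. $O(\rho^2)$ denotes terms in $(\rho)^2$. *)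

theory Defs
  imports "HOL-Analysis.Analysis" "HOL-Computational_Algebra.Polynomial"
begin

definition upper_half :: "complex set" where
  "upper_half = {z. Im z > 0}"

definition SL2 :: "(real^2^2) set" where
  "SL2 = {g. det g = 1}"

definition moeb :: "real^2^2 \<Rightarrow> complex \<Rightarrow> complex" where
  "moeb g z = (of_real (g$1$1) * z + of_real (g$1$2)) / (of_real (g$2$1) * z + of_real (g$2$2))"

text \<open>Action of the inverse matrix (for det g = 1, the inverse is [[d,-b],[-c,a]]).\<close>
definition moeb_inv :: "real^2^2 \<Rightarrow> complex \<Rightarrow> complex" where
  "moeb_inv g w = (of_real (g$2$2) * w - of_real (g$1$2)) / (- of_real (g$2$1) * w + of_real (g$1$1))"

definition jfac :: "real^2^2 \<Rightarrow> complex \<Rightarrow> complex" where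
  "jfac g z = of_real (g$2$1) * z + of_real (g$2$2)"

definition fuchsian_free_pd :: "(real^2^2) set \<Rightarrow> bool" where
  "fuchsian_free_pd G \<longleftrightarrow>
     G \<subseteq> SL2 \<and> mat 1 \<in> G \<and> (\<forall>g\<in>G. \<forall>h\<in>G. g ** h \<in> G) \<and>
     (\<forall>g\<in>G. \<exists>h\<in>G. g ** h = mat 1) \<and>
     (\<forall>g\<in>G. \<exists>e>0. \<forall>h\<in>G. dist h g < e \<longrightarrow> h = g) \<and>
     (\<forall>g\<in>G. \<forall>z\<in>upper_half. moeb g z = z \<longrightarrow> g = mat 1) \<and>
     (\<forall>K. compact K \<and> K \<subseteq> upper_half \<longrightarrow> finite {g\<in>G. moeb g ` K \<inter> K \<noteq> {}})"

type_synonym dop = "(complex \<Rightarrow> complex) \<Rightarrow> complex \<Rightarrow> complex"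

definition dop_eq :: "dop \<Rightarrow> dop \<Rightarrow> bool" where
  "dop_eq L M \<longleftrightarrow> (\<forall>f. f holomorphic_on upper_half \<longrightarrow> (\<forall>z\<in>upper_half. L f z = M f z))"

definition dop_id :: dop where "dop_id = (\<lambda>f. f)"
definition dop_zero :: dop where "dop_zero = (\<lambda>f z. 0)"
definition dop_add :: "dop \<Rightarrow> dop \<Rightarrow> dop" where
  "dop_add L M = (\<lambda>f z. L f z + M f z)"

definition dk_op :: "int \<Rightarrow> complex poly \<Rightarrow> dop" where
  "dk_op k p = (\<lambda>f z. 2 * poly p z * deriv f z + of_int k * poly (pderiv p) z * f z)"

definition in_dk :: "int \<Rightarrow> dop \<Rightarrow> bool" where
  "in_dk k L \<longleftrightarrow> (\<exists>p. degree p \<le> 2 \<and> dop_eq L (dk_op k p))"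

definition dop_slash :: "int \<Rightarrow> dop \<Rightarrow> real^2^2 \<Rightarrow> dop" where
  "dop_slash k L g = (\<lambda>f z. jfac g z powi (-k) *
      L (\<lambda>w. jfac g (moeb_inv g w) powi k * f (moeb_inv g w)) (moeb g z))"

section \<open>Power series in commuting variables rho_i (i :: 'n) with operator coefficients\<close>

type_synonym 'n dps = "('n \<Rightarrow> nat) \<Rightarrow> dop"

definition ps_eq :: "'n dps \<Rightarrow> 'n dps \<Rightarrow> bool" where
  "ps_eq A B \<longleftrightarrow> (\<forall>\<alpha>. dop_eq (A \<alpha>) (B \<alpha>))"

definition ps_mult :: "('n::finite) dps \<Rightarrow> 'n dps \<Rightarrow> 'n dps" where
  "ps_mult A B = (\<lambda>\<alpha> f z. \<Sum>\<beta>\<in>{\<beta>. \<forall>i. \<beta> i \<le> \<alpha> i}. A \<beta> (B (\<lambda>i. \<alpha> i - \<beta> i) f) z)"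

definition ps_one :: "'n dps" where
  "ps_one = (\<lambda>\<alpha>. if \<alpha> = (\<lambda>_. 0) then dop_id else dop_zero)"

primrec ps_pow :: "('n::finite) dps \<Rightarrow> nat \<Rightarrow> 'n dps" where
  "ps_pow X 0 = ps_one"
| "ps_pow X (Suc m) = ps_mult X (ps_pow X m)"

text \<open>Formal exponential; for X with zero constant term only powers m \<le> |alpha| contribute
  to the coefficient of rho^alpha.\<close>
definition ps_exp :: "('n::finite) dps \<Rightarrow> 'n dps" where
  "ps_exp X = (\<lambda>\<alpha> f z. \<Sum>m\<le>sum \<alpha> UNIV. ps_pow X m \<alpha> f z / of_nat (fact m))"

definition ps_slash :: "int \<Rightarrow> 'n dps \<Rightarrow> real^2^2 \<Rightarrow> 'n dps" where
  "ps_slash k A g = (\<lambda>\<alpha>. dop_slash k (A \<alpha>) g)"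

definition in_drho :: "int \<Rightarrow> 'n dps \<Rightarrow> bool" where
  "in_drho k X \<longleftrightarrow> X (\<lambda>_. 0) = dop_zero \<and> (\<forall>\<alpha>. in_dk k (X \<alpha>))"

definition in_Dk :: "int \<Rightarrow> ('n::finite) dps \<Rightarrow> bool" where
  "in_Dk k A \<longleftrightarrow> (\<exists>X. in_drho k X \<and> ps_eq A (ps_exp X))"

definition Z1_dk :: "(real^2^2) set \<Rightarrow> int \<Rightarrow> (real^2^2 \<Rightarrow> dop) \<Rightarrow> bool" where
  "Z1_dk G k a \<longleftrightarrow> (\<forall>g\<in>G. in_dk k (a g)) \<and>
     (\<forall>g\<in>G. \<forall>h\<in>G. dop_eq (a (g ** h)) (dop_add (dop_slash k (a g) h) (a h)))"

definition Z1_Dk :: "(real^2^2) set \<Rightarrow> int \<Rightarrow> (real^2^2 \<Rightarrow> ('n::finite) dps) \<Rightarrow> bool" where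
  "Z1_Dk G k A \<longleftrightarrow> (\<forall>g\<in>G. in_Dk k (A g)) \<and>
     (\<forall>g\<in>G. \<forall>h\<in>G. ps_eq (A (g ** h)) (ps_mult (ps_slash k (A g) h) (A h)))"

definition unit_idx :: "'n \<Rightarrow> 'n \<Rightarrow> nat" where
  "unit_idx i = (\<lambda>j. if j = i then 1 else 0)"

end

theory Submission
  imports Defs "HOL-Library.Function_Algebras" "HOL-Complex_Analysis.Cauchy_Integral_Formula"
begin

text \<open>The cocycle is extended degree by degree in \<open>\<rho>\<close> as \<open>exp (X\<^sub>\<gamma>)\<close>.  The obstruction at each step is a
  2-cocycle of \<open>\<Gamma>\<close> with values in \<open>\<dd>\<^sub>k\<close>, which as a module is the space of quadratic polynomials, so
  everything rests on \<open>H\<^sup>2(\<Gamma>, quadratic polynomials) = 0\<close>.  By linear duality a 2-cocycle is a coboundary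
  as soon as it pairs to zero with every finite 2-cycle.  A bump of integral 1 together with compactly
  supported primitives and an equivariant partition of unity turns the pairing with a 2-cycle into
  an integral against a multiplicity function on the upper half plane with values in linear
  functionals on the coefficients.  It is locally constant, hence a constant invariant
  functional, and it vanishes where the supports do not reach.  If translates of a compact set cover the half
  plane, an invariant functional \<open>\<Lambda>\<close> is zero: \<open>q(u) = \<Lambda> ((X - u)\<^sup>2)\<close> is a quadratic polynomial with
  \<open>|q| / Im\<close> invariant, hence bounded.\<close>

subsection \<open>Formal power series in several variables\<close>

text \<open>The obstacle is the generality of \<Gamma>: it may be infinitely generated, and its
  quotient may be open or closed, so there is neither a convenient presentation nor a compact
  fundamental domain to compute with. Passing to one finite 2-cycle at a time means that only a
  compact part of the half plane matters, and over such a part a partition of unity is easy to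
  build.

  The compactly supported forms act as smoothed chains. The bump stands for a point, a primitive of
  the difference of two translates for a path between them, and the primitive of three such paths
  for a triangle. The multiplicity function counts how often the triangles of the cycle cover a
  point.

  On the algebraic side products are taken among all operators, while each correction has to lie in
  the Lie algebra itself and not merely in the algebra generated by it. Logarithmic derivatives with
  respect to the Euler operator keep track of this, since for exponentials they are made of iterated
  commutators only.\<close>

definition deg :: "('n::finite \<Rightarrow> nat) \<Rightarrow> nat" where
  "deg \<alpha> = sum \<alpha> UNIV"

lemma deg_zero [simp]: "deg (\<lambda>_. 0) = 0" "deg 0 = 0"
  by (simp_all add: deg_def zero_fun_def)

lemma deg_eq_0_iff: "deg \<alpha> = 0 \<longleftrightarrow> \<alpha> = 0"
  by (auto simp: deg_def fun_eq_iff)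

lemma finite_multi_le [simp]: "finite {..(\<alpha> :: 'n::finite \<Rightarrow> nat)}"
proof -
  have "{..\<alpha>} \<subseteq> (\<Pi>\<^sub>E i\<in>UNIV. {..\<alpha> i})"
    by (auto simp: le_fun_def)
  moreover have "finite (\<Pi>\<^sub>E i\<in>(UNIV::'n set). {..\<alpha> i})"
    by (intro finite_PiE) auto
  ultimately show ?thesis
    by (rule finite_subset)
qed

lemma deg_diff: "\<beta> \<le> \<alpha> \<Longrightarrow> deg (\<alpha> - \<beta>) + deg \<beta> = deg \<alpha>"
  by (simp add: deg_def sum.distrib[symmetric] le_fun_def)

lemma multi_diff_eq_iff: "\<beta> \<le> \<alpha> \<Longrightarrow> \<alpha> - \<beta> = 0 \<longleftrightarrow> \<beta> = (\<alpha> :: 'n \<Rightarrow> nat)"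
  by (auto simp: le_fun_def fun_eq_iff intro: antisym)

text \<open>A copy of the function type, because the product has to be convolution and not the
  pointwise product. With the class instance below, \<open>X ^ n\<close> and ring arithmetic apply
  to series over a noncommutative coefficient algebra; the variables commute with each other and
  with the coefficients.\<close>

typedef ('n, 'a) mps = "UNIV :: (('n \<Rightarrow> nat) \<Rightarrow> 'a) set"
  morphisms coef Abs_mps by simp

lemma coef_Abs [simp]: "coef (Abs_mps f) = f"
  by (simp add: Abs_mps_inverse)

lemma mps_eqI: "(\<And>\<alpha>. coef A \<alpha> = coef B \<alpha>) \<Longrightarrow> A = B"
  by (simp add: coef_inject[symmetric] fun_eq_iff)

text \<open>Both sides run over the ways to write \<alpha> as a sum of three exponents: the right
  side names the first two summands, the left side the first summand and the sum of the first two.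
  This is associativity of convolution.\<close>

lemma sum_multi_assoc:
  fixes f :: "('n::finite \<Rightarrow> nat) \<Rightarrow> ('n \<Rightarrow> nat) \<Rightarrow> ('n \<Rightarrow> nat) \<Rightarrow> 'b::comm_monoid_add"
  shows "(\<Sum>\<beta>\<le>\<alpha>. \<Sum>\<gamma>\<le>\<beta>. f \<gamma> (\<beta> - \<gamma>) (\<alpha> - \<beta>)) = (\<Sum>\<gamma>\<le>\<alpha>. \<Sum>\<delta>\<le>\<alpha> - \<gamma>. f \<gamma> \<delta> (\<alpha> - \<gamma> - \<delta>))"
proof -
  have 1: "(\<Sum>\<beta>\<le>\<alpha>. \<Sum>\<gamma>\<le>\<beta>. f \<gamma> (\<beta> - \<gamma>) (\<alpha> - \<beta>)) =
      (\<Sum>(\<beta>,\<gamma>)\<in>(SIGMA \<beta>:{..\<alpha>}. {..\<beta>}). f \<gamma> (\<beta> - \<gamma>) (\<alpha> - \<beta>))"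
    by (subst sum.Sigma) simp_all
  have 2: "(\<Sum>\<gamma>\<le>\<alpha>. \<Sum>\<delta>\<le>\<alpha> - \<gamma>. f \<gamma> \<delta> (\<alpha> - \<gamma> - \<delta>)) =
      (\<Sum>(\<gamma>,\<delta>)\<in>(SIGMA \<gamma>:{..\<alpha>}. {..\<alpha> - \<gamma>}). f \<gamma> \<delta> (\<alpha> - \<gamma> - \<delta>))"
    by (subst sum.Sigma) simp_all
  show ?thesis
    unfolding 1 2
  proof (rule sum.reindex_bij_witness[where i = "\<lambda>(\<gamma>,\<delta>). (\<gamma> + \<delta>, \<gamma>)" and j = "\<lambda>(\<beta>,\<gamma>). (\<gamma>, \<beta> - \<gamma>)"],
      goal_cases)
    case (1 a) then show ?case by (auto simp: le_fun_def fun_eq_iff)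
  next
    case (2 a) then show ?case
      by (auto simp: le_fun_def diff_le_mono intro: order_trans)
  next
    case (3 a) then show ?case by (auto simp: le_fun_def fun_eq_iff)
  next
    case (4 a)
    then show ?case
      by (auto simp: le_fun_def) (metis add.commute le_diff_conv2)
  next
    case (5 a)
    obtain b g where a: "a = (b, g)" by (cases a)
    with 5 have "g \<le> b" "b \<le> \<alpha>" by auto
    then have "\<alpha> - g - (b - g) = \<alpha> - b"
      by (auto simp: le_fun_def fun_eq_iff)
    then show ?case by (simp add: a)
  qed
qed

instantiation mps :: (finite, real_algebra_1) real_algebra_1
begin

definition "0 = Abs_mps (\<lambda>_. 0)"
definition "1 = Abs_mps (\<lambda>\<alpha>. if \<alpha> = 0 then 1 else 0)"
definition "A + B = Abs_mps (\<lambda>\<alpha>. coef A \<alpha> + coef B \<alpha>)"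
definition "A - B = Abs_mps (\<lambda>\<alpha>. coef A \<alpha> - coef B \<alpha>)"
definition "- A = Abs_mps (\<lambda>\<alpha>. - coef A \<alpha>)"
definition "A * B = Abs_mps (\<lambda>\<alpha>. \<Sum>\<beta>\<le>\<alpha>. coef A \<beta> * coef B (\<alpha> - \<beta>))"
definition "r *\<^sub>R A = Abs_mps (\<lambda>\<alpha>. r *\<^sub>R coef A \<alpha>)"

lemma coef_zero: "coef 0 \<alpha> = (0::'b)"
  and coef_one: "coef 1 \<alpha> = (if \<alpha> = 0 then 1 else (0::'b))"
  and coef_add: "coef (A + B) \<alpha> = coef A \<alpha> + (coef B \<alpha> :: 'b)"
  and coef_diff: "coef (A - B) \<alpha> = coef A \<alpha> - (coef B \<alpha> :: 'b)"
  and coef_minus: "coef (- A) \<alpha> = - (coef A \<alpha> :: 'b)"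
  and coef_mult: "coef (A * B) \<alpha> = (\<Sum>\<beta>\<le>\<alpha>. coef A \<beta> * (coef B (\<alpha> - \<beta>) :: 'b))"
  and coef_scaleR: "coef (r *\<^sub>R A) \<alpha> = r *\<^sub>R (coef A \<alpha> :: 'b)"
  by (simp_all add: zero_mps_def one_mps_def plus_mps_def minus_mps_def uminus_mps_def
      times_mps_def scaleR_mps_def)

instance
proof
  fix A B C :: "('a, 'b) mps" and r s :: real
  show "A + B + C = A + (B + C)" "A + B = B + A" "0 + A = A" "- A + A = 0" "A - B = A + - B"
    by (auto intro!: mps_eqI simp: coef_zero coef_add coef_minus coef_diff add_ac)
  show "r *\<^sub>R (A + B) = r *\<^sub>R A + r *\<^sub>R B" "(r + s) *\<^sub>R A = r *\<^sub>R A + s *\<^sub>R A"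
    "r *\<^sub>R s *\<^sub>R A = (r * s) *\<^sub>R A" "1 *\<^sub>R A = A"
    by (auto intro!: mps_eqI simp: coef_add coef_scaleR algebra_simps)
  show "A * B * C = A * (B * C)"
    by (rule mps_eqI) (simp add: coef_mult sum_distrib_left sum_distrib_right mult.assoc
        sum_multi_assoc[where f = "\<lambda>a b c. coef A a * (coef B b * coef C c)"])
  show "(A + B) * C = A * C + B * C" "A * (B + C) = A * B + A * C"
    by (auto intro!: mps_eqI simp: coef_mult coef_add algebra_simps sum.distrib)
  show "r *\<^sub>R A * B = r *\<^sub>R (A * B)" "A * r *\<^sub>R B = r *\<^sub>R (A * B)"
    by (auto intro!: mps_eqI simp: coef_mult coef_scaleR scaleR_sum_right)
  show "1 * A = A"
  proof (rule mps_eqI)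
    fix \<alpha>
    have "coef (1 * A) \<alpha> = (\<Sum>\<beta>\<le>\<alpha>. if \<beta> = 0 then coef A \<alpha> else 0)"
      unfolding coef_mult coef_one by (intro sum.cong) (auto simp: fun_diff_def)
    then show "coef (1 * A) \<alpha> = coef A \<alpha>"
      by (simp add: le_fun_def)
  qed
  show "A * 1 = A"
  proof (rule mps_eqI)
    fix \<alpha>
    have "coef (A * 1) \<alpha> = (\<Sum>\<beta>\<le>\<alpha>. if \<beta> = \<alpha> then coef A \<alpha> else 0)"
      unfolding coef_mult coef_one by (intro sum.cong) (auto simp: multi_diff_eq_iff)
    then show "coef (A * 1) \<alpha> = coef A \<alpha>"
      by simp
  qed
  show "(0 :: ('a, 'b) mps) \<noteq> 1"
  proof
    assume "(0 :: ('a, 'b) mps) = 1"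
    then have "coef (0 :: ('a, 'b) mps) 0 = coef 1 0" by simp
    then show False by (simp add: coef_zero coef_one)
  qed
qed

end

lemmas coef_simps = coef_zero coef_one coef_add coef_diff coef_minus coef_scaleR

lemma coef_sum: "coef (\<Sum>i\<in>I. f i) \<alpha> = (\<Sum>i\<in>I. coef (f i) \<alpha>)"
  by (induction I rule: infinite_finite_induct) (simp_all add: coef_simps)

section \<open>Order in the variables and the Euler operator\<close>

definition ord_ge :: "nat \<Rightarrow> ('n::finite, 'a::real_algebra_1) mps \<Rightarrow> bool" where
  "ord_ge d A \<longleftrightarrow> (\<forall>\<alpha>. deg \<alpha> < d \<longrightarrow> coef A \<alpha> = 0)"

lemma ord_ge_0 [simp]: "ord_ge 0 A"
  by (simp add: ord_ge_def)

lemma ord_ge_mono: "ord_ge d A \<Longrightarrow> e \<le> d \<Longrightarrow> ord_ge e A"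
  by (auto simp: ord_ge_def)

lemma ord_ge_1_iff: "ord_ge 1 A \<longleftrightarrow> coef A 0 = 0"
  by (auto simp: ord_ge_def deg_eq_0_iff)

lemma ord_ge_add: "ord_ge d A \<Longrightarrow> ord_ge d B \<Longrightarrow> ord_ge d (A + B)"
  and ord_ge_diff: "ord_ge d A \<Longrightarrow> ord_ge d B \<Longrightarrow> ord_ge d (A - B)"
  and ord_ge_scaleR: "ord_ge d A \<Longrightarrow> ord_ge d (r *\<^sub>R A)"
  by (auto simp: ord_ge_def coef_simps)

lemma ord_ge_zero [simp]: "ord_ge d 0"
  by (simp add: ord_ge_def coef_simps)

lemma ord_ge_sum: "(\<And>i. i \<in> I \<Longrightarrow> ord_ge d (f i)) \<Longrightarrow> ord_ge d (\<Sum>i\<in>I. f i)"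
  by (induction I rule: infinite_finite_induct) (simp_all add: ord_ge_add)

lemma ord_ge_mult:
  assumes "ord_ge d A" "ord_ge e B"
  shows "ord_ge (d + e) (A * B)"
  unfolding ord_ge_def
proof (intro allI impI)
  fix \<alpha> :: "'a \<Rightarrow> nat"
  assume \<alpha>: "deg \<alpha> < d + e"
  have "coef A \<beta> * coef B (\<alpha> - \<beta>) = 0" if "\<beta> \<le> \<alpha>" for \<beta>
  proof (cases "deg \<beta> < d")
    case True
    then show ?thesis using assms by (simp add: ord_ge_def)
  next
    case False
    then have "deg (\<alpha> - \<beta>) < e" using deg_diff[OF that] \<alpha> by linarith
    then show ?thesis using assms by (simp add: ord_ge_def)
  qed
  then show "coef (A * B) \<alpha> = 0"
    by (simp add: coef_mult)
qed

lemma ord_ge_power: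
  assumes "ord_ge 1 X"
  shows "ord_ge n (X ^ n)"
proof (induction n)
  case (Suc n)
  show ?case using ord_ge_mult[OF assms Suc] by simp
qed simp

text \<open>The filtration by order is separated. Identities between infinite series are proved
  through it: both sides are replaced by finite truncations, and congruence modulo order N is
  written as \<open>ord_ge N\<close> of a difference.\<close>

lemma eq_if_ord_ge: "(\<And>N. ord_ge N (A - B)) \<Longrightarrow> A = B"
  by (rule mps_eqI) (auto simp: ord_ge_def coef_simps dest: spec[of _ "Suc _"])

text \<open>The Euler derivation, the sum of all
  \<open>\<rho>\<^sub>i \<partial>/\<partial>\<rho>\<^sub>i\<close>. It handles all variables at
  once and is invertible in positive degree, so it determines a series up to the constant
  term.\<close>

definition euler :: "('n::finite, 'a::real_algebra_1) mps \<Rightarrow> ('n, 'a) mps" where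
  "euler A = Abs_mps (\<lambda>\<alpha>. real (deg \<alpha>) *\<^sub>R coef A \<alpha>)"

lemma coef_euler: "coef (euler A) \<alpha> = real (deg \<alpha>) *\<^sub>R coef A \<alpha>"
  by (simp add: euler_def)

lemma euler_add: "euler (A + B) = euler A + euler B"
  and euler_diff: "euler (A - B) = euler A - euler B"
  and euler_scaleR: "euler (r *\<^sub>R A) = r *\<^sub>R euler A"
  and euler_0 [simp]: "euler 0 = 0"
  by (auto intro!: mps_eqI simp: coef_euler coef_simps algebra_simps)

lemma euler_1 [simp]: "euler 1 = 0"
  by (rule mps_eqI) (simp add: coef_euler coef_simps)

lemma euler_sum: "euler (\<Sum>i\<in>I. f i) = (\<Sum>i\<in>I. euler (f i))"
  by (induction I rule: infinite_finite_induct) (simp_all add: euler_add)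

lemma euler_mult: "euler (A * B) = euler A * B + A * euler B"
proof (rule mps_eqI)
  fix \<alpha>
  have "real (deg \<alpha>) *\<^sub>R (coef A \<beta> * coef B (\<alpha> - \<beta>)) =
      (real (deg \<beta>) *\<^sub>R coef A \<beta>) * coef B (\<alpha> - \<beta>) + coef A \<beta> * (real (deg (\<alpha> - \<beta>)) *\<^sub>R coef B (\<alpha> - \<beta>))"
    if "\<beta> \<le> \<alpha>" for \<beta>
    by (simp add: deg_diff[OF that, symmetric] algebra_simps)
  then show "coef (euler (A * B)) \<alpha> = coef (euler A * B + A * euler B) \<alpha>"
    by (simp add: coef_euler coef_mult coef_simps scaleR_sum_right sum.distrib[symmetric])
qed

lemma ord_ge_euler: "ord_ge d A \<Longrightarrow> ord_ge d (euler A)"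
  by (auto simp: ord_ge_def coef_euler)

section \<open>Formal exponential and series in the adjoint action\<close>

definition mexp :: "('n::finite, 'a::real_algebra_1) mps \<Rightarrow> ('n, 'a) mps" where
  "mexp X = Abs_mps (\<lambda>\<alpha>. \<Sum>m\<le>deg \<alpha>. (1 / fact m) *\<^sub>R coef (X ^ m) \<alpha>)"

definition mexp_upto :: "nat \<Rightarrow> ('n::finite, 'a::real_algebra_1) mps \<Rightarrow> ('n, 'a) mps" where
  "mexp_upto N X = (\<Sum>m\<le>N. (1 / fact m) *\<^sub>R X ^ m)"

text \<open>The power X^m has order at least m, so the cutoff at \<open>deg \<alpha>\<close> in
  \<open>mexp\<close> loses nothing when the constant term of X vanishes, and truncation at N is
  exact through degree N.\<close>

lemma mexp_upto_approx:
  assumes "ord_ge 1 X"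
  shows "ord_ge (Suc N) (mexp X - mexp_upto N X)"
  unfolding ord_ge_def
proof (intro allI impI)
  fix \<alpha> :: "'a \<Rightarrow> nat"
  assume \<alpha>: "deg \<alpha> < Suc N"
  have "(\<Sum>m\<le>N. (1 / fact m) *\<^sub>R coef (X ^ m) \<alpha>) = (\<Sum>m\<le>deg \<alpha>. (1 / fact m) *\<^sub>R coef (X ^ m) \<alpha>)"
    using \<alpha> ord_ge_power[OF assms] by (intro sum.mono_neutral_right) (auto simp: ord_ge_def)
  then show "coef (mexp X - mexp_upto N X) \<alpha> = 0"
    by (simp add: coef_simps mexp_def mexp_upto_def coef_sum)
qed

lemma coef_mexp_0 [simp]: "coef (mexp X) 0 = 1"
  by (simp add: mexp_def coef_simps)

definition ad :: "'a::ring_1 \<Rightarrow> 'a \<Rightarrow> 'a" where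
  "ad X Y = X * Y - Y * X"

text \<open>Left multiplication by X is the sum of \<open>ad X\<close> and right multiplication by
  X, and these two operators commute; this is the binomial theorem for their sum.\<close>

lemma power_mult_ad:
  fixes X :: "'a::real_algebra_1"
  shows "X ^ n * Y = (\<Sum>m\<le>n. real (n choose m) *\<^sub>R ((ad X ^^ m) Y * X ^ (n - m)))"
proof (induction n)
  case (Suc n)
  let ?t = "\<lambda>m k. (ad X ^^ m) Y * X ^ k"
  have step: "X * ?t m k = ?t (Suc m) k + ?t m (Suc k)" for m k
    by (simp add: ad_def algebra_simps)
  have "X ^ Suc n * Y = (\<Sum>m\<le>n. real (n choose m) *\<^sub>R (X * ?t m (n - m)))"
    by (simp add: mult.assoc Suc sum_distrib_left)
  also have "\<dots> = (\<Sum>m\<le>n. real (n choose m) *\<^sub>R ?t (Suc m) (n - m)) + (\<Sum>m\<le>n. real (n choose m) *\<^sub>R ?t m (Suc n - m))"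
    unfolding step by (simp add: scaleR_add_right sum.distrib Suc_diff_le)
  also have "(\<Sum>m\<le>n. real (n choose m) *\<^sub>R ?t m (Suc n - m)) = (\<Sum>m\<le>Suc n. real (n choose m) *\<^sub>R ?t m (Suc n - m))"
    by simp
  also have "\<dots> = ?t 0 (Suc n) + (\<Sum>m\<le>n. real (n choose Suc m) *\<^sub>R ?t (Suc m) (n - m))"
    by (subst sum.atMost_Suc_shift) simp
  finally have "X ^ Suc n * Y = ?t 0 (Suc n) + (\<Sum>m\<le>n. real (Suc n choose Suc m) *\<^sub>R ?t (Suc m) (n - m))"
    by (simp add: sum.distrib scaleR_add_left)
  then show ?case
    by (subst sum.atMost_Suc_shift) simp
qed simp

text \<open>By the Leibniz rule the left side is the sum of the terms X^i (\<open>euler X\<close>)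
  X^(n-1-i). Carrying X^i across as in \<open>power_mult_ad\<close> produces the coefficients
  \<open>i choose m\<close>, whose sum over i < n is \<open>n choose Suc m\<close>.\<close>

lemma euler_power_ad:
  fixes X :: "('n::finite, 'a::real_algebra_1) mps"
  shows "euler (X ^ n) = (\<Sum>m<n. real (n choose Suc m) *\<^sub>R ((ad X ^^ m) (euler X) * X ^ (n - Suc m)))"
proof (induction n)
  case (Suc n)
  let ?t = "\<lambda>m k. (ad X ^^ m) (euler X) * X ^ k"
  have step: "X * ?t m k = ?t (Suc m) k + ?t m (Suc k)" for m k
    by (simp add: ad_def algebra_simps)
  have "euler (X ^ Suc n) = ?t 0 n + (\<Sum>m<n. real (n choose Suc m) *\<^sub>R (X * ?t m (n - Suc m)))"
    by (simp add: euler_mult Suc sum_distrib_left)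
  also have "\<dots> = ?t 0 n + (\<Sum>m<n. real (n choose Suc m) *\<^sub>R ?t (Suc m) (n - Suc m))
      + (\<Sum>m<n. real (n choose Suc m) *\<^sub>R ?t m (n - m))"
  proof -
    have "Suc (n - Suc m) = n - m" if "m < n" for m using that by simp
    then show ?thesis unfolding step by (simp add: scaleR_add_right sum.distrib add.assoc)
  qed
  also have "?t 0 n + (\<Sum>m<n. real (n choose Suc m) *\<^sub>R ?t (Suc m) (n - Suc m)) =
      (\<Sum>m<Suc n. real (n choose m) *\<^sub>R ?t m (n - m))"
    by (subst sum.lessThan_Suc_shift) simp
  also have "(\<Sum>m<n. real (n choose Suc m) *\<^sub>R ?t m (n - m)) = (\<Sum>m<Suc n. real (n choose Suc m) *\<^sub>R ?t m (n - m))"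
    by simp
  finally show ?case
    by (simp add: sum.distrib[symmetric] scaleR_add_left del: sum.lessThan_Suc)
qed simp

lemma ord_ge_ad_power:
  assumes "ord_ge 1 X" "ord_ge d Y"
  shows "ord_ge (d + m) ((ad X ^^ m) Y)"
proof (induction m)
  case (Suc m)
  show ?case
    using ord_ge_mult[OF assms(1) Suc] ord_ge_mult[OF Suc assms(1)]
    by (simp add: ad_def ord_ge_diff)
qed (simp add: assms)

text \<open>A power series with coefficients w in the operator \<open>ad X\<close>, applied to Y.
  The weights \<open>1 / fact m\<close> give conjugation by exp X; the weights
  \<open>1 / fact (Suc m)\<close> give (exp(ad X) - 1) / ad X, the factor in the derivative of
  exp.\<close>

definition ad_series :: "(nat \<Rightarrow> real) \<Rightarrow> ('n::finite, 'a::real_algebra_1) mps \<Rightarrow> ('n, 'a) mps \<Rightarrow> ('n, 'a) mps" where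
  "ad_series w X Y = Abs_mps (\<lambda>\<alpha>. \<Sum>m\<le>deg \<alpha>. w m *\<^sub>R coef ((ad X ^^ m) Y) \<alpha>)"

lemma ad_series_approx:
  assumes "ord_ge 1 X"
  shows "ord_ge (Suc N) (ad_series w X Y - (\<Sum>m\<le>N. w m *\<^sub>R (ad X ^^ m) Y))"
  unfolding ord_ge_def
proof (intro allI impI)
  fix \<alpha> :: "'a \<Rightarrow> nat"
  assume \<alpha>: "deg \<alpha> < Suc N"
  have "(\<Sum>m\<le>N. w m *\<^sub>R coef ((ad X ^^ m) Y) \<alpha>) = (\<Sum>m\<le>deg \<alpha>. w m *\<^sub>R coef ((ad X ^^ m) Y) \<alpha>)"
    using \<alpha> ord_ge_ad_power[OF assms ord_ge_0, of _ Y]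
    by (intro sum.mono_neutral_right) (auto simp: ord_ge_def)
  then show "coef (ad_series w X Y - (\<Sum>m\<le>N. w m *\<^sub>R (ad X ^^ m) Y)) \<alpha> = 0"
    by (simp add: coef_simps ad_series_def coef_sum)
qed

lemma ord_ge_mult_approx:
  assumes "ord_ge N (A - A')" "ord_ge N (B - B')"
  shows "ord_ge N (A * B - A' * B')"
proof -
  have "A * B - A' * B' = (A - A') * B + A' * (B - B')"
    by (simp add: algebra_simps)
  moreover have "ord_ge N ((A - A') * B)" "ord_ge N (A' * (B - B'))"
    using ord_ge_mult[OF assms(1) ord_ge_0] ord_ge_mult[OF ord_ge_0 assms(2)] by auto
  ultimately show ?thesis by (simp add: ord_ge_add)
qed

lemma ord_ge_cong_trans:
  "ord_ge N (A - B) \<Longrightarrow> ord_ge N (B - C) \<Longrightarrow> ord_ge N (A - C)"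
  using ord_ge_add[of N "A - B" "B - C"] by simp

lemma ord_ge_cong_sym: "ord_ge N (A - B) \<Longrightarrow> ord_ge N (B - A)"
  using ord_ge_diff[of N 0 "A - B"] by simp

text \<open>A product of two sums up to N is a sum over a square, its Cauchy form a sum over the
  triangle \<open>m + k \<le> N\<close>. A term outside the triangle has m brackets with X and k
  factors X besides Y, hence order at least N + 1 + d.\<close>

lemma sum_triangle_ad:
  fixes X :: "('n::finite, 'a::real_algebra_1) mps"
  assumes "ord_ge 1 X" "ord_ge d Y"
  shows "ord_ge (Suc N + d) ((\<Sum>m\<le>N. w m *\<^sub>R (ad X ^^ m) Y) * mexp_upto N X
     - (\<Sum>n\<le>N. \<Sum>m\<le>n. (w m / fact (n - m)) *\<^sub>R ((ad X ^^ m) Y * X ^ (n - m))))"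
proof -
  let ?t = "\<lambda>m k. (w m / fact k) *\<^sub>R ((ad X ^^ m) Y * X ^ k)"
  have "(\<Sum>m\<le>N. w m *\<^sub>R (ad X ^^ m) Y) * mexp_upto N X = (\<Sum>(m,k)\<in>{..N}\<times>{..N}. ?t m k)"
    by (simp add: mexp_upto_def sum_product sum.cartesian_product field_simps)
  moreover have "(\<Sum>n\<le>N. \<Sum>m\<le>n. ?t m (n - m)) = (\<Sum>(m,k)\<in>{(m,k). m + k \<le> N}. ?t m k)"
    by (subst sum.Sigma; (simp; fail)?)
      (rule sum.reindex_bij_witness[where i = "\<lambda>(m,k). (m+k,m)" and j = "\<lambda>(n,m). (m,n-m)"], auto)
  moreover have "(\<Sum>(m,k)\<in>{..N}\<times>{..N}. ?t m k) = (\<Sum>(m,k)\<in>{(m,k). m + k \<le> N}. ?t m k)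
      + (\<Sum>(m,k)\<in>{..N}\<times>{..N} - {(m,k). m + k \<le> N}. ?t m k)"
    by (subst add.commute, rule sum.subset_diff) auto
  ultimately have "(\<Sum>m\<le>N. w m *\<^sub>R (ad X ^^ m) Y) * mexp_upto N X - (\<Sum>n\<le>N. \<Sum>m\<le>n. ?t m (n - m)) =
     (\<Sum>(m,k)\<in>{..N}\<times>{..N} - {(m,k). m + k \<le> N}. ?t m k)"
    by simp
  moreover have "ord_ge (Suc N + d) (?t m k)" if "\<not> m + k \<le> N" for m k
    using ord_ge_mult[OF ord_ge_ad_power[OF assms, of m] ord_ge_power[OF assms(1), of k]] that
    by (intro ord_ge_scaleR) (erule ord_ge_mono, linarith)
  ultimately show ?thesis
    by (auto intro!: ord_ge_sum)
qed

text \<open>The rule exp(X) Y exp(-X) = exp(ad X) Y, with the inverse moved to the other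
  side.\<close>

lemma mexp_mult_ad:
  assumes "ord_ge 1 X"
  shows "mexp X * Y = ad_series (\<lambda>m. 1 / fact m) X Y * mexp X"
proof (rule eq_if_ord_ge)
  fix N
  have c: "real (n choose m) / fact n = 1 / (fact m * fact (n - m))" if "m \<le> n" for m n
    using that by (simp add: binomial_fact divide_simps)
  have "mexp_upto N X * Y = (\<Sum>n\<le>N. \<Sum>m\<le>n. ((1 / fact m) / fact (n - m)) *\<^sub>R ((ad X ^^ m) Y * X ^ (n - m)))"
    by (simp add: mexp_upto_def sum_distrib_right power_mult_ad scaleR_sum_right c)
  then have 1: "ord_ge (Suc N) ((\<Sum>m\<le>N. (1 / fact m) *\<^sub>R (ad X ^^ m) Y) * mexp_upto N X - mexp_upto N X * Y)"
    using sum_triangle_ad[OF assms ord_ge_0, of N "\<lambda>m. 1 / fact m" Y] by simp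
  have 2: "ord_ge (Suc N) (mexp X * Y - mexp_upto N X * Y)"
    by (rule ord_ge_mult_approx) (simp_all add: mexp_upto_approx[OF assms])
  have 3: "ord_ge (Suc N) (ad_series (\<lambda>m. 1 / fact m) X Y * mexp X - (\<Sum>m\<le>N. (1 / fact m) *\<^sub>R (ad X ^^ m) Y) * mexp_upto N X)"
    by (rule ord_ge_mult_approx) (simp_all add: mexp_upto_approx[OF assms] ad_series_approx[OF assms])
  show "ord_ge N (mexp X * Y - ad_series (\<lambda>m. 1 / fact m) X Y * mexp X)"
    using 1 2 3 by (meson ord_ge_cong_trans ord_ge_cong_sym ord_ge_mono le_SucI order_refl)
qed

text \<open>The noncommutative chain rule: the logarithmic derivative of exp X is (exp(ad X) - 1) /
  ad X applied to the derivative of X, a series of iterated brackets.\<close>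

lemma euler_mexp:
  assumes "ord_ge 1 X"
  shows "euler (mexp X) = ad_series (\<lambda>m. 1 / fact (Suc m)) X (euler X) * mexp X"
proof (rule eq_if_ord_ge)
  fix N
  let ?w = "\<lambda>m. 1 / fact (Suc m) :: real"
  have c: "real (Suc n choose Suc m) / fact (Suc n) = ?w m / fact (n - m)" if "m \<le> n" for m n
    using binomial_fact[of "Suc m" "Suc n", where 'a = real] that
    by (simp add: divide_simps del: fact_Suc binomial_Suc_Suc)
  \<comment> \<open>The cutoff \<open>Suc N\<close> fits the triangle: the derivative of X^(n+1)
    consists of terms with n factors X besides the differentiated one, and the constant term of exp
    disappears.\<close>
  have "euler (mexp_upto (Suc N) X) = (\<Sum>n\<le>Suc N. (1 / fact n) *\<^sub>R euler (X ^ n))"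
    by (simp only: mexp_upto_def euler_sum euler_scaleR)
  also have "\<dots> = (\<Sum>n\<le>N. (1 / fact (Suc n)) *\<^sub>R euler (X ^ Suc n))"
    by (subst sum.atMost_Suc_shift) simp
  also have "\<dots> = (\<Sum>n\<le>N. \<Sum>m\<le>n. (?w m / fact (n - m)) *\<^sub>R ((ad X ^^ m) (euler X) * X ^ (n - m)))"
  proof (intro sum.cong refl)
    fix n
    have "(1 / fact (Suc n)) *\<^sub>R euler (X ^ Suc n) =
       (\<Sum>m\<le>n. (real (Suc n choose Suc m) / fact (Suc n)) *\<^sub>R ((ad X ^^ m) (euler X) * X ^ (n - m)))"
      unfolding euler_power_ad by (simp add: scaleR_sum_right lessThan_Suc_atMost del: power_Suc fact_Suc binomial_Suc_Suc)
    then show "(1 / fact (Suc n)) *\<^sub>R euler (X ^ Suc n) =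
       (\<Sum>m\<le>n. (?w m / fact (n - m)) *\<^sub>R ((ad X ^^ m) (euler X) * X ^ (n - m)))"
      using c by (simp del: fact_Suc binomial_Suc_Suc power_Suc)
  qed
  finally have 1: "ord_ge (Suc N) ((\<Sum>m\<le>N. ?w m *\<^sub>R (ad X ^^ m) (euler X)) * mexp_upto N X - euler (mexp_upto (Suc N) X))"
    using sum_triangle_ad[OF assms ord_ge_0, of N ?w "euler X"] by simp
  have 2: "ord_ge (Suc N) (euler (mexp X) - euler (mexp_upto (Suc N) X))"
    unfolding euler_diff[symmetric]
    by (rule ord_ge_euler) (rule ord_ge_mono[OF mexp_upto_approx[OF assms]], simp)
  have 3: "ord_ge (Suc N) (ad_series ?w X (euler X) * mexp X - (\<Sum>m\<le>N. ?w m *\<^sub>R (ad X ^^ m) (euler X)) * mexp_upto N X)"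
    by (rule ord_ge_mult_approx) (simp_all add: mexp_upto_approx[OF assms] ad_series_approx[OF assms])
  show "ord_ge N (euler (mexp X) - ad_series ?w X (euler X) * mexp X)"
    using 1 2 3 by (meson ord_ge_cong_trans ord_ge_cong_sym ord_ge_mono le_SucI order_refl)
qed

section \<open>Exponentials of series with coefficients in a Lie algebra\<close>

definition lie_subspace :: "'a::real_algebra_1 set \<Rightarrow> bool" where
  "lie_subspace L \<longleftrightarrow> subspace L \<and> (\<forall>x\<in>L. \<forall>y\<in>L. ad x y \<in> L)"

definition series_in :: "'a set \<Rightarrow> ('n::finite, 'a::real_algebra_1) mps set" where
  "series_in L = {X. \<forall>\<alpha>. coef X \<alpha> \<in> L}"

lemma series_in_D: "X \<in> series_in L \<Longrightarrow> coef X \<alpha> \<in> L"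
  by (simp add: series_in_def)

lemma sum_multi_rev:
  "(\<Sum>\<beta>\<le>\<alpha>. f \<beta> (\<alpha> - \<beta>)) = (\<Sum>\<beta>\<le>(\<alpha> :: 'n::finite \<Rightarrow> nat). f (\<alpha> - \<beta>) \<beta>)"
  by (rule sum.reindex_bij_witness[where i = "\<lambda>\<beta>. \<alpha> - \<beta>" and j = "\<lambda>\<beta>. \<alpha> - \<beta>"])
    (auto simp: le_fun_def fun_eq_iff intro!: arg_cong2[where f = f])

text \<open>Since the variables commute with the coefficients, a coefficient of a bracket of series
  is a sum of brackets of coefficients.\<close>

lemma series_in_ad:
  assumes "lie_subspace L" "X \<in> series_in L" "Y \<in> series_in L"
  shows "ad X Y \<in> series_in L"
proof -
  have "coef (ad X Y) \<alpha> = (\<Sum>\<beta>\<le>\<alpha>. ad (coef X \<beta>) (coef Y (\<alpha> - \<beta>)))" for \<alpha>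
    unfolding ad_def coef_diff coef_mult sum_subtractf
    by (subst sum_multi_rev[of "\<lambda>a b. coef Y a * coef X b"]) simp
  then show ?thesis
    using assms by (auto simp: series_in_def lie_subspace_def intro!: subspace_sum)
qed

lemma series_in_ad_series:
  assumes "lie_subspace L" "X \<in> series_in L" "Y \<in> series_in L"
  shows "ad_series w X Y \<in> series_in L"
proof -
  have "(ad X ^^ m) Y \<in> series_in L" for m
    by (induction m) (simp_all add: assms series_in_ad)
  then show ?thesis
    using assms(1) by (auto simp: series_in_def lie_subspace_def ad_series_def intro!: subspace_sum subspace_scale)
qed

lemma series_in_add: "subspace L \<Longrightarrow> X \<in> series_in L \<Longrightarrow> Y \<in> series_in L \<Longrightarrow> X + Y \<in> series_in L"
  by (simp add: series_in_def coef_simps subspace_add)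

lemma series_in_euler: "subspace L \<Longrightarrow> X \<in> series_in L \<Longrightarrow> euler X \<in> series_in L"
  by (simp add: series_in_def coef_euler subspace_scale)

text \<open>The logarithmic derivative of exp X exp Y is that of exp X plus the conjugate by exp X
  of that of exp Y. Both are series of iterated brackets, so they have coefficients in
  \<open>L\<close> even though the product of exponentials does not.\<close>

lemma euler_mexp_mult_in:
  assumes L: "lie_subspace L" and X: "X \<in> series_in L" "ord_ge 1 X"
    and Y: "Y \<in> series_in L" "ord_ge 1 Y"
  shows "\<exists>U\<in>series_in L. euler (mexp X * mexp Y) = U * (mexp X * mexp Y)"
proof -
  let ?w = "\<lambda>m. 1 / fact (Suc m)"
  define U where "U = ad_series ?w X (euler X)"
  define V where "V = ad_series ?w Y (euler Y)"
  define W where "W = ad_series (\<lambda>m. 1 / fact m) X V"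
  have sub: "subspace L" using L by (simp add: lie_subspace_def)
  have "U \<in> series_in L" "V \<in> series_in L"
    using assms by (auto simp: U_def V_def series_in_ad_series series_in_euler sub)
  then have "U + W \<in> series_in L"
    using assms by (simp add: series_in_add sub W_def series_in_ad_series)
  moreover have "euler (mexp X * mexp Y) = (U + W) * (mexp X * mexp Y)"
  proof -
    have "euler (mexp X) = U * mexp X" "euler (mexp Y) = V * mexp Y"
      using euler_mexp X(2) Y(2) by (auto simp: U_def V_def)
    moreover have "mexp X * V = W * mexp X"
      using mexp_mult_ad[OF X(2), of V] by (simp add: W_def)
    ultimately show ?thesis
      by (simp add: euler_mult distrib_right flip: mult.assoc)
  qed
  ultimately show ?thesis by blast
qed

lemma mexp_0 [simp]: "mexp 0 = (1 :: ('n::finite, 'b::real_algebra_1) mps)"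
proof (rule mps_eqI)
  fix \<alpha> :: "'n \<Rightarrow> nat"
  have "coef (mexp 0 :: ('n, 'b) mps) \<alpha> = (\<Sum>m\<le>deg \<alpha>. if m = 0 then coef 1 \<alpha> else (0::'b))"
    unfolding mexp_def coef_Abs by (intro sum.cong) (auto simp: power_0_left coef_simps)
  then show "coef (mexp 0 :: ('n, 'b) mps) \<alpha> = coef 1 \<alpha>" by simp
qed

lemma coef_mult_0:
  fixes A B :: "('n::finite, 'a::real_algebra_1) mps"
  shows "coef (A * B) 0 = coef A 0 * coef B 0"
proof -
  have "{..0::'n \<Rightarrow> nat} = {0}" by (auto simp: le_fun_def fun_eq_iff)
  moreover have "0 - 0 = (0 :: 'n \<Rightarrow> nat)" by (simp add: fun_eq_iff)
  ultimately show ?thesis by (simp add: coef_mult)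
qed

text \<open>A series with constant term 1 is determined by its logarithmic Euler derivative, so two
  such series with logarithmic derivatives in \<open>L\<close> first differ by an element of \<open>L\<close>.  This replaces
  the Baker--Campbell--Hausdorff formula.\<close>

lemma log_euler_discrepancy:
  fixes P Q U V :: "('n::finite, 'a::real_algebra_1) mps"
  assumes L: "subspace L" and "U \<in> series_in L" "V \<in> series_in L"
    and P: "euler P = U * P" "coef P 0 = 1" and Q: "euler Q = V * Q" "coef Q 0 = 1"
    and agree: "ord_ge n (P - Q)" and \<alpha>: "deg \<alpha> = n"
  shows "coef P \<alpha> - coef Q \<alpha> \<in> L"
proof (cases "n = 0")
  case True
  then have "\<alpha> = 0" using \<alpha> by (simp add: deg_eq_0_iff)
  then show ?thesis using P Q subspace_0[OF L] by simp
next
  case False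
  \<comment> \<open>The summand \<gamma> = \<beta> is split off. There \<open>coef A 0 = 1\<close>,
    so the top coefficient of W occurs with factor 1 and is determined by A and by lower
    coefficients of W.\<close>
  have rec: "real (deg \<beta>) *\<^sub>R coef A \<beta> = coef W \<beta> + (\<Sum>\<gamma>\<in>{..\<beta>} - {\<beta>}. coef W \<gamma> * coef A (\<beta> - \<gamma>))"
    if "euler A = W * A" "coef A 0 = 1" for A W and \<beta> :: "'n \<Rightarrow> nat"
  proof -
    have "real (deg \<beta>) *\<^sub>R coef A \<beta> = (\<Sum>\<gamma>\<le>\<beta>. coef W \<gamma> * coef A (\<beta> - \<gamma>))"
      using that by (metis coef_euler coef_mult)
    also have "\<dots> = coef W \<beta> * coef A (\<beta> - \<beta>) + (\<Sum>\<gamma>\<in>{..\<beta>} - {\<beta>}. coef W \<gamma> * coef A (\<beta> - \<gamma>))"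
      by (rule sum.remove) auto
    finally show ?thesis using that by simp
  qed
  have deg_less: "deg \<gamma> < deg \<beta>" if "\<gamma> \<in> {..\<beta>} - {\<beta>}" for \<beta> \<gamma> :: "'n \<Rightarrow> nat"
    using that deg_diff[of \<gamma> \<beta>] multi_diff_eq_iff[of \<gamma> \<beta>] deg_eq_0_iff[of "\<beta> - \<gamma>"] by auto
  have PQ: "coef P \<beta> = coef Q \<beta>" if "deg \<beta> < n" for \<beta>
    using agree that by (auto simp: ord_ge_def coef_simps)
  have UV: "deg \<beta> < n \<Longrightarrow> coef U \<beta> = coef V \<beta>" for \<beta>
  proof (induction "deg \<beta>" arbitrary: \<beta> rule: less_induct)
    case less
    have "(\<Sum>\<gamma>\<in>{..\<beta>} - {\<beta>}. coef U \<gamma> * coef P (\<beta> - \<gamma>)) = (\<Sum>\<gamma>\<in>{..\<beta>} - {\<beta>}. coef V \<gamma> * coef Q (\<beta> - \<gamma>))"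
    proof (intro sum.cong refl)
      fix \<gamma> assume g: "\<gamma> \<in> {..\<beta>} - {\<beta>}"
      have "deg (\<beta> - \<gamma>) \<le> deg \<beta>" using deg_diff[of \<gamma> \<beta>] g by simp
      then show "coef U \<gamma> * coef P (\<beta> - \<gamma>) = coef V \<gamma> * coef Q (\<beta> - \<gamma>)"
        using less(1)[of \<gamma>] deg_less[OF g] less(2) PQ by simp
    qed
    then show ?case
      using rec[OF P, of \<beta>] rec[OF Q, of \<beta>] PQ[OF less(2)] by simp
  qed
  \<comment> \<open>In degree n the products can differ only at \<gamma> = 0, and there the factor
    \<open>coef U 0\<close> vanishes because an Euler derivative has no constant term. Hence the top
    coefficients of U and V differ by n times the difference of those of P and Q.\<close>
  have "(\<Sum>\<gamma>\<in>{..\<alpha>} - {\<alpha>}. coef U \<gamma> * coef P (\<alpha> - \<gamma>)) - (\<Sum>\<gamma>\<in>{..\<alpha>} - {\<alpha>}. coef V \<gamma> * coef Q (\<alpha> - \<gamma>))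
      = (\<Sum>\<gamma>\<in>{..\<alpha>} - {\<alpha>}. if \<gamma> = 0 then coef U 0 * (coef P \<alpha> - coef Q \<alpha>) else 0)"
    unfolding sum_subtractf[symmetric]
  proof (intro sum.cong refl)
    fix \<gamma> assume g: "\<gamma> \<in> {..\<alpha>} - {\<alpha>}"
    have "deg (\<alpha> - \<gamma>) + deg \<gamma> = deg \<alpha>" using deg_diff[of \<gamma> \<alpha>] g by simp
    moreover have "\<gamma> \<noteq> 0 \<Longrightarrow> deg \<gamma> \<noteq> 0" by (simp add: deg_eq_0_iff)
    ultimately show "coef U \<gamma> * coef P (\<alpha> - \<gamma>) - coef V \<gamma> * coef Q (\<alpha> - \<gamma>) =
        (if \<gamma> = 0 then coef U 0 * (coef P \<alpha> - coef Q \<alpha>) else 0)"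
      using UV[of \<gamma>] UV[of 0] deg_less[OF g] PQ[of "\<alpha> - \<gamma>"] \<alpha> False
      by (auto simp: algebra_simps fun_diff_def)
  qed
  also have "coef U 0 = 0"
    using rec[OF P, of 0] by (simp add: le_fun_def fun_eq_iff) (metis (mono_tags) P coef_euler coef_mult_0 deg_zero(2) mult.right_neutral of_nat_0 scale_zero_left)
  finally have "(\<Sum>\<gamma>\<in>{..\<alpha>} - {\<alpha>}. coef U \<gamma> * coef P (\<alpha> - \<gamma>)) - (\<Sum>\<gamma>\<in>{..\<alpha>} - {\<alpha>}. coef V \<gamma> * coef Q (\<alpha> - \<gamma>)) = 0"
    by (simp only: mult_zero_left if_cancel sum.neutral_const)
  then have "real (deg \<alpha>) *\<^sub>R (coef P \<alpha> - coef Q \<alpha>) = coef U \<alpha> - coef V \<alpha>"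
    using rec[OF P, of \<alpha>] rec[OF Q, of \<alpha>]
    by (metis (no_types, lifting) add_diff_cancel_right eq_iff_diff_eq_0 scaleR_diff_right)
  moreover have "coef U \<alpha> - coef V \<alpha> \<in> L"
    using assms by (simp add: subspace_diff series_in_D)
  ultimately have "(1 / real (deg \<alpha>)) *\<^sub>R (real (deg \<alpha>) *\<^sub>R (coef P \<alpha> - coef Q \<alpha>)) \<in> L"
    using L by (simp only: subspace_scale)
  then show ?thesis using False \<alpha> by simp
qed

text \<open>In the difference of two m-th powers with m at least 2, every term contains a factor X'
  - X of order d and another factor of positive order. Modulo order d + 1 only the linear term of
  exp notices the change.\<close>

lemma mexp_perturb:
  assumes X: "ord_ge 1 X" and d: "ord_ge d (X' - X)" "d \<ge> 1"
  shows "ord_ge (Suc d) (mexp X' - mexp X - (X' - X))"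
proof -
  have X': "ord_ge 1 X'"
    using ord_ge_add[OF X ord_ge_mono[OF d]] by simp
  have step: "X' ^ Suc m - X ^ Suc m = X' * (X' ^ m - X ^ m) + (X' - X) * X ^ m" for m
    by (simp add: algebra_simps)
  have pow: "ord_ge d (X' ^ m - X ^ m)" for m
  proof (induction m)
    case (Suc m)
    then show ?case
      unfolding step using ord_ge_mult[OF ord_ge_0 Suc, of X'] ord_ge_mult[OF d(1) ord_ge_0, of "X ^ m"]
      by (simp add: ord_ge_add)
  qed simp
  have pow2: "ord_ge (Suc d) (X' ^ Suc (Suc m) - X ^ Suc (Suc m))" for m
    unfolding step[of "Suc m"]
    using ord_ge_mult[OF X' pow, of "Suc m"] ord_ge_mult[OF d(1) ord_ge_power[OF X], of "Suc m"]
    by (intro ord_ge_add) (auto elim: ord_ge_mono)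
  have split: "mexp_upto (Suc d) Z = 1 + Z + (\<Sum>m<d. (1 / fact (Suc (Suc m))) *\<^sub>R Z ^ Suc (Suc m))"
    for Z :: "('a, 'b) mps"
    unfolding mexp_upto_def lessThan_Suc_atMost[symmetric]
    by (subst sum.lessThan_Suc_shift, subst sum.lessThan_Suc_shift) (simp add: add.assoc)
  have "mexp_upto (Suc d) X' - mexp_upto (Suc d) X - (X' - X) =
      (\<Sum>m<d. (1 / fact (Suc (Suc m))) *\<^sub>R (X' ^ Suc (Suc m) - X ^ Suc (Suc m)))"
    unfolding split by (simp add: scaleR_diff_right sum_subtractf del: fact_Suc power_Suc)
  moreover have "ord_ge (Suc d) \<dots>"
    by (intro ord_ge_sum ord_ge_scaleR pow2)
  ultimately have 1: "ord_ge (Suc d) (mexp_upto (Suc d) X' - mexp_upto (Suc d) X - (X' - X))"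
    by simp
  have "ord_ge (Suc d) (mexp X' - mexp_upto (Suc d) X')" "ord_ge (Suc d) (mexp X - mexp_upto (Suc d) X)"
    using mexp_upto_approx[OF X', of "Suc d"] mexp_upto_approx[OF X, of "Suc d"] by (auto elim: ord_ge_mono)
  from ord_ge_add[OF 1 ord_ge_diff[OF this]] show ?thesis
    by (simp add: algebra_simps)
qed

lemma mexp_cong_ord_ge:
  assumes X: "ord_ge 1 X" and d: "ord_ge d (X' - X)" "d \<ge> 1"
  shows "ord_ge d (mexp X' - mexp X)"
  using ord_ge_add[OF ord_ge_mono[OF mexp_perturb[OF assms]] d(1)] by simp

lemma ord_ge_1_mexp: "ord_ge 1 (mexp X - 1)"
  unfolding ord_ge_1_iff by (simp add: coef_simps)

section \<open>Algebra homomorphisms acting on coefficients\<close>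

definition map_mps :: "('a \<Rightarrow> 'a) \<Rightarrow> ('n::finite, 'a::real_algebra_1) mps \<Rightarrow> ('n, 'a) mps" where
  "map_mps s A = Abs_mps (\<lambda>\<alpha>. s (coef A \<alpha>))"

lemma coef_map_mps [simp]: "coef (map_mps s A) \<alpha> = s (coef A \<alpha>)"
  by (simp add: map_mps_def)

definition algebra_hom :: "('a::real_algebra_1 \<Rightarrow> 'a) \<Rightarrow> bool" where
  "algebra_hom s \<longleftrightarrow> linear s \<and> s 1 = 1 \<and> (\<forall>x y. s (x * y) = s x * s y)"

lemma map_mps_hom:
  assumes "algebra_hom s"
  shows map_mps_mult: "map_mps s (A * B) = map_mps s A * map_mps s B"
    and map_mps_add: "map_mps s (A + B) = map_mps s A + map_mps s B"
    and map_mps_diff: "map_mps s (A - B) = map_mps s A - map_mps s B"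
    and map_mps_1: "map_mps s 1 = 1"
    and ord_ge_map_mps: "ord_ge d A \<Longrightarrow> ord_ge d (map_mps s A)"
proof -
  have lin: "linear s" and s: "s 1 = 1" "s (x * y) = s x * s y" for x y
    using assms by (auto simp: algebra_hom_def)
  show "map_mps s (A * B) = map_mps s A * map_mps s B"
    "map_mps s (A + B) = map_mps s A + map_mps s B"
    "map_mps s (A - B) = map_mps s A - map_mps s B"
    "map_mps s 1 = 1"
    using lin s by (auto intro!: mps_eqI simp: coef_mult coef_simps linear_sum linear_add linear_diff linear_0)
  show "ord_ge d A \<Longrightarrow> ord_ge d (map_mps s A)"
    using lin by (auto simp: ord_ge_def linear_0)
qed

lemma map_mps_mexp:
  assumes "algebra_hom s"
  shows "map_mps s (mexp X) = mexp (map_mps s X)"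
proof (rule mps_eqI)
  fix \<alpha>
  have lin: "linear s" using assms by (auto simp: algebra_hom_def)
  have pow: "map_mps s (X ^ m) = map_mps s X ^ m" for m
    by (induction m) (simp_all add: map_mps_hom[OF assms])
  show "coef (map_mps s (mexp X)) \<alpha> = coef (mexp (map_mps s X)) \<alpha>"
    by (simp add: mexp_def linear_sum[OF lin] linear_scale[OF lin] flip: pow)
qed

text \<open>Obstruction theory: \<open>H\<^sup>2 = 0\<close> lets one lift a first-order cocycle degree by degree.\<close>

locale unobstructed =
  fixes L :: "'a::real_algebra_1 set" and G :: "'g set" and mul :: "'g \<Rightarrow> 'g \<Rightarrow> 'g"
    and s :: "'g \<Rightarrow> 'a \<Rightarrow> 'a"
  assumes L: "lie_subspace L"
    and mul: "\<And>g h. g \<in> G \<Longrightarrow> h \<in> G \<Longrightarrow> mul g h \<in> G"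
      "\<And>g h k. mul (mul g h) k = mul g (mul h k)"
    and hom: "\<And>g. g \<in> G \<Longrightarrow> algebra_hom (s g)"
    and s_mul: "\<And>g h x. g \<in> G \<Longrightarrow> h \<in> G \<Longrightarrow> s (mul g h) x = s h (s g x)"
    and s_L: "\<And>g x. g \<in> G \<Longrightarrow> x \<in> L \<Longrightarrow> s g x \<in> L"
    and H2: "\<And>c. \<lbrakk>\<And>g h. g \<in> G \<Longrightarrow> h \<in> G \<Longrightarrow> c g h \<in> L;
        \<And>g h k. g \<in> G \<Longrightarrow> h \<in> G \<Longrightarrow> k \<in> G \<Longrightarrow> c (mul g h) k + s k (c g h) = c g (mul h k) + c h k\<rbrakk>
      \<Longrightarrow> \<exists>b. (\<forall>g\<in>G. b g \<in> L) \<and> (\<forall>g\<in>G. \<forall>h\<in>G. c g h = s h (b g) + b h - b (mul g h))"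
begin

definition discr :: "('g \<Rightarrow> ('n::finite, 'a) mps) \<Rightarrow> 'g \<Rightarrow> 'g \<Rightarrow> ('n, 'a) mps" where
  "discr X g h = map_mps (s h) (mexp (X g)) * mexp (X h) - mexp (X (mul g h))"

text \<open>Level n means that the cocycle relation holds in all degrees up to and including n, so
  that the defect starts in degree n + 1.\<close>

definition lift_upto :: "nat \<Rightarrow> ('g \<Rightarrow> ('n::finite, 'a) mps) \<Rightarrow> bool" where
  "lift_upto n X \<longleftrightarrow> (\<forall>g\<in>G. X g \<in> series_in L \<and> ord_ge 1 (X g)) \<and>
     (\<forall>g\<in>G. \<forall>h\<in>G. ord_ge (Suc n) (discr X g h))"

text \<open>The product and the exponential it is compared with both have logarithmic Euler
  derivatives with coefficients in \<open>L\<close>; therefore their first difference lies in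
  \<open>L\<close>.\<close>

lemma discr_in:
  assumes X: "lift_upto n X" and "g \<in> G" "h \<in> G" and \<alpha>: "deg \<alpha> = Suc n"
  shows "coef (discr X g h) \<alpha> \<in> L"
proof -
  have sub: "subspace L" using L by (simp add: lie_subspace_def)
  have Xi: "X g \<in> series_in L" "ord_ge 1 (X g)" if "g \<in> G" for g
    using X that by (auto simp: lift_upto_def)
  have Xg: "map_mps (s h) (X g) \<in> series_in L" "ord_ge 1 (map_mps (s h) (X g))"
    using Xi[OF \<open>g \<in> G\<close>] \<open>h \<in> G\<close> by (auto simp: series_in_def s_L ord_ge_map_mps hom)
  have gh: "mul g h \<in> G" using assms mul by blast
  obtain U where U: "U \<in> series_in L"
    "euler (mexp (map_mps (s h) (X g)) * mexp (X h)) = U * (mexp (map_mps (s h) (X g)) * mexp (X h))"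
    using euler_mexp_mult_in[OF L Xg Xi[OF \<open>h \<in> G\<close>]] by blast
  \<comment> \<open>A single exponential is treated as its product with exp 0 = 1.\<close>
  obtain V where V: "V \<in> series_in L" "euler (mexp (X (mul g h))) = V * mexp (X (mul g h))"
    using euler_mexp_mult_in[OF L Xi[OF gh], of 0] subspace_0[OF sub]
    by (auto simp: series_in_def coef_simps)
  have "ord_ge (Suc n) (mexp (map_mps (s h) (X g)) * mexp (X h) - mexp (X (mul g h)))"
    using X assms by (auto simp: lift_upto_def discr_def map_mps_mexp hom)
  from log_euler_discrepancy[OF sub U(1) V(1) U(2) _ V(2) _ this \<alpha>]
  show ?thesis
    by (simp add: coef_mult_0 discr_def coef_simps map_mps_mexp hom \<open>h \<in> G\<close>)
qed

text \<open>The triple product, bracketed in two ways, gives an exact identity in which two of the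
  defects carry an exponential factor. These factors are 1 up to positive order, so the additive
  cocycle identity holds in the first degree where the defect can be nonzero.\<close>

lemma discr_cocycle:
  assumes X: "lift_upto n X" and g: "g \<in> G" and h: "h \<in> G" and k: "k \<in> G"
  shows "ord_ge (Suc (Suc n)) (discr X (mul g h) k + map_mps (s k) (discr X g h)
     - (discr X g (mul h k) + discr X h k))"
proof -
  let ?A = "\<lambda>g. mexp (X g)"
  have ord: "ord_ge (Suc n) (discr X g h)" if "g \<in> G" "h \<in> G" for g h
    using X that by (auto simp: lift_upto_def)
  have "discr X (mul g h) k + map_mps (s k) (discr X g h) * ?A k
      = discr X g (mul h k) + map_mps (s (mul h k)) (?A g) * discr X h k"
  proof -
    have "map_mps (s (mul h k)) (?A g) = map_mps (s k) (map_mps (s h) (?A g))"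
      using h k by (auto intro!: mps_eqI simp: s_mul)
    then show ?thesis
      unfolding discr_def using k by (simp add: map_mps_hom hom mul(2) algebra_simps)
  qed
  then have eq: "discr X (mul g h) k + map_mps (s k) (discr X g h) - (discr X g (mul h k) + discr X h k)
     = (map_mps (s (mul h k)) (?A g) - 1) * discr X h k - map_mps (s k) (discr X g h) * (?A k - 1)"
    by (simp add: algebra_simps)
  have hk: "mul h k \<in> G" using mul h k by blast
  have "ord_ge 1 (map_mps (s (mul h k)) (?A g) - 1)"
    using ord_ge_1_mexp ord_ge_map_mps[OF hom[OF hk] ord_ge_1_mexp[of "X g"]]
    by (simp add: map_mps_hom hom hk)
  from ord_ge_mult[OF this ord[OF h k]]
    ord_ge_mult[OF ord_ge_map_mps[OF hom[OF k] ord[OF g h]] ord_ge_1_mexp[of "X k"]]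
  show ?thesis
    unfolding eq by (intro ord_ge_diff) simp_all
qed

text \<open>Each multi-index of degree n + 1 carries its own 2-cocycle of defects. Subtracting a
  primitive of it from the corresponding coefficient of X cancels it, and the side effects begin one
  degree higher.\<close>

lemma lift_step:
  assumes X: "lift_upto n X"
  shows "\<exists>X'. lift_upto (Suc n) X' \<and> (\<forall>g\<in>G. ord_ge (Suc n) (X' g - X g))"
proof -
  have sub: "subspace L" using L by (simp add: lie_subspace_def)
  have "\<exists>b. (\<forall>g\<in>G. b g \<in> L) \<and> (\<forall>g\<in>G. \<forall>h\<in>G. coef (discr X g h) \<alpha> = s h (b g) + b h - b (mul g h))"
    if \<alpha>: "deg \<alpha> = Suc n" for \<alpha>
  proof (rule H2)
    fix g h k assume g: "g \<in> G" and h: "h \<in> G" and k: "k \<in> G"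
    show "coef (discr X (mul g h) k) \<alpha> + s k (coef (discr X g h) \<alpha>) = coef (discr X g (mul h k)) \<alpha> + coef (discr X h k) \<alpha>"
      using discr_cocycle[OF X g h k] \<alpha> by (simp add: ord_ge_def coef_simps)
  qed (rule discr_in[OF X _ _ \<alpha>])
  then obtain b where b: "\<And>\<alpha> g. deg \<alpha> = Suc n \<Longrightarrow> g \<in> G \<Longrightarrow> b \<alpha> g \<in> L"
    "\<And>\<alpha> g h. deg \<alpha> = Suc n \<Longrightarrow> g \<in> G \<Longrightarrow> h \<in> G \<Longrightarrow> coef (discr X g h) \<alpha> = s h (b \<alpha> g) + b \<alpha> h - b \<alpha> (mul g h)"
    by metis
  define t where "t g = Abs_mps (\<lambda>\<alpha>. if deg \<alpha> = Suc n then - b \<alpha> g else 0)" for g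
  define X' where "X' g = X g + t g" for g
  have t: "ord_ge (Suc n) (t g)" for g by (auto simp: t_def ord_ge_def)
  have t_in: "t g \<in> series_in L" if "g \<in> G" for g
    using b that by (auto simp: t_def series_in_def subspace_neg subspace_0 sub)
  have Xi: "X g \<in> series_in L" "ord_ge 1 (X g)" if "g \<in> G" for g
    using X that by (auto simp: lift_upto_def)
  have X'i: "X' g \<in> series_in L" "ord_ge 1 (X' g)" if "g \<in> G" for g
    using Xi[OF that] t_in[OF that] ord_ge_mono[OF t, of 1]
    by (auto simp: X'_def series_in_add sub ord_ge_add)
  define r where "r g = mexp (X' g) - mexp (X g) - t g" for g
  have r: "ord_ge (Suc (Suc n)) (r g)" if "g \<in> G" for g
    using mexp_perturb[OF Xi(2)[OF that], of "Suc n" "X' g"] t by (simp add: r_def X'_def)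
  have exp_eq: "mexp (X' g) = mexp (X g) + t g + r g" for g by (simp add: r_def)
  have "ord_ge (Suc (Suc n)) (discr X' g h)" if g: "g \<in> G" and h: "h \<in> G" for g h
  proof -
    note hm = map_mps_hom[OF hom[OF h]]
    let ?m = "map_mps (s h)"
    have gh: "mul g h \<in> G" using mul g h by blast
    \<comment> \<open>The first bracket is the linear effect of the correction and vanishes through
      degree n + 1; everything in the second bracket has order at least n + 2.\<close>
    have "discr X' g h = (discr X g h + ?m (t g) + t h - t (mul g h))
       + (?m (t g) * (mexp (X h) - 1) + (?m (mexp (X g)) - 1) * t h + ?m (t g) * t h
          + ?m (r g) * mexp (X' h) + ?m (mexp (X g) + t g) * r h - r (mul g h))"
      unfolding discr_def exp_eq by (simp add: hm algebra_simps)
    moreover have "ord_ge (Suc (Suc n)) (discr X g h + ?m (t g) + t h - t (mul g h))"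
      unfolding ord_ge_def
    proof (intro allI impI)
      fix \<alpha> :: "'b \<Rightarrow> nat" assume a: "deg \<alpha> < Suc (Suc n)"
      have lin: "linear (s h)" using hom[OF h] by (simp add: algebra_hom_def)
      show "coef (discr X g h + ?m (t g) + t h - t (mul g h)) \<alpha> = 0"
      proof (cases "deg \<alpha> = Suc n")
        case True
        then show ?thesis
          using b(2)[OF True g h] by (simp add: coef_simps t_def linear_neg[OF lin])
      next
        case False
        then have "deg \<alpha> < Suc n" using a by simp
        moreover have "ord_ge (Suc n) (discr X g h)" using X g h by (auto simp: lift_upto_def)
        ultimately show ?thesis
          using t by (simp add: coef_simps ord_ge_def linear_0[OF lin])
      qed
    qed
    moreover have "ord_ge (Suc (Suc n)) (?m (t g) * (mexp (X h) - 1))"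
      using ord_ge_mult[OF hm(5)[OF t] ord_ge_1_mexp] by simp
    moreover have "ord_ge (Suc (Suc n)) ((?m (mexp (X g)) - 1) * t h)"
      using ord_ge_mult[OF hm(5)[OF ord_ge_1_mexp] t] by (simp add: hm)
    moreover have "ord_ge (Suc (Suc n)) (?m (t g) * t h)"
      using ord_ge_mult[OF hm(5)[OF t] t] by (rule ord_ge_mono) simp
    moreover have "ord_ge (Suc (Suc n)) (?m (r g) * mexp (X' h))"
      using ord_ge_mult[OF hm(5)[OF r[OF g]] ord_ge_0] by simp
    moreover have "ord_ge (Suc (Suc n)) (?m (mexp (X g) + t g) * r h)"
      using ord_ge_mult[OF ord_ge_0 r[OF h]] by simp
    ultimately show ?thesis
      using r[OF gh] by (simp only: ord_ge_add ord_ge_diff)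
  qed
  then have "lift_upto (Suc n) X'"
    using X'i by (simp add: lift_upto_def)
  then show ?thesis
    using t by (auto simp: X'_def)
qed

theorem lift_cocycle:
  fixes X0 :: "'g \<Rightarrow> ('n::finite, 'a) mps"
  assumes X0: "\<And>g. g \<in> G \<Longrightarrow> X0 g \<in> series_in L" "\<And>g. g \<in> G \<Longrightarrow> ord_ge 1 (X0 g)"
    and cocycle: "\<And>g h. g \<in> G \<Longrightarrow> h \<in> G \<Longrightarrow> ord_ge 2 (map_mps (s h) (X0 g) + X0 h - X0 (mul g h))"
  shows "\<exists>X. (\<forall>g\<in>G. X g \<in> series_in L \<and> ord_ge 1 (X g) \<and> ord_ge 2 (X g - X0 g)) \<and>
    (\<forall>g\<in>G. \<forall>h\<in>G. mexp (X (mul g h)) = map_mps (s h) (mexp (X g)) * mexp (X h))"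
proof -
  have "lift_upto 1 X0"
    unfolding lift_upto_def
  proof (intro conjI ballI)
    fix g h assume g: "g \<in> G" and h: "h \<in> G"
    note hm = map_mps_hom[OF hom[OF h]]
    define r where "r g = mexp (X0 g) - 1 - X0 g" for g
    have exp_eq: "mexp (X0 g) = 1 + X0 g + r g" for g by (simp add: r_def)
    have r: "ord_ge 2 (r g)" if "g \<in> G" for g
      using mexp_perturb[of 0 1 "X0 g"] X0(2)[OF that] by (simp add: r_def numeral_2_eq_2)
    let ?m = "map_mps (s h)"
    have gh: "mul g h \<in> G" using mul g h by blast
    have "discr X0 g h = (?m (X0 g) + X0 h - X0 (mul g h))
        + (?m (X0 g) * X0 h + ?m (r g) * mexp (X0 h) + ?m (1 + X0 g) * r h - r (mul g h))"
      unfolding discr_def exp_eq by (simp add: hm algebra_simps)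
    moreover have "ord_ge 2 (?m (X0 g) * X0 h)"
      using ord_ge_mult[OF hm(5)[OF X0(2)[OF g]] X0(2)[OF h]] by (simp add: numeral_2_eq_2)
    moreover have "ord_ge 2 (?m (r g) * mexp (X0 h))" "ord_ge 2 (?m (1 + X0 g) * r h)"
      using ord_ge_mult[OF hm(5)[OF r[OF g]] ord_ge_0] ord_ge_mult[OF ord_ge_0 r[OF h]]
      by (simp_all add: numeral_2_eq_2)
    ultimately show "ord_ge (Suc 1) (discr X0 g h)"
      using cocycle[OF g h] r[OF gh] by (simp add: numeral_2_eq_2 ord_ge_add ord_ge_diff)
  qed (use X0 in auto)
  then obtain Y where Y0: "Y 0 = X0" and Y: "\<And>n. lift_upto (Suc n) (Y n)"
    and Yd: "\<And>n. \<forall>g\<in>G. ord_ge (Suc (Suc n)) (Y (Suc n) g - Y n g)"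
    using dependent_nat_choice[of "\<lambda>n Y. lift_upto (Suc n) Y \<and> (n = 0 \<longrightarrow> Y = X0)"
        "\<lambda>n Y Y'. \<forall>g\<in>G. ord_ge (Suc (Suc n)) (Y' g - Y g)"] lift_step
    by (metis One_nat_def nat.distinct(1))
  have Ym: "ord_ge (Suc (Suc n)) (Y (n + m) g - Y n g)" if g: "g \<in> G" for n m g
  proof (induction m)
    case (Suc m)
    have "ord_ge (Suc (Suc n)) (Y (n + Suc m) g - Y (n + m) g)"
      using bspec[OF Yd[of "n + m"] g] by (auto intro: ord_ge_mono)
    then show ?case using Suc by (rule ord_ge_cong_trans)
  qed simp
  \<comment> \<open>\<open>Y n\<close> satisfies the relation through degree n + 1 and later steps
    change only degrees from n + 2 on, so the coefficients of degree d can safely be read off from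
    \<open>Y d\<close>.\<close>
  define X where "X g = Abs_mps (\<lambda>\<alpha>. coef (Y (deg \<alpha>) g) \<alpha>)" for g
  have XY: "ord_ge (Suc (Suc n)) (X g - Y n g)" if g: "g \<in> G" for n g
    unfolding ord_ge_def
  proof (intro allI impI)
    fix \<alpha> :: "'n \<Rightarrow> nat" assume a: "deg \<alpha> < Suc (Suc n)"
    show "coef (X g - Y n g) \<alpha> = 0"
    proof (cases "deg \<alpha> \<le> n")
      case True
      then obtain m where "n = deg \<alpha> + m" using le_Suc_ex by blast
      then show ?thesis
        using Ym[OF g, of "deg \<alpha>" m] by (simp add: X_def coef_simps ord_ge_def)
    next
      case False
      then have "deg \<alpha> = Suc n" using a by simp
      then show ?thesis
        using Ym[OF g, of n 1] by (simp add: X_def coef_simps ord_ge_def)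
    qed
  qed
  have Yi: "Y n g \<in> series_in L" "ord_ge 1 (Y n g)" if "g \<in> G" for n g
    using Y[of n] that by (auto simp: lift_upto_def)
  have Xi: "X g \<in> series_in L" "ord_ge 1 (X g)" if "g \<in> G" for g
    using Yi[OF that] by (auto simp: X_def series_in_def ord_ge_def)
  have XX: "ord_ge n (mexp (X g) - mexp (Y n g))" if "g \<in> G" for n g
    using mexp_cong_ord_ge[OF Yi(2)[OF that] XY[OF that]] by (rule ord_ge_mono) simp_all
  have "mexp (X (mul g h)) = map_mps (s h) (mexp (X g)) * mexp (X h)" if g: "g \<in> G" and h: "h \<in> G" for g h
  proof (rule eq_if_ord_ge)
    fix n
    have gh: "mul g h \<in> G" using mul g h by blast
    have 1: "ord_ge n (map_mps (s h) (mexp (X g)) * mexp (X h) - map_mps (s h) (mexp (Y n g)) * mexp (Y n h))"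
      using ord_ge_map_mps[OF hom[OF h] XX[OF g, of n]] XX[OF h, of n]
      by (intro ord_ge_mult_approx) (simp_all add: map_mps_hom hom h)
    have "ord_ge (Suc (Suc n)) (map_mps (s h) (mexp (Y n g)) * mexp (Y n h) - mexp (Y n (mul g h)))"
      using Y[of n] g h by (auto simp: lift_upto_def discr_def)
    then have "ord_ge n (map_mps (s h) (mexp (Y n g)) * mexp (Y n h) - mexp (Y n (mul g h)))"
      by (rule ord_ge_mono) simp
    then show "ord_ge n (mexp (X (mul g h)) - map_mps (s h) (mexp (X g)) * mexp (X h))"
      using 1 XX[OF gh, of n] by (meson ord_ge_cong_trans ord_ge_cong_sym)
  qed
  moreover have "ord_ge 2 (X g - X0 g)" if "g \<in> G" for g
    using XY[OF that, of 0] by (simp add: Y0 numeral_2_eq_2)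
  ultimately show ?thesis using Xi by blast
qed

end

section \<open>Moebius transformations of the upper half plane\<close>

lemma open_upper_half [simp]: "open upper_half"
  unfolding upper_half_def by (simp add: open_halfspace_Im_gt)

lemma convex_upper_half [simp]: "convex upper_half"
  unfolding upper_half_def by (simp add: convex_halfspace_Im_gt)

lemma SL2_iff: "g \<in> SL2 \<longleftrightarrow> g$1$1 * g$2$2 - g$1$2 * g$2$1 = 1"
  by (simp add: SL2_def det_2)

lemma SL2_mult [intro]: "g \<in> SL2 \<Longrightarrow> h \<in> SL2 \<Longrightarrow> g ** h \<in> SL2"
  by (simp add: SL2_def det_mul)

lemma mat2_mult_nth:
  fixes g h :: "real^2^2"
  shows "(g ** h)$i$j = g$i$1 * h$1$j + g$i$2 * h$2$j"
  by (simp add: matrix_matrix_mult_def sum_2)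

lemma jfac_nonzero: "g \<in> SL2 \<Longrightarrow> z \<in> upper_half \<Longrightarrow> jfac g z \<noteq> 0"
  by (auto simp: jfac_def complex_eq_iff upper_half_def SL2_iff)

lemma Im_moeb:
  assumes "g \<in> SL2"
  shows "Im (moeb g z) = Im z / (norm (jfac g z))\<^sup>2"
proof -
  have D: "(norm (jfac g z))\<^sup>2 = (g$2$1 * Re z + g$2$2)\<^sup>2 + (g$2$1 * Im z)\<^sup>2"
    by (simp add: jfac_def cmod_power2)
  have "Im (moeb g z) = (g$1$1 * Im z * (g$2$1 * Re z + g$2$2) - (g$1$1 * Re z + g$1$2) * (g$2$1 * Im z)) / (norm (jfac g z))\<^sup>2"
    unfolding D by (simp add: moeb_def Im_divide)
  also have "g$1$1 * Im z * (g$2$1 * Re z + g$2$2) - (g$1$1 * Re z + g$1$2) * (g$2$1 * Im z) = (g$1$1 * g$2$2 - g$1$2 * g$2$1) * Im z"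
    by (simp add: algebra_simps)
  finally have "Im (moeb g z) = (g$1$1 * g$2$2 - g$1$2 * g$2$1) * Im z / (norm (jfac g z))\<^sup>2" .
  then show ?thesis using assms by (simp add: SL2_iff)
qed

lemma moeb_upper_half_iff:
  assumes "g \<in> SL2"
  shows "moeb g z \<in> upper_half \<longleftrightarrow> z \<in> upper_half"
proof
  assume "z \<in> upper_half"
  then show "moeb g z \<in> upper_half"
    using jfac_nonzero[OF assms, of z] by (simp add: upper_half_def Im_moeb assms)
next
  assume "moeb g z \<in> upper_half"
  then show "z \<in> upper_half"
    by (simp add: upper_half_def Im_moeb assms zero_less_divide_iff)
qed

lemma jfac_mult:
  assumes "h \<in> SL2" "z \<in> upper_half"
  shows "jfac (g ** h) z = jfac g (moeb h z) * jfac h z"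
  using jfac_nonzero[OF assms]
  by (simp add: jfac_def moeb_def mat2_mult_nth field_simps)

lemma moeb_mult:
  assumes "g \<in> SL2" "h \<in> SL2" "z \<in> upper_half"
  shows "moeb (g ** h) z = moeb g (moeb h z)"
proof -
  have j: "jfac h z \<noteq> 0" "jfac g (moeb h z) \<noteq> 0"
    using assms jfac_nonzero[of h z] jfac_nonzero[of g "moeb h z"] by (simp_all add: moeb_upper_half_iff)
  have "moeb (g ** h) z = (of_real (g$1$1) * moeb h z + of_real (g$1$2)) * jfac h z / jfac (g ** h) z"
  proof -
    have "moeb h z * jfac h z = of_real (h$1$1) * z + of_real (h$1$2)"
      using j(1) by (simp add: moeb_def jfac_def)
    moreover have "(of_real (g$1$1) * moeb h z + of_real (g$1$2)) * jfac h z =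
        of_real (g$1$1) * (moeb h z * jfac h z) + of_real (g$1$2) * jfac h z"
      by (simp add: algebra_simps)
    ultimately have "(of_real (g$1$1) * moeb h z + of_real (g$1$2)) * jfac h z =
        of_real (g$1$1) * (of_real (h$1$1) * z + of_real (h$1$2)) + of_real (g$1$2) * jfac h z"
      by (simp only:)
    then show ?thesis
      by (simp add: moeb_def[of "g ** h"] jfac_def mat2_mult_nth algebra_simps)
  qed
  then show ?thesis
    using j by (simp add: jfac_mult assms moeb_def[of g] jfac_def[of g])
qed

lemma moeb_one [simp]: "moeb (mat 1) z = z" "jfac (mat 1) z = 1"
  by (simp_all add: moeb_def jfac_def mat_def)

definition SL2_inv :: "real^2^2 \<Rightarrow> real^2^2" where
  "SL2_inv g = vector [vector [g$2$2, - (g$1$2)], vector [- (g$2$1), g$1$1]]"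

lemma SL2_inv_nth [simp]:
  "SL2_inv g$1$1 = g$2$2" "SL2_inv g$1$2 = - (g$1$2)" "SL2_inv g$2$1 = - (g$2$1)" "SL2_inv g$2$2 = g$1$1"
  by (simp_all add: SL2_inv_def)

lemma SL2_inv:
  assumes "g \<in> SL2"
  shows "SL2_inv g \<in> SL2" "g ** SL2_inv g = mat 1" "SL2_inv g ** g = mat 1"
  using assms by (auto simp: SL2_iff vec_eq_iff forall_2 mat2_mult_nth mat_def algebra_simps)

lemma moeb_inv_eq: "moeb_inv g z = moeb (SL2_inv g) z"
  by (simp add: moeb_inv_def moeb_def)

lemma moeb_inv_inverse:
  assumes "g \<in> SL2" "z \<in> upper_half"
  shows "moeb_inv g z \<in> upper_half" "moeb g (moeb_inv g z) = z" "moeb_inv g (moeb g z) = z"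
  using assms SL2_inv[OF assms(1)]
  by (simp_all add: moeb_inv_eq moeb_upper_half_iff flip: moeb_mult)

lemma moeb_deriv:
  assumes "g \<in> SL2" "z \<in> upper_half"
  shows "(moeb g has_field_derivative 1 / (jfac g z)\<^sup>2) (at z)"
proof -
  have j: "of_real (g$2$1) * z + of_real (g$2$2) \<noteq> 0"
    using jfac_nonzero[OF assms] by (simp add: jfac_def)
  have det: "complex_of_real (g$1$1) * of_real (g$2$2) - of_real (g$1$2) * of_real (g$2$1) = 1"
    using assms by (simp add: SL2_iff flip: of_real_mult of_real_diff)
  have "of_real (g$1$1) * (of_real (g$2$1) * z + of_real (g$2$2)) - (of_real (g$1$1) * z + of_real (g$1$2)) * of_real (g$2$1)
      = (1 :: complex)"
    using det by (simp add: algebra_simps)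
  then show ?thesis
    unfolding moeb_def
    by (auto intro!: derivative_eq_intros j simp: jfac_def power2_eq_square)
qed

lemma jfac_deriv: "(jfac g has_field_derivative of_real (g$2$1)) (at z)"
  unfolding jfac_def by (auto intro!: derivative_eq_intros)

lemma holomorphic_moeb: "g \<in> SL2 \<Longrightarrow> moeb g holomorphic_on upper_half"
  using moeb_deriv by (meson field_differentiable_at_within field_differentiable_def holomorphic_onI)

lemma holomorphic_jfac: "jfac g holomorphic_on S"
  using jfac_deriv by (meson field_differentiable_at_within field_differentiable_def holomorphic_onI)

section \<open>The module of quadratic polynomials\<close>

type_synonym quad = "complex \<times> complex \<times> complex"

text \<open>A triple lists the coefficients of 1, z and z^2. Triples make the module a real
  Euclidean space, so that inner products and adjoints are available in the duality
  argument.\<close>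

definition qev :: "quad \<Rightarrow> complex \<Rightarrow> complex" where
  "qev v z = fst v + fst (snd v) * z + snd (snd v) * z\<^sup>2"

definition qev' :: "quad \<Rightarrow> complex \<Rightarrow> complex" where
  "qev' v z = fst (snd v) + 2 * snd (snd v) * z"

definition quad_poly :: "quad \<Rightarrow> complex poly" where
  "quad_poly v = [:fst v, fst (snd v), snd (snd v):]"

lemma poly_quad: "poly (quad_poly v) z = qev v z" "poly (pderiv (quad_poly v)) z = qev' v z"
  by (simp_all add: quad_poly_def qev_def qev'_def pderiv_pCons algebra_simps power2_eq_square)

lemma degree_quad: "degree (quad_poly v) \<le> 2"
  by (simp add: quad_poly_def)

lemma quad_poly_surj:
  assumes "degree p \<le> 2"
  shows "\<exists>v. quad_poly v = p"
proof
  show "quad_poly (coeff p 0, coeff p 1, coeff p 2) = p"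
  proof (rule poly_eqI)
    fix n :: nat
    consider "n = 0" | "n = 1" | "n = 2" | "n > 2" by linarith
    then show "coeff (quad_poly (coeff p 0, coeff p 1, coeff p 2)) n = coeff p n"
      using assms by cases (auto simp: quad_poly_def numeral_2_eq_2 coeff_eq_0 coeff_pCons split: nat.split)
  qed
qed

lemma qev_deriv: "(qev v has_field_derivative qev' v z) (at z)" "(qev' v has_field_derivative 2 * snd (snd v)) (at z)"
  unfolding qev_def qev'_def by (auto intro!: derivative_eq_intros simp: algebra_simps)

lemma holomorphic_qev: "qev v holomorphic_on S" "qev' v holomorphic_on S"
  unfolding qev_def qev'_def by (auto intro!: holomorphic_intros)

lemma qev_linear: "qev (v + w) z = qev v z + qev w z" "qev (r *\<^sub>R v) z = of_real r * qev v z"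
  "qev' (v + w) z = qev' v z + qev' w z" "qev' (r *\<^sub>R v) z = of_real r * qev' v z"
  by (simp_all add: qev_def qev'_def algebra_simps scaleR_conv_of_real)

lemma qev_eqI:
  assumes "\<And>z. z \<in> upper_half \<Longrightarrow> qev v z = qev w z"
  shows "v = w"
proof -
  have "poly (quad_poly v - quad_poly w) z = 0" if "z \<in> upper_half" for z
    using assms[OF that] by (simp add: poly_quad)
  moreover have "infinite upper_half"
  proof
    assume "finite upper_half"
    moreover have "\<i> \<in> upper_half" by (simp add: upper_half_def)
    ultimately show False
      using open_upper_half finite_imp_not_open by blast
  qed
  ultimately have "quad_poly v - quad_poly w = 0"
    by (metis (mono_tags, lifting) mem_Collect_eq poly_roots_finite rev_finite_subset subsetI)
  then show ?thesis
    by (simp add: quad_poly_def prod_eq_iff)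
qed

text \<open>The coefficients of p(g z) j(z)^2 with denominators cleared: the pullback of the vector
  field p d/dz. It composes as a right action.\<close>

definition quad_act :: "real^2^2 \<Rightarrow> quad \<Rightarrow> quad" where
  "quad_act g v = (let a = of_real (g$1$1); b = of_real (g$1$2); c = of_real (g$2$1); d = of_real (g$2$2);
      p = fst v; q = fst (snd v); r = snd (snd v)
    in (p * d\<^sup>2 + q * b * d + r * b\<^sup>2, 2 * c * d * p + (a * d + b * c) * q + 2 * a * b * r,
        p * c\<^sup>2 + q * a * c + r * a\<^sup>2))"

lemma qev_act:
  assumes "jfac g z \<noteq> 0"
  shows "qev (quad_act g v) z = qev v (moeb g z) * (jfac g z)\<^sup>2"
proof -
  have "qev v (moeb g z) * (jfac g z)\<^sup>2 = fst v * (jfac g z)\<^sup>2 + fst (snd v) * (moeb g z * jfac g z) * jfac g z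
      + snd (snd v) * (moeb g z * jfac g z)\<^sup>2"
    by (simp add: qev_def algebra_simps power2_eq_square)
  moreover have "moeb g z * jfac g z = of_real (g$1$1) * z + of_real (g$1$2)"
    using assms by (simp add: moeb_def jfac_def)
  ultimately show ?thesis
    by (simp add: quad_act_def Let_def qev_def jfac_def) (simp add: algebra_simps power2_eq_square)
qed

lemma quad_act_linear: "linear (quad_act g)"
  by (rule linearI) (simp_all add: quad_act_def Let_def algebra_simps scaleR_conv_of_real)

lemma quad_act_mult:
  assumes "g \<in> SL2" "h \<in> SL2"
  shows "quad_act (g ** h) v = quad_act h (quad_act g v)"
proof (rule qev_eqI)
  fix z assume z: "z \<in> upper_half"
  have "moeb h z \<in> upper_half" using z assms by (simp add: moeb_upper_half_iff)
  then show "qev (quad_act (g ** h) v) z = qev (quad_act h (quad_act g v)) z"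
    using z assms by (simp add: qev_act jfac_nonzero SL2_mult jfac_mult moeb_mult power_mult_distrib)
qed

lemma quad_act_one [simp]: "quad_act (mat 1) v = v"
  by (simp add: quad_act_def mat_def prod_eq_iff)

subsection \<open>The algebra of operators on holomorphic functions\<close>

text \<open>Functions are extended by 0, so that equality in the type is equality on the half plane,
  the only place where \<open>dop_eq\<close> looks.\<close>

typedef hol = "{f. f holomorphic_on upper_half \<and> (\<forall>z. z \<notin> upper_half \<longrightarrow> f z = 0)}"
  morphisms hol_fun Abs_hol
  by (rule exI[of _ "\<lambda>_. 0"]) auto

lemma hol_fun_holomorphic: "hol_fun f holomorphic_on upper_half"
  and hol_fun_outside: "z \<notin> upper_half \<Longrightarrow> hol_fun f z = 0"
  using hol_fun[of f] by auto

definition mk_hol :: "(complex \<Rightarrow> complex) \<Rightarrow> hol" where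
  "mk_hol f = Abs_hol (\<lambda>z. if z \<in> upper_half then f z else 0)"

lemma hol_fun_mk:
  assumes "f holomorphic_on upper_half"
  shows "hol_fun (mk_hol f) z = (if z \<in> upper_half then f z else 0)"
proof -
  have "(\<lambda>z. if z \<in> upper_half then f z else 0) holomorphic_on upper_half"
    using assms by (rule holomorphic_transform) simp
  then show ?thesis by (simp add: mk_hol_def Abs_hol_inverse)
qed

lemma hol_eqI: "(\<And>z. z \<in> upper_half \<Longrightarrow> hol_fun f z = hol_fun g z) \<Longrightarrow> f = g"
  by (metis ext hol_fun_inject hol_fun_outside)

lemma mk_hol_hol_fun [simp]: "mk_hol (hol_fun f) = f"
  by (rule hol_eqI) (simp add: hol_fun_mk hol_fun_holomorphic)

lemma mk_hol_cong: "(\<And>z. z \<in> upper_half \<Longrightarrow> f z = g z) \<Longrightarrow> mk_hol f = mk_hol g"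
  unfolding mk_hol_def by (rule arg_cong[where f = Abs_hol]) auto

instantiation hol :: real_vector
begin

definition "0 = mk_hol (\<lambda>_. 0)"
definition "f + g = mk_hol (\<lambda>z. hol_fun f z + hol_fun g z)"
definition "f - g = mk_hol (\<lambda>z. hol_fun f z - hol_fun g z)"
definition "- f = mk_hol (\<lambda>z. - hol_fun f z)"
definition "r *\<^sub>R f = mk_hol (\<lambda>z. of_real r * hol_fun f z)"

lemma hol_fun_simps: "hol_fun 0 z = 0" "hol_fun (f + g) z = hol_fun f z + hol_fun g z"
  "hol_fun (f - g) z = hol_fun f z - hol_fun g z" "hol_fun (- f) z = - hol_fun f z"
  "hol_fun (r *\<^sub>R f) z = of_real r * hol_fun f z"
  by (simp_all add: zero_hol_def plus_hol_def minus_hol_def uminus_hol_def scaleR_hol_def hol_fun_mk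
      hol_fun_holomorphic holomorphic_intros hol_fun_outside)

instance
  by standard (auto intro!: hol_eqI simp: hol_fun_simps algebra_simps)

end

text \<open>Maps of type \<open>dop\<close> need not be additive, so composition is not distributive
  on both sides. Linear maps on \<open>hol\<close> form an algebra; real linearity is enough, since
  the scalars in the exponential are rational.\<close>

typedef hop = "{L :: hol \<Rightarrow> hol. linear L}"
  morphisms hop_fun Abs_hop
  by (rule exI[of _ "\<lambda>f. f"]) (simp add: linear_ident)

lemma hop_fun_linear: "linear (hop_fun L)"
  using hop_fun[of L] by simp

lemma hop_fun_Abs: "linear L \<Longrightarrow> hop_fun (Abs_hop L) = L"
  by (simp add: Abs_hop_inverse)

lemma hop_eqI: "(\<And>f. hop_fun L f = hop_fun M f) \<Longrightarrow> L = M"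
  by (simp add: hop_fun_inject[symmetric] fun_eq_iff)

instantiation hop :: real_algebra_1
begin

definition "0 = Abs_hop (\<lambda>_. 0)"
definition "1 = Abs_hop (\<lambda>f. f)"
definition "L + M = Abs_hop (\<lambda>f. hop_fun L f + hop_fun M f)"
definition "L - M = Abs_hop (\<lambda>f. hop_fun L f - hop_fun M f)"
definition "- L = Abs_hop (\<lambda>f. - hop_fun L f)"
definition "L * M = Abs_hop (\<lambda>f. hop_fun L (hop_fun M f))"
definition "r *\<^sub>R L = Abs_hop (\<lambda>f. r *\<^sub>R hop_fun L f)"

lemma hop_fun_simps: "hop_fun 0 f = 0" "hop_fun 1 f = f" "hop_fun (L + M) f = hop_fun L f + hop_fun M f"
  "hop_fun (L - M) f = hop_fun L f - hop_fun M f" "hop_fun (- L) f = - hop_fun L f"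
  "hop_fun (L * M) f = hop_fun L (hop_fun M f)"
  "hop_fun (r *\<^sub>R L) f = r *\<^sub>R hop_fun L f"
  unfolding zero_hop_def one_hop_def plus_hop_def minus_hop_def uminus_hop_def times_hop_def scaleR_hop_def
  by (subst hop_fun_Abs; simp add: linear_ident linear_zero linear_compose_add linear_compose_sub linear_compose_neg
      linear_compose_scale_right hop_fun_linear linear_compose[unfolded o_def])+

instance
proof
  show "(0 :: hop) \<noteq> 1"
  proof
    assume "(0 :: hop) = 1"
    then have "hop_fun 0 (mk_hol (\<lambda>_. 1)) = hop_fun 1 (mk_hol (\<lambda>_. 1))" by simp
    then have "hol_fun 0 \<i> = hol_fun (mk_hol (\<lambda>_. 1)) \<i>" by (simp add: hop_fun_simps)
    then show False by (simp add: hol_fun_simps hol_fun_mk upper_half_def)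
  qed
qed (auto intro!: hop_eqI simp: hop_fun_simps algebra_simps linear_add[OF hop_fun_linear] linear_scale[OF hop_fun_linear])

end

text \<open>The argument enters only through its restriction to the half plane, which lets
  compositions be compared with those of arbitrary \<open>dop\<close>.\<close>

definition of_hop :: "hop \<Rightarrow> dop" where
  "of_hop L = (\<lambda>f. hol_fun (hop_fun L (mk_hol f)))"

lemma of_hop_cong: "(\<And>z. z \<in> upper_half \<Longrightarrow> f z = g z) \<Longrightarrow> of_hop L f = of_hop L g"
  by (simp add: of_hop_def mk_hol_cong[of f g])

lemma of_hop_simps: "of_hop 0 = dop_zero" "of_hop (L + M) f z = of_hop L f z + of_hop M f z"
  "of_hop (L * M) f = of_hop L (of_hop M f)" "of_hop (r *\<^sub>R L) f z = of_real r * of_hop L f z"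
  by (auto simp: of_hop_def hop_fun_simps hol_fun_simps dop_zero_def fun_eq_iff)

lemma of_hop_sum: "of_hop (\<Sum>i\<in>I. L i) f z = (\<Sum>i\<in>I. of_hop (L i) f z)"
  by (induction I rule: infinite_finite_induct) (simp_all add: of_hop_simps dop_zero_def)

lemma of_hop_one: "f holomorphic_on upper_half \<Longrightarrow> z \<in> upper_half \<Longrightarrow> of_hop 1 f z = f z"
  by (simp add: of_hop_def hop_fun_simps hol_fun_mk)

lemma dop_eq_refl [simp]: "dop_eq L L"
  and dop_eq_sym: "dop_eq L M \<Longrightarrow> dop_eq M L"
  and dop_eq_trans: "dop_eq L M \<Longrightarrow> dop_eq M N \<Longrightarrow> dop_eq L N"
  by (auto simp: dop_eq_def)

lemma of_hop_one_eq: "dop_eq (of_hop 1) dop_id"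
  by (auto simp: dop_eq_def dop_id_def of_hop_one)

text \<open>\<open>dop_eq\<close> tests on every holomorphic function, and these exhaust
  \<open>hol\<close>. In this way relations given up to \<open>dop_eq\<close> become equations in
  the algebra.\<close>

lemma of_hop_inject:
  assumes "dop_eq (of_hop L) (of_hop M)"
  shows "L = M"
proof (intro hop_eqI hol_eqI)
  fix f z assume "z \<in> upper_half"
  then show "hol_fun (hop_fun L f) z = hol_fun (hop_fun M f) z"
    using assms hol_fun_holomorphic[of f] by (auto simp: dop_eq_def of_hop_def)
qed

definition iota :: "int \<Rightarrow> quad \<Rightarrow> hop" where
  "iota k v = Abs_hop (\<lambda>f. mk_hol (\<lambda>z. 2 * qev v z * deriv (hol_fun f) z + of_int k * qev' v z * hol_fun f z))"

lemma hol_fun_deriv: "z \<in> upper_half \<Longrightarrow> (hol_fun f has_field_derivative deriv (hol_fun f) z) (at z)"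
  using hol_fun_holomorphic holomorphic_derivI open_upper_half by blast

lemma deriv_hol_simps:
  assumes "z \<in> upper_half"
  shows "deriv (hol_fun (f + g)) z = deriv (hol_fun f) z + deriv (hol_fun g) z"
    "deriv (hol_fun (r *\<^sub>R f)) z = of_real r * deriv (hol_fun f) z"
proof -
  have "hol_fun (f + g) = (\<lambda>z. hol_fun f z + hol_fun g z)" "hol_fun (r *\<^sub>R f) = (\<lambda>z. of_real r * hol_fun f z)"
    by (auto simp: hol_fun_simps)
  then show "deriv (hol_fun (f + g)) z = deriv (hol_fun f) z + deriv (hol_fun g) z"
    "deriv (hol_fun (r *\<^sub>R f)) z = of_real r * deriv (hol_fun f) z"
    using hol_fun_deriv[OF assms] by (auto intro!: DERIV_imp_deriv derivative_eq_intros)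
qed

lemma holomorphic_iota:
  "(\<lambda>z. 2 * qev v z * deriv (hol_fun f) z + of_int k * qev' v z * hol_fun f z) holomorphic_on upper_half"
  by (intro holomorphic_intros holomorphic_qev hol_fun_holomorphic holomorphic_deriv open_upper_half)

lemma iota_apply:
  assumes "z \<in> upper_half"
  shows "hol_fun (hop_fun (iota k v) f) z = 2 * qev v z * deriv (hol_fun f) z + of_int k * qev' v z * hol_fun f z"
proof -
  define D where "D f = mk_hol (\<lambda>z. 2 * qev v z * deriv (hol_fun f) z + of_int k * qev' v z * hol_fun f z)" for f
  have D: "hol_fun (D f) z = 2 * qev v z * deriv (hol_fun f) z + of_int k * qev' v z * hol_fun f z"
    if "z \<in> upper_half" for f z
    unfolding D_def using that by (simp only: hol_fun_mk[OF holomorphic_iota] if_True)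
  have "linear D"
    by (rule linearI; intro hol_eqI) (simp_all add: D deriv_hol_simps hol_fun_simps algebra_simps)
  then show ?thesis
    using assms D by (simp add: iota_def hop_fun_Abs flip: D_def)
qed

lemma iota_linear: "linear (iota k)"
  by (rule linearI; intro hop_eqI hol_eqI)
    (simp_all add: iota_apply hop_fun_simps hol_fun_simps qev_linear algebra_simps del: split_paired_All)

lemma iota_eq_dk_op: "dop_eq (of_hop (iota k v)) (dk_op k (quad_poly v))"
  unfolding dop_eq_def
proof (intro allI impI ballI)
  fix f z assume f: "f holomorphic_on upper_half" and z: "z \<in> upper_half"
  have "eventually (\<lambda>w. hol_fun (mk_hol f) w = f w) (nhds z)"
    using eventually_nhds_in_open[OF open_upper_half z] by eventually_elim (simp add: hol_fun_mk f)
  then have "deriv (hol_fun (mk_hol f)) z = deriv f z"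
    by (intro deriv_cong_ev) auto
  then show "of_hop (iota k v) f z = dk_op k (quad_poly v) f z"
    using z f by (simp add: of_hop_def iota_apply dk_op_def poly_quad hol_fun_mk)
qed

lemma in_dk_iff: "in_dk k L \<longleftrightarrow> (\<exists>v. dop_eq L (of_hop (iota k v)))"
  unfolding in_dk_def
  by (metis degree_quad dop_eq_sym dop_eq_trans iota_eq_dk_op quad_poly_surj)

text \<open>The constant function 1 detects k p', and then the identity function detects 2 p; this
  also covers k = 0.\<close>

lemma iota_inject:
  assumes "iota k v = iota k w"
  shows "v = w"
proof (rule qev_eqI)
  fix z assume z: "z \<in> upper_half"
  have d: "deriv (hol_fun (mk_hol f)) z = deriv f z" if "f holomorphic_on upper_half" for f
    by (rule deriv_cong_ev) (use that z eventually_nhds_in_open[OF open_upper_half z] in \<open>auto elim!: eventually_mono simp: hol_fun_mk\<close>)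
  have ap: "hol_fun (hop_fun (iota k u) (mk_hol f)) z = 2 * qev u z * deriv f z + of_int k * qev' u z * f z"
    if "f holomorphic_on upper_half" for f u
    using that z by (simp add: iota_apply d hol_fun_mk)
  have "of_int k * qev' v z = of_int k * qev' w z"
    using ap[of "\<lambda>_. 1" v] ap[of "\<lambda>_. 1" w] assms by (auto simp: holomorphic_intros)
  moreover have "2 * qev v z + of_int k * qev' v z * z = 2 * qev w z + of_int k * qev' w z * z"
    using ap[of "\<lambda>z. z" v] ap[of "\<lambda>z. z" w] assms by (simp add: holomorphic_intros)
  ultimately show "qev v z = qev w z"
    by (simp only: add_right_cancel) simp
qed

text \<open>The coefficients of 2 (p q' - p' q), up to the factor 2 the bracket of the vector fields
  p d/dz and q d/dz. The weight k does not enter.\<close>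

definition quad_bracket :: "quad \<Rightarrow> quad \<Rightarrow> quad" where
  "quad_bracket v w = (let (a, b, c) = v; (a', b', c') = w
     in (2 * (a * b' - a' * b), 4 * (a * c' - a' * c), 2 * (b * c' - b' * c)))"

text \<open>Second derivatives of f cancel in the commutator. With r = 2 (p q' - p' q) the remaining
  terms are 2 r d/dz + k r', since r' = 2 (p q'' - p'' q).\<close>

lemma ad_iota: "ad (iota k v) (iota k w) = iota k (quad_bracket v w)"
proof (intro hop_eqI hol_eqI)
  fix f z assume z: "z \<in> upper_half"
  let ?f = "hol_fun f"
  have d2: "(deriv ?f has_field_derivative deriv (deriv ?f) z) (at z)"
    using hol_fun_holomorphic holomorphic_deriv holomorphic_derivI open_upper_half z by blast
  have d: "deriv (hol_fun (hop_fun (iota k u) f)) z = 2 * qev' u z * deriv ?f z + 2 * qev u z * deriv (deriv ?f) z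
      + of_int k * (2 * snd (snd u)) * ?f z + of_int k * qev' u z * deriv ?f z" for u
  proof (rule trans[OF deriv_cong_ev DERIV_imp_deriv])
    show "eventually (\<lambda>w. hol_fun (hop_fun (iota k u) f) w = 2 * qev u w * deriv ?f w + of_int k * qev' u w * ?f w) (nhds z)"
      using eventually_nhds_in_open[OF open_upper_half z] by eventually_elim (simp add: iota_apply)
  qed (auto intro!: derivative_eq_intros d2 hol_fun_deriv z qev_deriv simp: algebra_simps)
  have br: "qev (quad_bracket v w) z = 2 * (qev v z * qev' w z - qev' v z * qev w z)"
    "qev' (quad_bracket v w) z = 2 * (qev v z * (2 * snd (snd w)) - 2 * snd (snd v) * qev w z)"
    by (simp_all add: quad_bracket_def qev_def qev'_def split: prod.splits) (simp_all add: algebra_simps power2_eq_square)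
  show "hol_fun (hop_fun (ad (iota k v) (iota k w)) f) z = hol_fun (hop_fun (iota k (quad_bracket v w)) f) z"
    using z by (simp add: ad_def hop_fun_simps hol_fun_simps iota_apply d br) (simp add: algebra_simps)
qed

lemma lie_subspace_iota: "lie_subspace (range (iota k))"
  unfolding lie_subspace_def
  using linear_subspace_image[OF iota_linear subspace_UNIV] by (auto simp: ad_iota)

section \<open>The slash action on operators\<close>

definition slash_fun :: "int \<Rightarrow> real^2^2 \<Rightarrow> hol \<Rightarrow> hol" where
  "slash_fun k g f = mk_hol (\<lambda>z. jfac g z powi (- k) * hol_fun f (moeb g z))"

definition unslash_fun :: "int \<Rightarrow> real^2^2 \<Rightarrow> hol \<Rightarrow> hol" where
  "unslash_fun k g f = mk_hol (\<lambda>w. jfac g (moeb_inv g w) powi k * hol_fun f (moeb_inv g w))"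

text \<open>Conjugation by the slash operator on functions, \<open>unslash_fun\<close> being its
  inverse; this is why the slash action respects products and hence exponentials.\<close>

definition slash_op :: "int \<Rightarrow> real^2^2 \<Rightarrow> hop \<Rightarrow> hop" where
  "slash_op k g L = Abs_hop (\<lambda>f. slash_fun k g (hop_fun L (unslash_fun k g f)))"

lemma holomorphic_compose_moeb:
  assumes "g \<in> SL2" "f holomorphic_on upper_half"
  shows "(\<lambda>z. f (moeb g z)) holomorphic_on upper_half"
proof -
  have "moeb g ` upper_half \<subseteq> upper_half"
    using moeb_upper_half_iff[OF assms(1)] by blast
  then show ?thesis
    using holomorphic_on_compose_gen[OF holomorphic_moeb[OF assms(1)] assms(2)] by (simp add: o_def)
qed

lemma holomorphic_slash:
  assumes "g \<in> SL2" "f holomorphic_on upper_half"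
  shows "(\<lambda>z. jfac g z powi n * f (moeb g z)) holomorphic_on upper_half"
  using assms jfac_nonzero by (intro holomorphic_intros holomorphic_jfac holomorphic_compose_moeb) auto

lemma holomorphic_unslash:
  assumes "g \<in> SL2" "f holomorphic_on upper_half"
  shows "(\<lambda>w. jfac g (moeb_inv g w) powi n * f (moeb_inv g w)) holomorphic_on upper_half"
proof -
  have "(\<lambda>z. jfac g z powi n * f z) holomorphic_on upper_half"
    using assms jfac_nonzero by (intro holomorphic_intros holomorphic_jfac) auto
  from holomorphic_compose_moeb[OF SL2_inv(1)[OF assms(1)] this] show ?thesis
    by (simp add: moeb_inv_eq)
qed

lemma slash_fun_apply: "g \<in> SL2 \<Longrightarrow> z \<in> upper_half \<Longrightarrow>
    hol_fun (slash_fun k g f) z = jfac g z powi (- k) * hol_fun f (moeb g z)"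
  unfolding slash_fun_def by (subst hol_fun_mk) (auto intro!: holomorphic_slash hol_fun_holomorphic)

lemma unslash_fun_apply: "g \<in> SL2 \<Longrightarrow> z \<in> upper_half \<Longrightarrow>
    hol_fun (unslash_fun k g f) z = jfac g (moeb_inv g z) powi k * hol_fun f (moeb_inv g z)"
  unfolding unslash_fun_def by (subst hol_fun_mk) (auto intro!: holomorphic_unslash hol_fun_holomorphic)

lemma slash_unslash:
  assumes "g \<in> SL2"
  shows "slash_fun k g (unslash_fun k g f) = f" "unslash_fun k g (slash_fun k g f) = f"
  using assms by (auto intro!: hol_eqI simp: slash_fun_apply unslash_fun_apply moeb_upper_half_iff
      moeb_inv_inverse jfac_nonzero power_int_minus)

lemma slash_fun_linear: "g \<in> SL2 \<Longrightarrow> linear (slash_fun k g)" "g \<in> SL2 \<Longrightarrow> linear (unslash_fun k g)"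
  by (rule linearI; auto intro!: hol_eqI simp: slash_fun_apply unslash_fun_apply hol_fun_simps algebra_simps)+

lemma slash_fun_mult:
  assumes "g \<in> SL2" "h \<in> SL2"
  shows "slash_fun k (g ** h) f = slash_fun k h (slash_fun k g f)"
  using assms by (auto intro!: hol_eqI simp: slash_fun_apply SL2_mult jfac_mult moeb_mult moeb_upper_half_iff
      power_int_mult_distrib)

lemma slash_op_apply:
  assumes "g \<in> SL2"
  shows "hop_fun (slash_op k g L) f = slash_fun k g (hop_fun L (unslash_fun k g f))"
  unfolding slash_op_def
  using linear_compose[OF linear_compose[OF slash_fun_linear(2)[OF assms, of k] hop_fun_linear[of L]]
      slash_fun_linear(1)[OF assms, of k]]
  by (simp add: hop_fun_Abs o_def)

lemma slash_op_hom: "g \<in> SL2 \<Longrightarrow> algebra_hom (slash_op k g)"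
  unfolding algebra_hom_def
  by (auto intro!: linearI hop_eqI simp: slash_op_apply hop_fun_simps slash_unslash
      linear_add[OF slash_fun_linear(1)] linear_scale[OF slash_fun_linear(1)])

lemma slash_op_mult:
  assumes "g \<in> SL2" "h \<in> SL2"
  shows "slash_op k (g ** h) L = slash_op k h (slash_op k g L)"
proof -
  have "unslash_fun k (g ** h) f = unslash_fun k g (unslash_fun k h f)" for f
    by (metis assms SL2_mult slash_fun_mult slash_unslash)
  then show ?thesis
    using assms by (auto intro!: hop_eqI simp: slash_op_apply SL2_mult slash_fun_mult)
qed

lemma dop_slash_cong:
  assumes "g \<in> SL2" "dop_eq L M"
  shows "dop_eq (dop_slash k L g) (dop_slash k M g)"
  unfolding dop_eq_def
proof (intro allI impI ballI)
  fix f z assume f: "f holomorphic_on upper_half" and z: "z \<in> upper_half"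
  have "L (\<lambda>w. jfac g (moeb_inv g w) powi k * f (moeb_inv g w)) (moeb g z) =
      M (\<lambda>w. jfac g (moeb_inv g w) powi k * f (moeb_inv g w)) (moeb g z)"
    using assms(2) holomorphic_unslash[OF assms(1) f, of k] z assms(1)
    by (simp add: dop_eq_def moeb_upper_half_iff)
  then show "dop_slash k L g f z = dop_slash k M g f z"
    by (simp add: dop_slash_def)
qed

lemma of_hop_slash:
  assumes "g \<in> SL2"
  shows "dop_eq (of_hop (slash_op k g L)) (dop_slash k (of_hop L) g)"
  unfolding dop_eq_def
proof (intro allI impI ballI)
  fix f z assume f: "f holomorphic_on upper_half" and z: "z \<in> upper_half"
  have "unslash_fun k g (mk_hol f) = mk_hol (\<lambda>w. jfac g (moeb_inv g w) powi k * f (moeb_inv g w))"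
    unfolding unslash_fun_def
    by (rule mk_hol_cong) (simp add: hol_fun_mk f moeb_inv_inverse assms)
  then show "of_hop (slash_op k g L) f z = dop_slash k (of_hop L) g f z"
    using z assms by (simp add: of_hop_def slash_op_apply slash_fun_apply dop_slash_def)
qed

text \<open>Differentiating the automorphy factor to the power k produces the extra term 2 k c j
  p(w) f with w = g z. It is exactly accounted for by (p(g z) j^2)' = p'(w) + 2 c j p(w).\<close>

lemma slash_iota:
  assumes g: "g \<in> SL2"
  shows "slash_op k g (iota k v) = iota k (quad_act g v)"
proof (intro hop_eqI hol_eqI)
  fix f z assume z: "z \<in> upper_half"
  define u where "u = unslash_fun k g f"
  define w where "w = moeb g z"
  define j where "j = jfac g z"
  define c where "c = complex_of_real (g$2$1)"
  have w: "w \<in> upper_half" using z g by (simp add: w_def moeb_upper_half_iff)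
  have j: "j \<noteq> 0" using z g by (simp add: j_def jfac_nonzero)
  \<comment> \<open>Differentiating this identity near z yields the derivative of u at w without
    differentiating the inverse transformation.\<close>
  have ev: "eventually (\<lambda>z. hol_fun u (moeb g z) = jfac g z powi k * hol_fun f z) (nhds z)"
    using eventually_nhds_in_open[OF open_upper_half z]
    by eventually_elim (simp add: u_def unslash_fun_apply g moeb_upper_half_iff moeb_inv_inverse)
  have "((\<lambda>z. hol_fun u (moeb g z)) has_field_derivative deriv (hol_fun u) w * (1 / j\<^sup>2)) (at z)"
    unfolding w_def j_def
    by (rule DERIV_chain2[OF hol_fun_deriv moeb_deriv]) (use z g in \<open>auto simp: moeb_upper_half_iff\<close>)
  moreover have "((\<lambda>z. jfac g z powi k * hol_fun f z) has_field_derivative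
      of_int k * j powi (k - 1) * c * hol_fun f z + j powi k * deriv (hol_fun f) z) (at z)"
    using j unfolding j_def c_def
    by (auto intro!: derivative_eq_intros jfac_deriv hol_fun_deriv z)
  ultimately have "deriv (hol_fun u) w * (1 / j\<^sup>2) = of_int k * j powi (k - 1) * c * hol_fun f z + j powi k * deriv (hol_fun f) z"
    by (metis DERIV_imp_deriv deriv_cong_ev[OF ev refl])
  then have du: "deriv (hol_fun u) w = j\<^sup>2 * (of_int k * j powi (k - 1) * c * hol_fun f z + j powi k * deriv (hol_fun f) z)"
    using j by (simp add: field_simps)
  have uw: "hol_fun u w = j powi k * hol_fun f z"
    using eventually_nhds_x_imp_x[OF ev] by (simp add: w_def j_def)
  have jk: "j powi (k - 1) = j powi k / j" "j powi (- k) = 1 / j powi k"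
    using j by (simp_all add: power_int_diff power_int_minus field_simps)
  have q': "qev' (quad_act g v) z = qev' v w + 2 * c * j * qev v w"
  proof -
    have ev': "eventually (\<lambda>z. qev (quad_act g v) z = qev v (moeb g z) * (jfac g z)\<^sup>2) (nhds z)"
      using eventually_nhds_in_open[OF open_upper_half z]
      by eventually_elim (simp add: qev_act jfac_nonzero g)
    have "((\<lambda>z. qev v (moeb g z) * (jfac g z)\<^sup>2) has_field_derivative
        qev' v w * (1 / j\<^sup>2) * j\<^sup>2 + 2 * j * c * qev v w) (at z)"
    proof -
      have "((\<lambda>z. qev v (moeb g z)) has_field_derivative qev' v w * (1 / j\<^sup>2)) (at z)"
        unfolding w_def j_def by (rule DERIV_chain2[OF qev_deriv(1) moeb_deriv[OF g z]])
      moreover have "((\<lambda>z. (jfac g z)\<^sup>2) has_field_derivative 2 * j * c) (at z)"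
        unfolding j_def c_def by (auto intro!: derivative_eq_intros jfac_deriv)
      ultimately show ?thesis
        by (rule DERIV_cong[OF DERIV_mult]) (simp add: w_def j_def)
    qed
    then have "deriv (qev (quad_act g v)) z = qev' v w * (1 / j\<^sup>2) * j\<^sup>2 + 2 * j * c * qev v w"
      unfolding deriv_cong_ev[OF ev' refl] by (rule DERIV_imp_deriv)
    then show ?thesis
      using j by (simp add: DERIV_imp_deriv[OF qev_deriv(1)])
  qed
  have q: "qev (quad_act g v) z = qev v w * j\<^sup>2"
    using z g by (simp add: qev_act jfac_nonzero w_def j_def)
  show "hol_fun (hop_fun (slash_op k g (iota k v)) f) z = hol_fun (hop_fun (iota k (quad_act g v)) f) z"
  proof -
    have "hol_fun (hop_fun (slash_op k g (iota k v)) f) z = j powi (- k) * hol_fun (hop_fun (iota k v) u) w"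
      using z g by (simp only: slash_op_apply slash_fun_apply u_def w_def j_def)
    also have "\<dots> = j powi (- k) * (2 * qev v w * deriv (hol_fun u) w + of_int k * qev' v w * hol_fun u w)"
      using w by (simp only: iota_apply)
    also have "\<dots> = 2 * (qev v w * j\<^sup>2) * deriv (hol_fun f) z + of_int k * (qev' v w + 2 * c * j * qev v w) * hol_fun f z"
    proof -
      have alg: "1 / J * (2 * a * (j\<^sup>2 * (K * (J / j) * c * F + J * F')) + K * a' * (J * F)) =
          2 * (a * j\<^sup>2) * F' + K * (a' + 2 * c * j * a) * F" if "J \<noteq> 0" for J a a' K F F'
        using that j by (simp add: field_simps power2_eq_square)
      show ?thesis
        unfolding du uw jk by (rule alg) (use j in simp)
    qed
    also have "\<dots> = hol_fun (hop_fun (iota k (quad_act g v)) f) z"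
      using z by (simp only: iota_apply q q')
    finally show ?thesis .
  qed
qed

section \<open>Transfer between the two kinds of power series\<close>

lemma ps_mult_of_hop:
  "ps_mult (\<lambda>\<alpha>. of_hop (coef A \<alpha>)) (\<lambda>\<alpha>. of_hop (coef B \<alpha>)) \<alpha> f z = of_hop (coef (A * B) \<alpha>) f z"
  by (simp add: ps_mult_def coef_mult of_hop_sum of_hop_simps atMost_def le_fun_def fun_diff_def)

text \<open>\<open>dop_eq\<close> speaks only about holomorphic arguments, so A can be replaced by
  its algebra counterpart only once \<open>B \<gamma> f\<close> is known to be holomorphic.\<close>

lemma ps_eq_mult:
  assumes A: "ps_eq A (\<lambda>\<alpha>. of_hop (coef A' \<alpha>))" and B: "ps_eq B (\<lambda>\<alpha>. of_hop (coef B' \<alpha>))"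
  shows "ps_eq (ps_mult A B) (\<lambda>\<alpha>. of_hop (coef (A' * B') \<alpha>))"
  unfolding ps_eq_def dop_eq_def
proof (intro allI impI ballI)
  fix \<alpha> f z assume f: "f holomorphic_on upper_half" and z: "z \<in> upper_half"
  have "A \<beta> (B \<gamma> f) z = of_hop (coef A' \<beta>) (of_hop (coef B' \<gamma>) f) z" for \<beta> \<gamma>
  proof -
    have eq: "B \<gamma> f w = of_hop (coef B' \<gamma>) f w" if "w \<in> upper_half" for w
      using B f that by (auto simp: ps_eq_def dop_eq_def)
    have "of_hop (coef B' \<gamma>) f holomorphic_on upper_half"
      by (simp add: of_hop_def hol_fun_holomorphic)
    then have "B \<gamma> f holomorphic_on upper_half"
      by (rule holomorphic_transform) (simp add: eq)
    then have "A \<beta> (B \<gamma> f) z = of_hop (coef A' \<beta>) (B \<gamma> f) z"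
      using A z by (auto simp: ps_eq_def dop_eq_def)
    then show ?thesis
      using of_hop_cong[of "B \<gamma> f"] eq by simp
  qed
  then have "ps_mult A B \<alpha> f z = ps_mult (\<lambda>\<alpha>. of_hop (coef A' \<alpha>)) (\<lambda>\<alpha>. of_hop (coef B' \<alpha>)) \<alpha> f z"
    by (simp add: ps_mult_def)
  then show "ps_mult A B \<alpha> f z = of_hop (coef (A' * B') \<alpha>) f z"
    by (simp add: ps_mult_of_hop)
qed

lemma ps_exp_of_hop: "ps_eq (ps_exp (\<lambda>\<alpha>. of_hop (coef X \<alpha>))) (\<lambda>\<alpha>. of_hop (coef (mexp X) \<alpha>))"
proof -
  have "ps_eq (ps_pow (\<lambda>\<alpha>. of_hop (coef X \<alpha>)) m) (\<lambda>\<alpha>. of_hop (coef (X ^ m) \<alpha>))" for m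
  proof (induction m)
    case 0
    then show ?case
      by (auto simp: ps_eq_def ps_one_def coef_one of_hop_one_eq of_hop_simps zero_fun_def intro: dop_eq_sym)
  next
    case (Suc m)
    then show ?case
      unfolding ps_pow.simps power_Suc by (intro ps_eq_mult) (simp add: ps_eq_def)
  qed
  then show ?thesis
    by (auto simp: ps_eq_def dop_eq_def ps_exp_def mexp_def of_hop_sum of_hop_simps deg_def)
qed

lemma ps_slash_of_hop:
  assumes "g \<in> SL2" "ps_eq A (\<lambda>\<alpha>. of_hop (coef A' \<alpha>))"
  shows "ps_eq (ps_slash k A g) (\<lambda>\<alpha>. of_hop (coef (map_mps (slash_op k g) A') \<alpha>))"
  using assms unfolding ps_eq_def ps_slash_def
  using dop_eq_trans[OF dop_slash_cong dop_eq_sym[OF of_hop_slash]] by simp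

section \<open>Continuously differentiable functions, test functions and forms\<close>

definition fd :: "(complex \<Rightarrow> 'a::real_normed_vector) \<Rightarrow> complex \<Rightarrow> complex \<Rightarrow> 'a" where
  "fd f z = frechet_derivative f (at z)"

text \<open>Differentiability is asked on the whole plane: forms have compact support in the half
  plane and are extended by 0, so no domains have to be carried along.\<close>

definition C1 :: "(complex \<Rightarrow> 'a::real_normed_vector) \<Rightarrow> bool" where
  "C1 f \<longleftrightarrow> (\<forall>z. f differentiable at z) \<and> (\<forall>v. continuous_on UNIV (\<lambda>z. fd f z v))"

definition supp_in :: "complex set \<Rightarrow> (complex \<Rightarrow> 'a::zero) \<Rightarrow> bool" where
  "supp_in K f \<longleftrightarrow> (\<forall>z. z \<notin> K \<longrightarrow> f z = 0)"

lemma fd_eq: "(f has_derivative f') (at z) \<Longrightarrow> fd f z = f'"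
  by (simp add: fd_def frechet_derivative_at[symmetric])

lemma C1_has_derivative: "C1 f \<Longrightarrow> (f has_derivative fd f z) (at z)"
  by (simp add: C1_def fd_def frechet_derivative_works)

lemma C1_continuous_fd: "C1 f \<Longrightarrow> continuous_on S (\<lambda>z. fd f z v)"
  unfolding C1_def by (meson continuous_on_subset subset_UNIV)

lemma C1_continuous: "C1 f \<Longrightarrow> continuous_on S f"
  by (meson C1_has_derivative continuous_at_imp_continuous_on has_derivative_continuous)

lemma C1_linear: "C1 f \<Longrightarrow> linear (fd f z)"
  using C1_has_derivative has_derivative_linear by blast

lemma C1I:
  assumes "\<And>z. (f has_derivative F z) (at z)" "\<And>v. continuous_on UNIV (\<lambda>z. F z v)"
  shows "C1 f" "fd f z = F z"
  using assms fd_eq[OF assms(1)] by (auto simp: C1_def differentiable_def)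

lemma complex_basis: "v = Re v *\<^sub>R 1 + Im v *\<^sub>R \<i>"
  by (simp add: complex_eq_iff)

lemma C1_fd_basis: "C1 f \<Longrightarrow> fd f z v = Re v *\<^sub>R fd f z 1 + Im v *\<^sub>R fd f z \<i>"
  by (subst complex_basis) (simp add: linear_add linear_scale C1_linear del: complex_basis)

lemma fd_zero_supp:
  assumes "closed K" "supp_in K f" "z \<notin> K"
  shows "fd f z v = 0"
proof -
  have "(f has_derivative (\<lambda>_. 0)) (at z)"
    by (rule has_derivative_transform_within_open[where s = "- K", OF has_derivative_const[of 0]])
      (use assms in \<open>auto simp: supp_in_def open_Compl\<close>)
  then show ?thesis by (simp add: fd_eq)
qed

lemma supp_in_fd: "closed K \<Longrightarrow> supp_in K f \<Longrightarrow> supp_in K (\<lambda>z. fd f z v)"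
  by (simp add: supp_in_def fd_zero_supp)

lemma C1_const [simp]: "C1 (\<lambda>_. c)" and fd_const: "fd (\<lambda>_. c) z v = 0"
proof -
  have d: "((\<lambda>_. c) has_derivative (\<lambda>_. 0)) (at z)" for z :: complex by simp
  show "C1 (\<lambda>_. c)" by (rule C1I[OF d]) simp
  show "fd (\<lambda>_. c) z v = 0" by (simp add: fd_eq[OF d])
qed

lemma C1_add [intro]: "C1 f \<Longrightarrow> C1 g \<Longrightarrow> C1 (\<lambda>z. f z + g z)"
  and fd_add: "C1 f \<Longrightarrow> C1 g \<Longrightarrow> fd (\<lambda>z. f z + g z) z v = fd f z v + fd g z v"
proof -
  assume f: "C1 f" and g: "C1 g"
  have d: "((\<lambda>z. f z + g z) has_derivative (\<lambda>v. fd f z v + fd g z v)) (at z)" for z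
    by (intro has_derivative_add C1_has_derivative f g)
  show "C1 (\<lambda>z. f z + g z)"
    by (rule C1I[OF d]) (intro continuous_intros C1_continuous_fd f g)
  show "fd (\<lambda>z. f z + g z) z v = fd f z v + fd g z v"
    by (simp add: fd_eq[OF d])
qed

lemma C1_bounded_linear: "bounded_linear T \<Longrightarrow> C1 f \<Longrightarrow> C1 (\<lambda>z. T (f z))"
  and fd_bounded_linear: "bounded_linear T \<Longrightarrow> C1 f \<Longrightarrow> fd (\<lambda>z. T (f z)) z v = T (fd f z v)"
proof -
  assume T: "bounded_linear T" and f: "C1 f"
  have d: "((\<lambda>z. T (f z)) has_derivative (\<lambda>v. T (fd f z v))) (at z)" for z
    by (rule bounded_linear.has_derivative[OF T C1_has_derivative[OF f]])
  show "C1 (\<lambda>z. T (f z))"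
    by (rule C1I[OF d]) (intro bounded_linear.continuous_on[OF T] C1_continuous_fd f)
  show "fd (\<lambda>z. T (f z)) z v = T (fd f z v)"
    by (simp add: fd_eq[OF d])
qed

lemma C1_mult [intro]: "C1 f \<Longrightarrow> C1 g \<Longrightarrow> C1 (\<lambda>z. f z * (g z :: 'a::real_normed_algebra))"
  and fd_mult: "C1 f \<Longrightarrow> C1 g \<Longrightarrow> fd (\<lambda>z. f z * g z) z v = f z * fd g z v + fd f z v * g z"
proof -
  assume f: "C1 f" and g: "C1 g"
  have d: "((\<lambda>z. f z * g z) has_derivative (\<lambda>v. f z * fd g z v + fd f z v * g z)) (at z)" for z
    by (intro has_derivative_mult C1_has_derivative f g)
  show "C1 (\<lambda>z. f z * g z)"
    by (rule C1I[OF d]) (intro continuous_intros C1_continuous_fd C1_continuous f g)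
  show "fd (\<lambda>z. f z * g z) z v = f z * fd g z v + fd f z v * g z"
    by (simp add: fd_eq[OF d])
qed

lemmas C1_Re = C1_bounded_linear[OF bounded_linear_Re]
  and C1_Im = C1_bounded_linear[OF bounded_linear_Im]
  and fd_Re = fd_bounded_linear[OF bounded_linear_Re]
  and fd_Im = fd_bounded_linear[OF bounded_linear_Im]
  and C1_of_real = C1_bounded_linear[OF bounded_linear_of_real]
  and fd_of_real = fd_bounded_linear[OF bounded_linear_of_real]

lemma C1_scaleR: "C1 f \<Longrightarrow> C1 (\<lambda>z. c *\<^sub>R f z)"
  and fd_scaleR: "C1 f \<Longrightarrow> fd (\<lambda>z. c *\<^sub>R f z) z v = c *\<^sub>R fd f z v"
  by (simp_all add: C1_bounded_linear fd_bounded_linear bounded_linear_scaleR_right)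

lemma C1_minus: "C1 f \<Longrightarrow> C1 (\<lambda>z. - f z)"
  and fd_minus: "C1 f \<Longrightarrow> fd (\<lambda>z. - f z) z v = - fd f z v"
  using C1_scaleR[of f "-1"] fd_scaleR[of f "-1"] by simp_all

lemma C1_diff [intro]: "C1 f \<Longrightarrow> C1 g \<Longrightarrow> C1 (\<lambda>z. f z - g z)"
  and fd_diff: "C1 f \<Longrightarrow> C1 g \<Longrightarrow> fd (\<lambda>z. f z - g z) z v = fd f z v - fd g z v"
  using C1_add[of f "\<lambda>z. - g z"] fd_add[of f "\<lambda>z. - g z"] by (simp_all add: C1_minus fd_minus)

lemma C1_sum: "(\<And>i. i \<in> I \<Longrightarrow> C1 (f i)) \<Longrightarrow> C1 (\<lambda>z. \<Sum>i\<in>I. f i z)"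
  and fd_sum: "(\<And>i. i \<in> I \<Longrightarrow> C1 (f i)) \<Longrightarrow> fd (\<lambda>z. \<Sum>i\<in>I. f i z) z v = (\<Sum>i\<in>I. fd (f i) z v)"
proof -
  have "(\<forall>i\<in>I. C1 (f i)) \<longrightarrow> C1 (\<lambda>z. \<Sum>i\<in>I. f i z) \<and> fd (\<lambda>z. \<Sum>i\<in>I. f i z) z v = (\<Sum>i\<in>I. fd (f i) z v)"
    by (induction I rule: infinite_finite_induct) (auto simp: fd_const C1_add fd_add)
  then show "(\<And>i. i \<in> I \<Longrightarrow> C1 (f i)) \<Longrightarrow> C1 (\<lambda>z. \<Sum>i\<in>I. f i z)"
    "(\<And>i. i \<in> I \<Longrightarrow> C1 (f i)) \<Longrightarrow> fd (\<lambda>z. \<Sum>i\<in>I. f i z) z v = (\<Sum>i\<in>I. fd (f i) z v)"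
    by blast+
qed

lemma C1_real_comp:
  assumes s: "\<And>t. (s has_real_derivative s' t) (at t)" "continuous_on UNIV s'" and f: "C1 f"
  shows "C1 (\<lambda>z. s (f z))" "fd (\<lambda>z. s (f z)) z v = s' (f z) * fd f z v"
proof -
  have d: "((\<lambda>z. s (f z)) has_derivative (\<lambda>v. s' (f z) * fd f z v)) (at z)" for z
    using has_derivative_compose[OF C1_has_derivative[OF f] s(1)[unfolded has_field_derivative_def]] .
  show "C1 (\<lambda>z. s (f z))"
    by (rule C1I[OF d])
      (intro continuous_intros C1_continuous_fd f continuous_on_compose2[OF s(2) C1_continuous[OF f]] subset_UNIV)
  show "fd (\<lambda>z. s (f z)) z v = s' (f z) * fd f z v"
    by (simp add: fd_eq[OF d])
qed

lemma C1_ReIm: "C1 Re" "C1 Im" and fd_ReIm: "fd Re z v = Re v" "fd Im z v = Im v"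
proof -
  have d: "(Re has_derivative Re) (at z)" "(Im has_derivative Im) (at z)" for z
    by (auto intro: bounded_linear_imp_has_derivative bounded_linear_Re bounded_linear_Im)
  show "C1 Re" "C1 Im" by (rule C1I[OF d(1)], simp, rule C1I[OF d(2)], simp)
  show "fd Re z v = Re v" "fd Im z v = Im v" by (simp_all add: fd_eq[OF d(1)] fd_eq[OF d(2)])
qed

text \<open>Pullbacks under Moebius maps are differentiable a priori only on the half plane. Compact
  support allows gluing with 0 on the complement of K.\<close>

lemma C1_extend:
  assumes "open U" "closed K" "K \<subseteq> U" and f: "supp_in K f"
    and F: "\<And>z. z \<in> U \<Longrightarrow> (f has_derivative F z) (at z)" "\<And>v. continuous_on U (\<lambda>z. F z v)"
  shows "C1 f" "fd f z v = (if z \<in> U then F z v else 0)"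
proof -
  have z: "(f has_derivative (\<lambda>_. 0)) (at z)" if "z \<notin> K" for z
    by (rule has_derivative_transform_within_open[where s = "- K", OF has_derivative_const[of 0]])
      (use assms that in \<open>auto simp: supp_in_def open_Compl\<close>)
  let ?F = "\<lambda>z v. if z \<in> U then F z v else 0"
  have d: "(f has_derivative ?F z) (at z)" for z
    using F(1) z \<open>K \<subseteq> U\<close> by (cases "z \<in> U") auto
  have "continuous_on UNIV (\<lambda>z. ?F z v)" for v
  proof -
    have "?F z v = 0" if "z \<notin> K" for z
      using has_derivative_unique[OF d[of z] z[OF that]] by metis
    then have "continuous_on (- K) (\<lambda>z. ?F z v)"
      by (subst continuous_on_cong[OF refl, of _ _ "\<lambda>_. 0"]) auto
    moreover have "continuous_on U (\<lambda>z. ?F z v)"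
      by (subst continuous_on_cong[OF refl, of _ _ "\<lambda>z. F z v"]) (auto simp: F)
    ultimately have "continuous_on (U \<union> - K) (\<lambda>z. ?F z v)"
      using assms by (intro continuous_on_open_Un) (auto simp: open_Compl)
    moreover have "U \<union> - K = UNIV" using \<open>K \<subseteq> U\<close> by auto
    ultimately show ?thesis by simp
  qed
  with d show "C1 f" "fd f z v = ?F z v"
    using C1I[of f ?F] by auto
qed

definition test :: "(complex \<Rightarrow> 'a::real_normed_vector) \<Rightarrow> bool" where
  "test f \<longleftrightarrow> C1 f \<and> (\<exists>K. compact K \<and> K \<subseteq> upper_half \<and> supp_in K f)"

lemma test_C1: "test f \<Longrightarrow> C1 f" by (simp add: test_def)

lemma supp_in_mono: "supp_in K f \<Longrightarrow> K \<subseteq> L \<Longrightarrow> supp_in L f"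
  by (auto simp: supp_in_def)

lemma testI: "C1 f \<Longrightarrow> compact K \<Longrightarrow> K \<subseteq> upper_half \<Longrightarrow> supp_in K f \<Longrightarrow> test f"
  by (auto simp: test_def)

lemma test_add:
  assumes "test f" "test g"
  shows "test (\<lambda>z. f z + g z)"
proof -
  obtain K L where "compact K" "K \<subseteq> upper_half" "supp_in K f" "compact L" "L \<subseteq> upper_half" "supp_in L g"
    using assms by (auto simp: test_def)
  then show ?thesis
    using assms by (intro testI[of _ "K \<union> L"]) (auto simp: test_def supp_in_def)
qed

lemma test_mult1: "test f \<Longrightarrow> C1 g \<Longrightarrow> test (\<lambda>z. f z * (g z :: 'a::real_normed_algebra))"
  and test_mult2: "test f \<Longrightarrow> C1 g \<Longrightarrow> test (\<lambda>z. (g z :: 'a::real_normed_algebra) * f z)"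
  and test_of_real_mult: "test h \<Longrightarrow> C1 u \<Longrightarrow> test (\<lambda>z. of_real (u z) * (h z :: complex))"
  by (auto simp: test_def C1_mult C1_of_real supp_in_def; metis mult_zero_left mult_zero_right)+

lemma test_bounded_linear: "bounded_linear T \<Longrightarrow> test f \<Longrightarrow> test (\<lambda>z. T (f z))"
  unfolding test_def supp_in_def by (metis C1_bounded_linear linear_simps(3))

lemma test_scaleR: "test f \<Longrightarrow> test (\<lambda>z. c *\<^sub>R f z)"
  using test_bounded_linear[OF bounded_linear_scaleR_right] .

lemma test_minus: "test f \<Longrightarrow> test (\<lambda>z. - f z)"
  using test_scaleR[of f "-1"] by simp

lemma test_diff: "test f \<Longrightarrow> test g \<Longrightarrow> test (\<lambda>z. f z - g z)"
  using test_add[OF _ test_minus, of f g] by simp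

lemma test_0 [simp]: "test (\<lambda>_. 0)"
  by (rule testI[of _ "{}"]) (auto simp: supp_in_def)

lemma supp_in_moeb:
  assumes g: "g \<in> SL2" and f: "supp_in K f" "K \<subseteq> upper_half"
  shows "supp_in (moeb_inv g ` K) (\<lambda>z. f (moeb g z))"
  unfolding supp_in_def
proof (intro allI impI)
  fix z assume z: "z \<notin> moeb_inv g ` K"
  have "moeb g z \<notin> K"
  proof
    assume K: "moeb g z \<in> K"
    then have "z \<in> upper_half" using f g moeb_upper_half_iff by blast
    then have "z = moeb_inv g (moeb g z)" using g by (simp add: moeb_inv_inverse)
    with K z show False by blast
  qed
  then show "f (moeb g z) = 0" using f by (simp add: supp_in_def)
qed

lemma continuous_on_moeb: "g \<in> SL2 \<Longrightarrow> continuous_on upper_half (moeb g)"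
  using holomorphic_moeb holomorphic_on_imp_continuous_on by blast

lemma compact_moeb_inv:
  assumes g: "g \<in> SL2" and "compact K" "K \<subseteq> upper_half"
  shows "compact (moeb_inv g ` K)" "moeb_inv g ` K \<subseteq> upper_half"
proof -
  show "compact (moeb_inv g ` K)"
    unfolding moeb_inv_eq[abs_def]
    by (rule compact_continuous_image[OF continuous_on_subset[OF continuous_on_moeb[OF SL2_inv(1)[OF g]] assms(3)] assms(2)])
  show "moeb_inv g ` K \<subseteq> upper_half"
    using moeb_inv_inverse(1)[OF g] assms(3) by auto
qed

lemma moeb_has_derivative:
  assumes "g \<in> SL2" "z \<in> upper_half"
  shows "(moeb g has_derivative (\<lambda>v. v / (jfac g z)\<^sup>2)) (at z)"
  using has_field_derivative_imp_has_derivative[OF moeb_deriv[OF assms]]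
  by (rule has_derivative_eq_rhs) auto

lemma continuous_on_jfac: "continuous_on S (jfac g)"
  unfolding jfac_def by (intro continuous_intros)

lemma test_moeb:
  assumes g: "g \<in> SL2" and f: "test f"
  shows "test (\<lambda>z. f (moeb g z))"
    "z \<in> upper_half \<Longrightarrow> fd (\<lambda>z. f (moeb g z)) z v = fd f (moeb g z) (v / (jfac g z)\<^sup>2)"
proof -
  obtain K where K: "compact K" "K \<subseteq> upper_half" "supp_in K f"
    using f by (auto simp: test_def)
  have C: "C1 f" using f by (rule test_C1)
  note c = compact_moeb_inv[OF g K(1,2)] supp_in_moeb[OF g K(3,2)]
  have d: "((\<lambda>z. f (moeb g z)) has_derivative (\<lambda>v. fd f (moeb g z) (v / (jfac g z)\<^sup>2))) (at z)"
    if "z \<in> upper_half" for z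
    using has_derivative_compose[OF moeb_has_derivative[OF g that] C1_has_derivative[OF C]] .
  have "continuous_on upper_half (\<lambda>z. fd f (moeb g z) (v / (jfac g z)\<^sup>2))" for v
    by (subst C1_fd_basis[OF C])
      (intro continuous_intros continuous_on_jfac continuous_on_compose2[OF C1_continuous_fd[OF C, of UNIV]]
        continuous_on_moeb[OF g]; use jfac_nonzero[OF g] in auto)
  note ext = C1_extend[OF open_upper_half compact_imp_closed[OF c(1)] c(2,3) d this]
  show "test (\<lambda>z. f (moeb g z))"
    using testI[OF ext(1) c] by blast
  show "z \<in> upper_half \<Longrightarrow> fd (\<lambda>z. f (moeb g z)) z v = fd f (moeb g z) (v / (jfac g z)\<^sup>2)"
    using ext(2) by simp
qed

text \<open>A 1-form \<open>P dx + Q dy\<close> is encoded by \<open>\<eta> = P - iQ\<close>, so that its value on a tangent vector \<open>v\<close> is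
  \<open>Re (\<eta> v)\<close> and pulling back along a holomorphic map multiplies \<open>\<eta>\<close> by the complex derivative.\<close>

definition curl :: "(complex \<Rightarrow> complex) \<Rightarrow> complex \<Rightarrow> real" where
  "curl \<eta> z = - Im (fd \<eta> z 1) - Re (fd \<eta> z \<i>)"

definition pull1 :: "real^2^2 \<Rightarrow> (complex \<Rightarrow> complex) \<Rightarrow> complex \<Rightarrow> complex" where
  "pull1 g \<eta> z = \<eta> (moeb g z) / (jfac g z)\<^sup>2"

text \<open>The pullback of the 2-form f dx dy: the Jacobian of a holomorphic map is the squared
  modulus of its derivative, here the derivative 1 / j^2.\<close>

definition pull2 :: "real^2^2 \<Rightarrow> (complex \<Rightarrow> real) \<Rightarrow> complex \<Rightarrow> real" where
  "pull2 g f z = f (moeb g z) / (norm (jfac g z)) ^ 4"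

lemma test_pull:
  assumes g: "g \<in> SL2" and \<eta>: "test \<eta>"
  shows test_pull1: "test (pull1 g \<eta>)" and curl_pull1: "z \<in> upper_half \<Longrightarrow> curl (pull1 g \<eta>) z = pull2 g (curl \<eta>) z"
proof -
  obtain K where K: "compact K" "K \<subseteq> upper_half" "supp_in K \<eta>"
    using \<eta> by (auto simp: test_def)
  have C: "C1 \<eta>" using \<eta> by (rule test_C1)
  note c = compact_moeb_inv[OF g K(1,2)]
  have s: "supp_in (moeb_inv g ` K) (pull1 g \<eta>)"
    using supp_in_moeb[OF g K(3,2)] by (simp add: supp_in_def pull1_def)
  let ?c = "complex_of_real (g$2$1)"
  let ?D = "\<lambda>z v. fd \<eta> (moeb g z) (v / (jfac g z)\<^sup>2) * (1 / (jfac g z)\<^sup>2) + \<eta> (moeb g z) * (- 2 * ?c * v / (jfac g z) ^ 3)"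
  have d: "(pull1 g \<eta> has_derivative ?D z) (at z)" if z: "z \<in> upper_half" for z
  proof -
    have j: "jfac g z \<noteq> 0" using jfac_nonzero[OF g z] .
    have "((\<lambda>z. 1 / (jfac g z)\<^sup>2) has_field_derivative (- 2 * ?c / (jfac g z) ^ 3)) (at z)"
      using j by (auto intro!: derivative_eq_intros jfac_deriv simp: power2_eq_square power3_eq_cube field_simps)
    then have "((\<lambda>z. 1 / (jfac g z)\<^sup>2) has_derivative (\<lambda>v. - 2 * ?c * v / (jfac g z) ^ 3)) (at z)"
      by (rule has_field_derivative_imp_has_derivative[THEN has_derivative_eq_rhs]) (auto simp: mult_ac)
    then have "((\<lambda>z. \<eta> (moeb g z) * (1 / (jfac g z)\<^sup>2)) has_derivative
      (\<lambda>v. \<eta> (moeb g z) * (- 2 * ?c * v / (jfac g z) ^ 3) + fd \<eta> (moeb g z) (v / (jfac g z)\<^sup>2) * (1 / (jfac g z)\<^sup>2))) (at z)"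
      by (rule has_derivative_mult[OF has_derivative_compose[OF moeb_has_derivative[OF g z] C1_has_derivative[OF C]]])
    then show ?thesis
      by (simp add: pull1_def[abs_def] add.commute)
  qed
  have "continuous_on upper_half (\<lambda>z. ?D z v)" for v
    by (subst C1_fd_basis[OF C])
      (intro continuous_intros continuous_on_jfac continuous_on_compose2[OF C1_continuous_fd[OF C, of UNIV]]
        continuous_on_compose2[OF C1_continuous[OF C, of UNIV]] continuous_on_moeb[OF g]; use jfac_nonzero[OF g] in auto)
  note ext = C1_extend[OF open_upper_half compact_imp_closed[OF c(1)] c(2) s d this]
  show "test (pull1 g \<eta>)"
    using testI[OF ext(1) c s] by blast
  assume z: "z \<in> upper_half"
  have j: "jfac g z \<noteq> 0" using jfac_nonzero[OF g z] .
  define w where "w = 1 / (jfac g z)\<^sup>2"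
  define a where "a = fd \<eta> (moeb g z) 1"
  define b where "b = fd \<eta> (moeb g z) \<i>"
  have lin: "fd \<eta> (moeb g z) v = Re v *\<^sub>R a + Im v *\<^sub>R b" for v
    unfolding a_def b_def by (rule C1_fd_basis[OF C])
  have "curl (pull1 g \<eta>) z = - Im (?D z 1) - Re (?D z \<i>)"
    using z by (simp add: curl_def ext(2))
  also have "\<dots> = - Im (fd \<eta> (moeb g z) w * w) - Re (fd \<eta> (moeb g z) (\<i> * w) * w)"
  proof -
    \<comment> \<open>Differentiating 1 / j^2 contributes v e, which is complex linear in v. Such a
      term is invisible to \<open>curl\<close>, because - Im e - Re (i e) = 0.\<close>
    define e where "e = \<eta> (moeb g z) * (- 2 * ?c / (jfac g z) ^ 3)"
    have eq: "?D z v = fd \<eta> (moeb g z) (v * w) * w + v * e" for v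
      by (simp add: w_def e_def)
    show ?thesis unfolding eq by simp
  qed
  also have "\<dots> = (- Im a - Re b) * ((Re w)\<^sup>2 + (Im w)\<^sup>2)"
    unfolding lin by (simp add: algebra_simps power2_eq_square)
  also have "(Re w)\<^sup>2 + (Im w)\<^sup>2 = 1 / (norm (jfac g z)) ^ 4"
    unfolding cmod_power2[symmetric] w_def by (simp add: norm_divide norm_power power_divide flip: power_mult)
  finally show "curl (pull1 g \<eta>) z = pull2 g (curl \<eta>) z"
    by (simp add: pull2_def curl_def a_def b_def)
qed

subsection \<open>Integration over the plane\<close>

definition cx :: "real^2 \<Rightarrow> complex" where
  "cx x = Complex (x$1) (x$2)"

definition xc :: "complex \<Rightarrow> real^2" where
  "xc z = vector [Re z, Im z]"

lemma cx_xc [simp]: "cx (xc z) = z" and xc_cx [simp]: "xc (cx x) = x"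
  by (simp_all add: cx_def xc_def vec_eq_iff forall_2)

text \<open>Integration takes place over \<open>real^2\<close>, where the Jacobian in the change of
  variables is the determinant of a matrix.\<close>

definition plane_int :: "(complex \<Rightarrow> real) \<Rightarrow> real" where
  "plane_int f = integral UNIV (\<lambda>x. f (cx x))"

lemma bounded_linear_cx: "bounded_linear cx"
proof (rule linear_conv_bounded_linear[THEN iffD1], rule linearI)
qed (simp_all add: cx_def complex_eq_iff)

lemma bounded_linear_xc: "bounded_linear xc"
proof (rule linear_conv_bounded_linear[THEN iffD1], rule linearI)
qed (simp_all add: xc_def vec_eq_iff forall_2)

lemma cx_add: "cx (x + y) = cx x + cx y"
  using bounded_linear_cx by (simp add: linear_simps)

lemma continuous_on_comp_cx:
  assumes "continuous_on UNIV f"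
  shows "continuous_on S (\<lambda>x. f (cx x))"
  by (rule continuous_on_compose2[OF assms linear_continuous_on[OF bounded_linear_cx]]) simp

text \<open>The support may lie anywhere in the plane, so that the class is closed under
  translations and difference quotients.\<close>

definition cs :: "(complex \<Rightarrow> real) \<Rightarrow> bool" where
  "cs f \<longleftrightarrow> continuous_on UNIV f \<and> (\<exists>R. supp_in (cball 0 R) f)"

lemma cs_mono_radius: "cs f \<Longrightarrow> \<exists>R\<ge>M. supp_in (cball 0 R) f"
proof -
  assume "cs f"
  then obtain R where "supp_in (cball 0 R) f" by (auto simp: cs_def)
  then show ?thesis by (intro exI[of _ "max M R"]) (auto simp: supp_in_def)
qed

lemma csI_compact: "continuous_on UNIV f \<Longrightarrow> compact K \<Longrightarrow> supp_in K f \<Longrightarrow> cs f"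
  unfolding cs_def supp_in_def using compact_imp_bounded[of K] unfolding bounded_iff
  by (metis mem_cball_0)

lemma test_cs: "test f \<Longrightarrow> cs f"
  using csI_compact C1_continuous by (auto simp: test_def)

lemma test_fd_cs: "test f \<Longrightarrow> cs (\<lambda>z. fd f z v)"
  unfolding test_def by (metis C1_continuous_fd compact_imp_closed csI_compact supp_in_fd)

lemma cs_0 [simp]: "cs (\<lambda>_. 0)"
  by (auto simp: cs_def supp_in_def)

lemma cs_mult1: "cs f \<Longrightarrow> continuous_on UNIV g \<Longrightarrow> cs (\<lambda>z. f z * g z)"
  and cs_mult2: "cs f \<Longrightarrow> continuous_on UNIV g \<Longrightarrow> cs (\<lambda>z. g z * f z)"
  by (auto simp: cs_def supp_in_def intro!: continuous_intros)

lemma cs_add: "cs f \<Longrightarrow> cs g \<Longrightarrow> cs (\<lambda>z. f z + g z)"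
proof -
  assume f: "cs f" and g: "cs g"
  then obtain R S where "supp_in (cball 0 R) f" "supp_in (cball 0 S) g" by (auto simp: cs_def)
  then have "supp_in (cball 0 (max R S)) (\<lambda>z. f z + g z)" by (auto simp: supp_in_def)
  then show ?thesis using f g by (auto simp: cs_def intro!: continuous_intros)
qed

lemma cs_scale: "cs f \<Longrightarrow> cs (\<lambda>z. c * f z)"
  by (rule cs_mult2) (simp_all add: continuous_on_const)

lemma cs_minus: "cs f \<Longrightarrow> cs (\<lambda>z. - f z)"
  using cs_scale[of f "-1"] by simp

lemma cs_diff: "cs f \<Longrightarrow> cs g \<Longrightarrow> cs (\<lambda>z. f z - g z)"
  using cs_add[OF _ cs_minus, of f g] by simp

lemma cs_sum: "(\<And>i. i \<in> I \<Longrightarrow> cs (f i)) \<Longrightarrow> cs (\<lambda>z. \<Sum>i\<in>I. f i z)"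
  by (induction I rule: infinite_finite_induct) (auto simp: cs_add)

lemma cs_shift:
  fixes f :: "complex \<Rightarrow> real"
  shows "cs f \<Longrightarrow> cs (\<lambda>z. f (z + w))"
proof -
  assume f: "cs f"
  then obtain R where R: "supp_in (cball 0 R) f" by (auto simp: cs_def)
  have "supp_in (cball 0 (R + norm w)) (\<lambda>z. f (z + w))"
    unfolding supp_in_def
  proof (intro allI impI)
    fix z :: complex assume "z \<notin> cball 0 (R + norm w)"
    then have "norm (z + w) > R" using norm_triangle_ineq4[of "z + w" w] by (simp add: dist_norm)
    then show "f (z + w) = 0" using R by (simp add: supp_in_def dist_norm)
  qed
  moreover have "continuous_on UNIV (\<lambda>z. f (z + w))"
    by (rule continuous_on_compose2[of UNIV f]) (use f in \<open>simp_all add: cs_def continuous_on_add continuous_on_id continuous_on_const\<close>)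
  ultimately show ?thesis unfolding cs_def by blast
qed

abbreviation sqr :: "real \<Rightarrow> (real^2) set" where
  "sqr R \<equiv> cbox (vec (- R)) (vec R)"

lemma sqr_contains: "x \<notin> sqr R \<Longrightarrow> cx x \<notin> cball 0 R"
proof
  assume x: "x \<notin> sqr R" and "cx x \<in> cball 0 R"
  then have "norm (cx x) \<le> R" by simp
  then have "\<bar>x$1\<bar> \<le> R" "\<bar>x$2\<bar> \<le> R"
    using abs_Re_le_cmod[of "cx x"] abs_Im_le_cmod[of "cx x"] by (auto simp: cx_def)
  then have "x \<in> sqr R" by (auto simp: mem_box_cart forall_2)
  with x show False by simp
qed

lemma cs_has_integral:
  assumes "cs f" "supp_in (cball 0 R) f"
  shows "((\<lambda>x. f (cx x)) has_integral plane_int f) (sqr R)" "((\<lambda>x. f (cx x)) has_integral plane_int f) UNIV"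
proof -
  have c: "continuous_on (sqr R) (\<lambda>x. f (cx x))"
    using assms(1) by (simp add: cs_def continuous_on_comp_cx)
  have z: "f (cx x) = 0" if "x \<notin> sqr R" for x
    using assms(2) sqr_contains[OF that] by (auto simp: supp_in_def)
  have "((\<lambda>x. f (cx x)) has_integral integral (sqr R) (\<lambda>x. f (cx x))) UNIV"
    by (rule has_integral_on_superset[OF integrable_integral[OF integrable_continuous[OF c]]]) (use z in auto)
  moreover from this have "plane_int f = integral (sqr R) (\<lambda>x. f (cx x))"
    unfolding plane_int_def by (rule integral_unique)
  ultimately show "((\<lambda>x. f (cx x)) has_integral plane_int f) UNIV" "((\<lambda>x. f (cx x)) has_integral plane_int f) (sqr R)"
    using integrable_integral[OF integrable_continuous[OF c]] by auto
qed

lemma cs_has_integral_UNIV: "cs f \<Longrightarrow> ((\<lambda>x. f (cx x)) has_integral plane_int f) UNIV"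
  using cs_has_integral(2) by (auto simp: cs_def)

lemma plane_int_add: "cs f \<Longrightarrow> cs g \<Longrightarrow> plane_int (\<lambda>z. f z + g z) = plane_int f + plane_int g"
  using integral_unique[OF has_integral_add[OF cs_has_integral_UNIV cs_has_integral_UNIV]]
  by (simp add: plane_int_def)

lemma plane_int_scale: "plane_int (\<lambda>z. c * f z) = c * plane_int f"
  by (simp add: plane_int_def)

lemma plane_int_minus: "plane_int (\<lambda>z. - f z) = - plane_int f"
  using plane_int_scale[of "-1" f] by simp

lemma plane_int_diff: "cs f \<Longrightarrow> cs g \<Longrightarrow> plane_int (\<lambda>z. f z - g z) = plane_int f - plane_int g"
  using plane_int_add[OF _ cs_minus, of f g] by (simp add: plane_int_minus)

lemma plane_int_0 [simp]: "plane_int (\<lambda>_. 0) = 0"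
  by (simp add: plane_int_def)

lemma plane_int_sum: "(\<And>i. i \<in> I \<Longrightarrow> cs (f i)) \<Longrightarrow> plane_int (\<lambda>z. \<Sum>i\<in>I. f i z) = (\<Sum>i\<in>I. plane_int (f i))"
  by (induction I rule: infinite_finite_induct) (auto simp: plane_int_add cs_sum)

lemma plane_int_shift:
  assumes "cs f"
  shows "plane_int (\<lambda>z. f (z + w)) = plane_int f"
proof -
  obtain R where R: "supp_in (cball 0 R) f" using assms by (auto simp: cs_def)
  have "((\<lambda>x. f (cx (x + xc w))) has_integral plane_int f) (cbox (vec (- R) - xc w) (vec R - xc w))"
    by (rule has_integral_shift_cbox[OF cs_has_integral(1)[OF assms R]])
  then have "((\<lambda>x. f (cx (x + xc w))) has_integral plane_int f) UNIV"
  proof (rule has_integral_on_superset)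
    fix x assume "x \<notin> cbox (vec (- R) - xc w) (vec R - xc w)"
    then have "x + xc w \<notin> sqr R" by (auto simp: mem_box_cart forall_2 algebra_simps)
    then show "f (cx (x + xc w)) = 0"
      using R sqr_contains by (auto simp: supp_in_def)
  qed auto
  then show ?thesis
    by (simp add: plane_int_def cx_add integral_unique)
qed

lemma plane_int_bound:
  assumes "cs f" "supp_in (cball 0 R) f" "R \<ge> 0" "\<And>z. \<bar>f z\<bar> \<le> B"
  shows "\<bar>plane_int f\<bar> \<le> B * (2 * R)\<^sup>2"
proof -
  have "0 \<le> B" using assms(4)[of 0] by linarith
  then have "norm (plane_int f) \<le> B * measure lborel (sqr R)"
    by (rule has_integral_bound[OF _ cs_has_integral(1)[OF assms(1,2)]]) (use assms in auto)
  moreover have "measure lborel (sqr R) = (2 * R)\<^sup>2"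
    using assms(3) by (subst content_cbox_cart) (auto simp: interval_ne_empty_cart power2_eq_square)
  ultimately show ?thesis by simp
qed

lemma plane_int_pos:
  assumes f: "cs f" "\<And>z. f z \<ge> 0" "f w > 0"
  shows "plane_int f > 0"
proof -
  obtain R where R: "supp_in (cball 0 R) f" "R \<ge> 1" using cs_mono_radius[OF f(1), of 1] by auto
  have c: "continuous_on (sqr R) (\<lambda>x. f (cx x))"
    using f(1) by (simp add: cs_def continuous_on_comp_cx)
  have "plane_int f \<ge> 0"
    using has_integral_nonneg[OF cs_has_integral(1)[OF f(1) R(1)]] f(2) by auto
  moreover have "plane_int f \<noteq> 0"
  proof
    assume 0: "plane_int f = 0"
    have "box (vec (- R)) (vec R :: real^2) \<noteq> {}"
      using R(2) by (simp add: interval_ne_empty_cart)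
    moreover have "xc w \<in> sqr R"
      using R(1) f(3) sqr_contains[of "xc w" R] by (auto simp: supp_in_def)
    ultimately have "f (cx (xc w)) = 0"
      using has_integral_0_cbox_imp_0[OF c _ _ _ \<open>xc w \<in> sqr R\<close>] cs_has_integral(1)[OF f(1) R(1)] f(2) 0 by auto
    then show False using f(3) by simp
  qed
  ultimately show ?thesis by simp
qed

lemma cs_uniformly_continuous:
  assumes f: "cs f" and e: "e > 0"
  shows "\<exists>d>0. \<forall>z w. norm w < d \<longrightarrow> \<bar>f (z + w) - f z\<bar> < e"
proof -
  obtain R where R: "supp_in (cball 0 R) f" using f by (auto simp: cs_def)
  have "continuous_on (cball 0 (R + 1)) f"
    using f unfolding cs_def by (meson continuous_on_subset subset_UNIV)
  then have "uniformly_continuous_on (cball 0 (R + 1)) f"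
    by (rule compact_uniformly_continuous) simp
  then obtain d where d: "d > 0" "\<And>x y. x \<in> cball 0 (R + 1) \<Longrightarrow> y \<in> cball 0 (R + 1) \<Longrightarrow> dist y x < d \<Longrightarrow> dist (f y) (f x) < e"
    using e unfolding uniformly_continuous_on_def by metis
  have "\<bar>f (z + w) - f z\<bar> < e" if w: "norm w < min d 1" for z w
  proof (cases "norm z \<le> R + 1 \<and> norm (z + w) \<le> R + 1")
    case True
    then have "z \<in> cball 0 (R + 1)" "z + w \<in> cball 0 (R + 1)" by simp_all
    moreover have "dist (z + w) z < d" using w by (simp add: dist_norm)
    ultimately show ?thesis
      using d(2)[of z "z + w"] by (simp add: dist_real_def)
  next
    case False
    have "norm z > R" "norm (z + w) > R"
      using False w norm_triangle_ineq[of z w] norm_triangle_ineq4[of "z + w" w] by auto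
    then show ?thesis
      using R e by (simp add: supp_in_def)
  qed
  then show ?thesis
    using d(1) by (intro exI[of _ "min d 1"]) auto
qed

definition dq :: "complex \<Rightarrow> real \<Rightarrow> (complex \<Rightarrow> real) \<Rightarrow> complex \<Rightarrow> real" where
  "dq v t f z = (f (z + of_real t * v) - f z) / t"

lemma dq_mean_value:
  assumes "C1 f" "t \<noteq> 0"
  shows "\<exists>s. \<bar>s\<bar> \<le> \<bar>t\<bar> \<and> dq v t f z = fd f (z + of_real s * v) v"
proof -
  have d: "((\<lambda>s. f (z + of_real s * v)) has_real_derivative fd f (z + of_real s * v) v) (at s)" for s
  proof -
    have "((\<lambda>s. z + of_real s * v) has_derivative (\<lambda>h. of_real h * v)) (at s)"
      by (auto intro!: derivative_eq_intros)
    from has_derivative_compose[OF this C1_has_derivative[OF assms(1)]]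
    have "((\<lambda>s. f (z + of_real s * v)) has_derivative (\<lambda>h. fd f (z + of_real s * v) (h *\<^sub>R v))) (at s)"
      by (simp add: scaleR_conv_of_real)
    then show ?thesis
      by (simp add: linear_scale[OF C1_linear[OF assms(1)]] has_field_derivative_def mult.commute[of _ "fd _ _ _"])
  qed
  show ?thesis
  proof (cases "t > 0")
    case True
    then obtain s where "0 < s" "s < t" "f (z + of_real t * v) - f (z + of_real 0 * v) = (t - 0) * fd f (z + of_real s * v) v"
      using MVT2[of 0 t "\<lambda>s. f (z + of_real s * v)" "\<lambda>s. fd f (z + of_real s * v) v"] d by auto
    then show ?thesis
      using True by (intro exI[of _ s]) (auto simp: dq_def)
  next
    case False
    then have "t < 0" using assms by simp
    then obtain s where "t < s" "s < 0" "f (z + of_real 0 * v) - f (z + of_real t * v) = (0 - t) * fd f (z + of_real s * v) v"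
      using MVT2[of t 0 "\<lambda>s. f (z + of_real s * v)" "\<lambda>s. fd f (z + of_real s * v) v"] d by auto
    then show ?thesis
      using \<open>t < 0\<close> by (intro exI[of _ s]) (auto simp: dq_def field_simps)
  qed
qed

lemma cs_dq: "cs f \<Longrightarrow> cs (dq v t f)"
  unfolding dq_def[abs_def] using cs_scale[OF cs_diff[OF cs_shift], of f f "1/t" "of_real t * v"] by simp

lemma dq_supp:
  assumes "supp_in (cball 0 R) f" "\<bar>t\<bar> \<le> 1"
  shows "supp_in (cball 0 (R + norm v)) (dq v t f)"
  unfolding supp_in_def
proof (intro allI impI)
  fix z :: complex assume z: "z \<notin> cball 0 (R + norm v)"
  have "norm (of_real t * v) \<le> norm v" using assms(2) by (simp add: norm_mult mult_left_le_one_le)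
  moreover have "norm z > R + norm v" using z by simp
  moreover have "norm z \<le> norm (z + of_real t * v) + norm (of_real t * v)"
    using norm_triangle_ineq4[of "z + of_real t * v" "of_real t * v"] by simp
  ultimately have "norm (z + of_real t * v) > R" "norm z > R"
    using norm_ge_zero[of v] by linarith+
  then show "dq v t f z = 0"
    using assms(1) by (simp add: supp_in_def dq_def)
qed

text \<open>The mean value theorem turns the quotient into a derivative at a nearby point, uniform
  continuity of the compactly supported derivative makes the convergence uniform, and all supports
  lie in one ball.\<close>

lemma plane_int_dq_tendsto:
  assumes f: "C1 f" "supp_in (cball 0 R) f" and g: "continuous_on UNIV g"
    and t: "t \<longlonglongrightarrow> 0" "\<And>n. t n \<noteq> 0"
  shows "(\<lambda>n. plane_int (\<lambda>z. dq v (t n) f z * g z)) \<longlonglongrightarrow> plane_int (\<lambda>z. fd f z v * g z)"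
proof (rule LIMSEQ_I)
  fix e :: real assume e: "e > 0"
  \<comment> \<open>This radius covers the supports of all quotients with step at most 1; the
    maximum with 1 keeps it positive.\<close>
  define S where "S = max 1 (R + norm v)"
  have fs: "cs f" using f C1_continuous by (auto simp: cs_def)
  have fdS: "supp_in (cball 0 R) (\<lambda>z. fd f z v)" using supp_in_fd f(2) by blast
  have fds: "cs (\<lambda>z. fd f z v)"
    using fdS C1_continuous_fd[OF f(1)] by (auto simp: cs_def)
  have "compact (g ` cball 0 S)"
    by (rule compact_continuous_image[OF continuous_on_subset[OF g]]) auto
  then obtain M where M: "M > 0" "\<And>z. z \<in> cball 0 S \<Longrightarrow> \<bar>g z\<bar> \<le> M"
    using compact_imp_bounded[of "g ` cball 0 S"] unfolding bounded_pos by auto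
  \<comment> \<open>M bounds g and \<open>(2 * S)\<^sup>2\<close> is the area of the square of
    integration, so the final estimate comes out as e / 2.\<close>
  define e' where "e' = e / (2 * M * (2 * S)\<^sup>2)"
  have e': "e' > 0" using e M by (simp add: e'_def S_def)
  obtain d where d: "d > 0" "\<And>z w. norm w < d \<Longrightarrow> \<bar>fd f (z + w) v - fd f z v\<bar> < e'"
    using cs_uniformly_continuous[OF fds e'] by blast
  obtain N where N: "\<And>n. n \<ge> N \<Longrightarrow> \<bar>t n\<bar> < min 1 (d / (norm v + 1))"
    using LIMSEQ_D[OF t(1), of "min 1 (d / (norm v + 1))"] d(1)
    by (auto simp: divide_pos_pos add_nonneg_pos)
  have "norm (plane_int (\<lambda>z. dq v (t n) f z * g z) - plane_int (\<lambda>z. fd f z v * g z)) < e" if n: "n \<ge> N" for n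
  proof -
    let ?D = "\<lambda>z. dq v (t n) f z * g z - fd f z v * g z"
    have csD: "cs ?D"
      by (intro cs_diff cs_mult1 cs_dq fs fds g)
    have sD: "supp_in (cball 0 S) ?D"
    proof -
      have "supp_in (cball 0 S) (dq v (t n) f)"
        by (rule supp_in_mono[OF dq_supp[OF f(2)]]) (use N[OF n] in \<open>auto simp: S_def\<close>)
      moreover have "supp_in (cball 0 S) (\<lambda>z. fd f z v)"
        by (rule supp_in_mono[OF fdS]) (auto simp: S_def intro!: max.coboundedI2 add_increasing2)
      ultimately show ?thesis by (simp add: supp_in_def)
    qed
    have "\<bar>?D z\<bar> \<le> e' * M" for z
    proof (cases "z \<in> cball 0 S")
      case True
      obtain s where s: "\<bar>s\<bar> \<le> \<bar>t n\<bar>" "dq v (t n) f z = fd f (z + of_real s * v) v"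
        using dq_mean_value[OF f(1) t(2)] by blast
      have "norm (of_real s * v) \<le> \<bar>t n\<bar> * (norm v + 1)"
        using s(1) by (auto simp: norm_mult intro!: mult_mono)
      also have "\<dots> < d"
        using N[OF n] by (simp add: pos_less_divide_eq add_nonneg_pos)
      finally have "\<bar>dq v (t n) f z - fd f z v\<bar> \<le> e'"
        using d(2)[of "of_real s * v" z] s(2) by simp
      then have "\<bar>dq v (t n) f z - fd f z v\<bar> * \<bar>g z\<bar> \<le> e' * M"
        using M(2)[OF True] e' by (intro mult_mono) auto
      then show ?thesis
        by (simp add: abs_mult flip: left_diff_distrib)
    next
      case False
      then have "?D z = 0" using sD unfolding supp_in_def by blast
      then have "\<bar>?D z\<bar> = 0" by (simp only: abs_zero)
      moreover have "0 \<le> e' * M" using e' M(1) by simp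
      ultimately show ?thesis by linarith
    qed
    then have "\<bar>plane_int ?D\<bar> \<le> e' * M * (2 * S)\<^sup>2"
      by (rule plane_int_bound[OF csD sD, rotated]) (simp add: S_def)
    also have "\<dots> = e / 2"
      using M(1) by (simp add: e'_def S_def field_simps power2_eq_square)
    also have "\<dots> < e" using e by simp
    finally show ?thesis
      by (simp add: plane_int_diff cs_mult1 cs_dq fs fds g)
  qed
  then show "\<exists>N. \<forall>n\<ge>N. norm (plane_int (\<lambda>z. dq v (t n) f z * g z) - plane_int (\<lambda>z. fd f z v * g z)) < e"
    by blast
qed

lemma test_supp_cball:
  assumes "test f"
  obtains R where "supp_in (cball 0 R) f"
proof -
  obtain K where "compact K" "supp_in K f" using assms by (auto simp: test_def)
  then show ?thesis
    using that compact_imp_bounded[of K] unfolding bounded_iff supp_in_def by (metis mem_cball_0)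
qed

lemma seq_inverse: "(\<lambda>n. 1 / real (Suc n)) \<longlonglongrightarrow> 0" "(\<lambda>n. - (1 / real (Suc n))) \<longlonglongrightarrow> 0"
  using LIMSEQ_inverse_real_of_nat tendsto_minus[OF LIMSEQ_inverse_real_of_nat]
  by (simp_all add: inverse_eq_divide)

text \<open>Translation invariance makes the integral of every difference quotient 0, and the
  derivative is their limit.\<close>

lemma plane_int_fd:
  assumes "test f"
  shows "plane_int (\<lambda>z. fd f z v) = 0"
proof -
  obtain R where R: "supp_in (cball 0 R) f" using assms by (rule test_supp_cball)
  have "(\<lambda>n. plane_int (\<lambda>z. dq v (1 / real (Suc n)) f z * 1)) \<longlonglongrightarrow> plane_int (\<lambda>z. fd f z v * 1)"
    by (rule plane_int_dq_tendsto[OF test_C1[OF assms] R _ seq_inverse(1)]) (simp_all add: continuous_on_const)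
  moreover have "plane_int (\<lambda>z. dq v t f z * 1) = 0" for t
  proof -
    have "plane_int (\<lambda>z. f (z + of_real t * v) - f z) = 0"
      using test_cs[OF assms] by (simp add: plane_int_diff cs_shift plane_int_shift)
    then show ?thesis
      using plane_int_scale[of "1 / t" "\<lambda>z. f (z + of_real t * v) - f z"] by (simp add: dq_def)
  qed
  ultimately have "(\<lambda>n. 0) \<longlonglongrightarrow> plane_int (\<lambda>z. fd f z v * 1)"
    by (simp only:)
  from LIMSEQ_unique[OF this tendsto_const] show ?thesis
    by simp
qed

lemma cs_prods:
  assumes "test f" "C1 g"
  shows "cs (\<lambda>z. f z * g z)" "cs (\<lambda>z. f z * fd g z v)" "cs (\<lambda>z. fd f z v * g z)" "cs (\<lambda>z. fd f z v * fd g z w)"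
  by (rule cs_mult1[OF test_cs[OF assms(1)] C1_continuous[OF assms(2)]]
      cs_mult1[OF test_cs[OF assms(1)] C1_continuous_fd[OF assms(2)]]
      cs_mult1[OF test_fd_cs[OF assms(1)] C1_continuous[OF assms(2)]]
      cs_mult1[OF test_fd_cs[OF assms(1)] C1_continuous_fd[OF assms(2)]])+

lemma plane_int_ibp:
  assumes "test f" "test g"
  shows "plane_int (\<lambda>z. fd f z v * g z) = - plane_int (\<lambda>z. f z * fd g z v)"
proof -
  have c: "C1 f" "C1 g" by (simp_all add: test_C1 assms)
  have "plane_int (\<lambda>z. f z * fd g z v + fd f z v * g z) = 0"
    using plane_int_fd[OF test_mult1[OF assms(1) c(2)], of v] by (simp add: fd_mult c)
  then show ?thesis
    using plane_int_add[OF cs_prods(2)[OF assms(1) c(2), of v] cs_prods(3)[OF assms(1) c(2), of v]] by simp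
qed

text \<open>Only first derivatives of the functions exist, so the symmetry of second derivatives is
  replaced by moving difference quotients from one factor to the other.\<close>

lemma plane_int_fd_swap:
  assumes f: "test f" and g: "test g"
  shows "plane_int (\<lambda>z. fd f z v * fd g z w) = plane_int (\<lambda>z. fd f z w * fd g z v)"
proof -
  have c: "C1 f" "C1 g" by (simp_all add: test_C1 assms)
  obtain R where R: "supp_in (cball 0 R) f" using f by (rule test_supp_cball)
  obtain S where S: "supp_in (cball 0 S) g" using g by (rule test_supp_cball)
  let ?t = "\<lambda>n. 1 / real (Suc n)"
  have 1: "(\<lambda>n. plane_int (\<lambda>z. dq v (?t n) f z * fd g z w)) \<longlonglongrightarrow> plane_int (\<lambda>z. fd f z v * fd g z w)"
    by (rule plane_int_dq_tendsto[OF c(1) R C1_continuous_fd[OF c(2)] seq_inverse(1)]) simp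
  have 2: "(\<lambda>n. plane_int (\<lambda>z. dq v (- ?t n) g z * fd f z w)) \<longlonglongrightarrow> plane_int (\<lambda>z. fd g z v * fd f z w)"
    by (rule plane_int_dq_tendsto[OF c(2) S C1_continuous_fd[OF c(1)] seq_inverse(2)]) simp
  have "plane_int (\<lambda>z. dq v t f z * fd g z w) = plane_int (\<lambda>z. dq v (- t) g z * fd f z w)" for t
  proof -
    let ?h = "of_real t * v"
    \<comment> \<open>Translation invariance moves the shift from f to g, and integration by parts
      moves the derivative from g to f.\<close>
    have shift_ibp: "plane_int (\<lambda>z. f (z + ?h) * fd g z w) = - plane_int (\<lambda>z. fd f z w * g (z - ?h))"
    proof -
      obtain K where K: "compact K" "supp_in K g" using g by (auto simp: test_def)
      have d: "((\<lambda>z. g (z - ?h)) has_derivative fd g (z - ?h)) (at z)" for z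
      proof -
        have "((\<lambda>z. z - ?h) has_derivative (\<lambda>v. v)) (at z)"
          by (rule has_derivative_eq_rhs[OF has_derivative_diff[OF has_derivative_ident has_derivative_const]]) simp
        from has_derivative_compose[OF this C1_has_derivative[OF c(2)]] show ?thesis .
      qed
      have cont: "continuous_on UNIV (\<lambda>z. fd g (z - ?h) v)" for v
        by (rule continuous_on_compose2[OF C1_continuous_fd[OF c(2), of UNIV]
            continuous_on_diff[OF continuous_on_id continuous_on_const]]) simp
      have C: "C1 (\<lambda>z. g (z - ?h))" and fdg: "fd (\<lambda>z. g (z - ?h)) z = fd g (z - ?h)" for z
        by (rule C1I[OF d cont])+
      have csg: "cs (\<lambda>z. f z * fd g (z - ?h) w)"
        using C1_continuous_fd[OF C, of UNIV w] test_cs[OF f] by (simp add: fdg cs_mult1)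
      have "plane_int (\<lambda>z. f (z + ?h) * fd g z w) = plane_int (\<lambda>z. f z * fd g (z - ?h) w)"
        using plane_int_shift[OF csg, of ?h] by simp
      also have "\<dots> = - plane_int (\<lambda>z. fd f z w * g (z - ?h))"
      proof -
        have "plane_int (\<lambda>z. f z * fd g (z - ?h) w + fd f z w * g (z - ?h)) = 0"
          using plane_int_fd[OF test_mult1[OF f C], of w] by (simp add: fd_mult c C fdg)
        then show ?thesis
          using plane_int_add[OF csg cs_prods(3)[OF f C, of w]] by simp
      qed
      finally show ?thesis .
    qed
    have cont: "continuous_on UNIV (\<lambda>z. g (z - ?h))"
      by (rule continuous_on_compose2[OF C1_continuous[OF c(2), of UNIV]
            continuous_on_diff[OF continuous_on_id continuous_on_const]]) simp
    have "plane_int (\<lambda>z. f (z + ?h) * fd g z w - f z * fd g z w) =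
        plane_int (\<lambda>z. fd f z w * g z - fd f z w * g (z - ?h))"
      using plane_int_ibp[OF f g, of w] shift_ibp
        plane_int_diff[OF cs_mult1[OF cs_shift[OF test_cs[OF f]] C1_continuous_fd[OF c(2)]] cs_prods(2)[OF f c(2)], of ?h w w]
        plane_int_diff[OF cs_prods(3)[OF f c(2)] cs_mult1[OF test_fd_cs[OF f] cont], of w w]
      by simp
    then have "plane_int (\<lambda>z. (1 / t) * (f (z + ?h) * fd g z w - f z * fd g z w)) =
        plane_int (\<lambda>z. (1 / t) * (fd f z w * g z - fd f z w * g (z - ?h)))"
      by (simp only: plane_int_scale)
    moreover have "(1 / t) * (f (z + ?h) * fd g z w - f z * fd g z w) = dq v t f z * fd g z w"
      "(1 / t) * (fd f z w * g z - fd f z w * g (z - ?h)) = dq v (- t) g z * fd f z w" for z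
    proof -
      show "(1 / t) * (f (z + ?h) * fd g z w - f z * fd g z w) = dq v t f z * fd g z w"
        by (simp add: dq_def left_diff_distrib)
      have "dq v (- t) g z = (g z - g (z - ?h)) / t"
        by (simp add: dq_def divide_inverse algebra_simps del: minus_diff_eq)
      then show "(1 / t) * (fd f z w * g z - fd f z w * g (z - ?h)) = dq v (- t) g z * fd f z w"
        by (simp add: right_diff_distrib diff_divide_distrib mult.commute)
    qed
    ultimately show ?thesis by (simp only:)
  qed
  then have "(\<lambda>n. plane_int (\<lambda>z. dq v (?t n) f z * fd g z w)) \<longlonglongrightarrow> plane_int (\<lambda>z. fd g z v * fd f z w)"
    using 2 by (simp only:)
  then have "plane_int (\<lambda>z. fd f z v * fd g z w) = plane_int (\<lambda>z. fd g z v * fd f z w)"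
    by (rule LIMSEQ_unique[OF 1])
  then show ?thesis by (simp add: mult.commute)
qed

text \<open>The density of the 2-form df \<and> dg with respect to dx dy.\<close>

definition bracket :: "(complex \<Rightarrow> real) \<Rightarrow> (complex \<Rightarrow> real) \<Rightarrow> complex \<Rightarrow> real" where
  "bracket f g z = fd f z 1 * fd g z \<i> - fd f z \<i> * fd g z 1"

text \<open>The density of df \<and> \<eta>, where \<eta> = P dx + Q dy is encoded as P -
  iQ.\<close>

definition wedge :: "(complex \<Rightarrow> real) \<Rightarrow> (complex \<Rightarrow> complex) \<Rightarrow> complex \<Rightarrow> real" where
  "wedge f \<eta> z = - (fd f z 1 * Im (\<eta> z)) - fd f z \<i> * Re (\<eta> z)"

lemma cs_bracket:
  assumes "test f" "C1 g"
  shows "cs (bracket f g)"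
  unfolding bracket_def[abs_def] using assms
  by (intro cs_diff cs_mult1 test_fd_cs C1_continuous_fd) auto

lemma cs_wedge:
  assumes "C1 f" "test \<eta>"
  shows "cs (wedge f \<eta>)"
  unfolding wedge_def[abs_def] using assms
  by (intro cs_diff cs_minus cs_mult2 test_cs C1_continuous_fd test_bounded_linear[OF bounded_linear_Re]
      test_bounded_linear[OF bounded_linear_Im]) auto

text \<open>Stokes' theorem for the compactly supported form f \<eta>.\<close>

lemma plane_int_curl:
  assumes \<eta>: "test \<eta>" and f: "test f"
  shows "plane_int (\<lambda>z. f z * curl \<eta> z) = - plane_int (wedge f \<eta>)"
proof -
  note C = test_C1[OF \<eta>]
  note t = test_bounded_linear[OF bounded_linear_Re \<eta>] test_bounded_linear[OF bounded_linear_Im \<eta>]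
  have "plane_int (\<lambda>z. - (fd (\<lambda>z. Im (\<eta> z)) z 1 * f z) - fd (\<lambda>z. Re (\<eta> z)) z \<i> * f z) =
     - plane_int (\<lambda>z. fd (\<lambda>z. Im (\<eta> z)) z 1 * f z) - plane_int (\<lambda>z. fd (\<lambda>z. Re (\<eta> z)) z \<i> * f z)"
    using plane_int_diff[OF cs_minus[OF cs_prods(3)[OF t(2) test_C1[OF f]]] cs_prods(3)[OF t(1) test_C1[OF f]], of 1 \<i>]
    by (simp add: plane_int_minus)
  also have "\<dots> = plane_int (\<lambda>z. Im (\<eta> z) * fd f z 1) + plane_int (\<lambda>z. Re (\<eta> z) * fd f z \<i>)"
    by (simp add: plane_int_ibp[OF t(1) f] plane_int_ibp[OF t(2) f])
  also have "\<dots> = plane_int (\<lambda>z. Im (\<eta> z) * fd f z 1 + Re (\<eta> z) * fd f z \<i>)"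
    using plane_int_add[OF cs_prods(2)[OF t(2) test_C1[OF f]] cs_prods(2)[OF t(1) test_C1[OF f]], of 1 \<i>] by simp
  also have "\<dots> = - plane_int (wedge f \<eta>)"
    by (simp add: wedge_def mult.commute add.commute flip: plane_int_minus)
  finally show ?thesis
    by (simp add: curl_def fd_Re[OF C] fd_Im[OF C] algebra_simps)
qed

lemma plane_int_bracket:
  assumes "test f" "test g"
  shows "plane_int (bracket f g) = 0"
  using plane_int_fd_swap[OF assms, of 1 \<i>]
    plane_int_diff[OF cs_prods(4)[OF assms(1) test_C1[OF assms(2)]] cs_prods(4)[OF assms(1) test_C1[OF assms(2)]], of 1 \<i> \<i> 1]
  by (simp add: bracket_def[abs_def])

text \<open>The integral of dg \<and> d(f h) vanishes, and \<open>bracket\<close> is a derivation in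
  its second argument.\<close>

lemma plane_int_bracket3:
  assumes f: "test f" and g: "test g" and h: "test h"
  shows "plane_int (\<lambda>z. f z * bracket g h z) = - plane_int (\<lambda>z. h z * bracket g f z)"
proof -
  have C: "C1 f" "C1 g" "C1 h" by (simp_all add: test_C1 assms)
  have "plane_int (bracket g (\<lambda>z. f z * h z)) = 0"
    by (rule plane_int_bracket[OF g test_mult1[OF f C(3)]])
  moreover have "bracket g (\<lambda>z. f z * h z) = (\<lambda>z. f z * bracket g h z + h z * bracket g f z)"
    by (simp add: bracket_def fun_eq_iff fd_mult C algebra_simps)
  ultimately have "plane_int (\<lambda>z. f z * bracket g h z + h z * bracket g f z) = 0"
    by simp
  then show ?thesis
    using plane_int_add[OF cs_mult2[OF cs_bracket[OF g C(3)] C1_continuous[OF C(1)]]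
        cs_mult2[OF cs_bracket[OF g C(1)] C1_continuous[OF C(3)]]] by simp
qed

subsection \<open>Invariance of the integral\<close>

lemma upper_half_lebesgue: "{x. cx x \<in> upper_half} \<in> sets lebesgue"
proof -
  have "{x. cx x \<in> upper_half} = cx -` upper_half" by auto
  moreover have "open (cx -` upper_half)"
    by (rule open_vimage) (auto intro!: linear_continuous_on bounded_linear_cx)
  ultimately show ?thesis by auto
qed

lemma pull2_cs:
  assumes g: "g \<in> SL2" and f: "cs f" "compact K" "K \<subseteq> upper_half" "supp_in K f"
  shows "cs (pull2 g f)"
proof (rule csI_compact)
  note c = compact_moeb_inv[OF g f(2,3)]
  show s: "supp_in (moeb_inv g ` K) (pull2 g f)"
    using supp_in_moeb[OF g f(4,3)] by (simp add: supp_in_def pull2_def)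
  show "compact (moeb_inv g ` K)" by (rule c)
  have "continuous_on upper_half (pull2 g f)"
    unfolding pull2_def[abs_def] using f(1) jfac_nonzero[OF g]
    by (intro continuous_on_divide continuous_on_compose2[of UNIV f, OF _ continuous_on_moeb[OF g]] continuous_intros
      continuous_on_jfac) (auto simp: cs_def)
  moreover have "continuous_on (- (moeb_inv g ` K)) (pull2 g f)"
    using s by (subst continuous_on_cong[OF refl, of _ _ "\<lambda>_. 0"]) (auto simp: supp_in_def continuous_on_const)
  ultimately have "continuous_on (upper_half \<union> - (moeb_inv g ` K)) (pull2 g f)"
    using compact_imp_closed[OF c(1)] by (intro continuous_on_open_Un) (auto simp: open_Compl)
  moreover have "upper_half \<union> - (moeb_inv g ` K) = UNIV" using c(2) by auto
  ultimately show "continuous_on UNIV (pull2 g f)" by simp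
qed

text \<open>The map is a bijection of the half plane whose real Jacobian is exactly the factor
  |j|^-4 in \<open>pull2\<close>.\<close>

lemma plane_int_pull2:
  assumes g: "g \<in> SL2" and f: "cs f" "compact K" "K \<subseteq> upper_half" "supp_in K f"
  shows "plane_int (pull2 g f) = plane_int f"
proof -
  define S where "S = {x. cx x \<in> upper_half}"
  define G where "G x = xc (moeb g (cx x))" for x
  define G' where "G' x v = xc (cx v / (jfac g (cx x))\<^sup>2)" for x v
  \<comment> \<open>The change of variables is applied to a vector-valued integrand, hence the
    passage to \<open>real^1\<close>.\<close>
  define F where "F x = (vec (f (cx x)) :: real^1)" for x
  have S: "S \<in> sets lebesgue" unfolding S_def by (rule upper_half_lebesgue)
  have der: "(G has_derivative G' x) (at x within S)" if "x \<in> S" for x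
  proof -
    have "(cx has_derivative cx) (at x)" by (rule bounded_linear_imp_has_derivative[OF bounded_linear_cx])
    from has_derivative_compose[OF this moeb_has_derivative[OF g]] that
    have "((\<lambda>x. moeb g (cx x)) has_derivative (\<lambda>v. cx v / (jfac g (cx x))\<^sup>2)) (at x)"
      by (simp add: S_def)
    from bounded_linear.has_derivative[OF bounded_linear_xc this] show ?thesis
      unfolding G_def[abs_def] G'_def[abs_def] by (rule has_derivative_at_withinI)
  qed
  have inj: "inj_on G S"
  proof (rule inj_onI)
    fix x y assume "x \<in> S" "y \<in> S" "G x = G y"
    then have "moeb g (cx x) = moeb g (cx y)" by (metis G_def cx_xc)
    then have "cx x = cx y"
      using \<open>x \<in> S\<close> \<open>y \<in> S\<close> moeb_inv_inverse(3)[OF g] by (metis S_def mem_Collect_eq)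
    then show "x = y" by (metis xc_cx)
  qed
  have im: "G ` S = S"
  proof
    show "G ` S \<subseteq> S" by (auto simp: G_def S_def moeb_upper_half_iff[OF g])
    show "S \<subseteq> G ` S"
    proof
      fix y assume y: "y \<in> S"
      have "G (xc (moeb_inv g (cx y))) = y"
        using y by (simp add: G_def S_def moeb_inv_inverse[OF g])
      moreover have "xc (moeb_inv g (cx y)) \<in> S"
        using y by (simp add: S_def moeb_inv_inverse[OF g])
      ultimately show "y \<in> G ` S" by (metis imageI)
    qed
  qed
  have det: "\<bar>det (matrix (G' x))\<bar> = 1 / (norm (jfac g (cx x))) ^ 4" for x
  proof -
    define w where "w = 1 / (jfac g (cx x))\<^sup>2"
    have G'w: "G' x v = xc (cx v * w)" for v by (simp add: G'_def w_def)
    have "det (matrix (G' x)) = (Re w)\<^sup>2 + (Im w)\<^sup>2"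
      by (simp add: det_2 matrix_def G'w xc_def cx_def axis_def power2_eq_square)
    also have "\<dots> = 1 / (norm (jfac g (cx x))) ^ 4"
      unfolding cmod_power2[symmetric] w_def by (simp add: norm_divide norm_power power_divide flip: power_mult)
    finally show ?thesis by simp
  qed
  have hF: "(F has_integral vec (plane_int h)) UNIV" if "\<And>x. F x = vec (h (cx x))" "cs h" for h :: "complex \<Rightarrow> real" and F :: "real^2 \<Rightarrow> real^1"
  proof -
    have "bounded_linear (vec :: real \<Rightarrow> real^1)"
      by (rule linear_conv_bounded_linear[THEN iffD1], rule linearI) (simp_all add: vec_eq_iff)
    from has_integral_linear[OF cs_has_integral_UNIV[OF that(2)] this] show ?thesis
      by (simp add: that(1)[abs_def] o_def)
  qed
  have restr: "(H has_integral I) S \<longleftrightarrow> (H has_integral I) UNIV" if "\<And>x. x \<notin> S \<Longrightarrow> H x = 0" for H :: "real^2 \<Rightarrow> real^1" and I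
  proof -
    have "(\<lambda>x. if x \<in> S then H x else 0) = H" using that by auto
    then show ?thesis using has_integral_restrict_UNIV[of S H I] by simp
  qed
  have csa: "cs (\<lambda>z. \<bar>f z\<bar>)"
    using f(1) by (auto simp: cs_def supp_in_def intro!: continuous_intros)
  have F0: "F x = 0" if "x \<notin> S" for x
    using that f(3,4) by (auto simp: F_def S_def supp_in_def vec_eq_iff)
  have "F absolutely_integrable_on S"
  proof (rule absolutely_integrable_onI)
    show "F integrable_on S" unfolding integrable_on_def using restr[of F, OF F0] hF[of F f, OF F_def f(1)] by blast
    have "(\<lambda>x. \<bar>f (cx x)\<bar>) integrable_on UNIV"
      using cs_has_integral_UNIV[OF csa] by (auto simp: integrable_on_def)
    then have "(\<lambda>x. norm (F x)) integrable_on UNIV"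
      by (simp add: F_def norm_vec_def L2_set_def)
    moreover have "(\<lambda>x. if x \<in> S then norm (F x) else 0) = (\<lambda>x. norm (F x))"
      using F0 by auto
    ultimately show "(\<lambda>x. norm (F x)) integrable_on S"
      using integrable_restrict_UNIV[of S "\<lambda>x. norm (F x)"] by simp
  qed
  then have "F absolutely_integrable_on (G ` S)" by (simp add: im)
  then have eq: "integral S (\<lambda>x. \<bar>det (matrix (G' x))\<bar> *\<^sub>R F (G x)) = integral (G ` S) F"
    using has_absolute_integral_change_of_variables[OF S der inj, of F "integral (G ` S) F"] by blast
  have "integral S F = vec (plane_int f)"
    by (rule integral_unique, rule restr[THEN iffD2, OF F0 hF[of F f, OF F_def f(1)]])
  moreover have "integral S (\<lambda>x. \<bar>det (matrix (G' x))\<bar> *\<^sub>R F (G x)) = vec (plane_int (pull2 g f))"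
  proof (rule integral_unique)
    have e: "\<bar>det (matrix (G' x))\<bar> *\<^sub>R F (G x) = vec (pull2 g f (cx x))" for x
      by (simp add: det F_def G_def pull2_def vec_eq_iff)
    show "((\<lambda>x. \<bar>det (matrix (G' x))\<bar> *\<^sub>R F (G x)) has_integral vec (plane_int (pull2 g f))) S"
    proof (rule restr[THEN iffD2, OF _ hF[OF e pull2_cs[OF g f]]])
      fix x assume "x \<notin> S"
      then have "moeb g (cx x) \<notin> K" using f(3) moeb_upper_half_iff[OF g] by (auto simp: S_def)
      then show "\<bar>det (matrix (G' x))\<bar> *\<^sub>R F (G x) = 0"
        using f(4) by (simp add: F_def G_def supp_in_def vec_eq_iff)
    qed
  qed
  ultimately have "(vec (plane_int (pull2 g f)) :: real^1) = vec (plane_int f)"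
    using eq im by simp
  then show ?thesis by (simp add: vec_eq_iff)
qed

subsection \<open>Poincare lemmas with compact support\<close>

text \<open>The antiderivative of f along the unit direction e that starts behind the support; for a
  bounded support only a finite interval contributes.\<close>

definition ray :: "complex \<Rightarrow> (complex \<Rightarrow> real) \<Rightarrow> complex \<Rightarrow> real" where
  "ray e f z = integral {0..} (\<lambda>s. f (z - of_real s * e))"

lemma ray_eq:
  assumes "supp_in (cball 0 R) f" "norm e = 1" "norm z + R \<le> M"
  shows "ray e f z = integral {0..M} (\<lambda>s. f (z - of_real s * e))"
proof -
  have "(if s \<in> {0..} then f (z - of_real s * e) else 0) = (if s \<in> {0..M} then f (z - of_real s * e) else 0)" for s
  proof (cases "s > M \<and> s \<ge> 0")
    case True
    then have "norm (of_real s * e) > norm z + R" using assms by (simp add: norm_mult)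
    then have "norm (z - of_real s * e) > R"
      using norm_triangle_ineq4[of z "z - of_real s * e"] by simp
    then show ?thesis using True assms(1) by (simp add: supp_in_def)
  qed auto
  then have "integral UNIV (\<lambda>s. if s \<in> {0..} then f (z - of_real s * e) else 0) =
      integral UNIV (\<lambda>s. if s \<in> {0..M} then f (z - of_real s * e) else 0)"
    by (simp only:)
  then show ?thesis
    unfolding integral_restrict_UNIV ray_def .
qed

lemma ray_zero:
  assumes "\<And>s. s \<ge> 0 \<Longrightarrow> f (z - of_real s * e) = 0"
  shows "ray e f z = 0"
  unfolding ray_def
proof (rule integral_unique, rule has_integral_is_0)
  fix s :: real assume "s \<in> {0..}"
  then show "f (z - of_real s * e) = 0" using assms by blast
qed

lemma continuous_on_ray_integrand:
  assumes "continuous_on UNIV g"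
  shows "continuous_on S (\<lambda>p. g (fst p - of_real (snd p) * (e :: complex)))"
proof -
  have "continuous_on S (\<lambda>p. fst p - of_real (snd p) * e)" by (intro continuous_intros)
  then show ?thesis by (rule continuous_on_compose2[OF assms]) (rule subset_UNIV)
qed

lemma continuous_on_ray:
  assumes g: "continuous_on UNIV g" "supp_in (cball 0 R) g" and e: "norm e = 1"
  shows "continuous_on UNIV (ray e g)"
proof -
  have "continuous (at z0) (ray e g)" for z0
  proof -
    define M where "M = norm z0 + 1 + R"
    have "continuous_on (ball z0 1) (\<lambda>z. integral (cbox 0 M) (\<lambda>s. g (z - of_real s * e)))"
      by (rule integral_continuous_on_param)
        (use continuous_on_ray_integrand[OF g(1)] in \<open>simp add: case_prod_beta\<close>)
    moreover have "ray e g z = integral (cbox 0 M) (\<lambda>s. g (z - of_real s * e))" if "z \<in> ball z0 1" for z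
      using ray_eq[OF g(2) e, of z M] that norm_triangle_ineq4[of z0 "z0 - z"] by (simp add: M_def dist_norm)
    ultimately have "continuous_on (ball z0 1) (ray e g)"
      by (metis (no_types, lifting) continuous_on_cong)
    then show ?thesis
      by (rule continuous_on_interior) simp
  qed
  then show ?thesis by (simp add: continuous_on_eq_continuous_at)
qed

lemma ray_has_derivative:
  assumes f: "C1 f" "supp_in (cball 0 R) f" and e: "norm e = 1"
  shows "(ray e f has_derivative (\<lambda>v. ray e (\<lambda>w. fd f w v) z0)) (at z0)"
proof -
  \<comment> \<open>One compact interval serves all z within distance 1 of z0, which permits
    differentiation under the integral.\<close>
  define M where "M = norm z0 + 1 + R"
  define Fx where "Fx z t = Blinfun (fd f (z - of_real t * e))" for z :: complex and t :: real
  have Fx: "blinfun_apply (Fx z t) = fd f (z - of_real t * e)" for z t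
    unfolding Fx_def by (rule bounded_linear_Blinfun_apply[OF has_derivative_bounded_linear[OF C1_has_derivative[OF f(1)]]])
  have contFx: "continuous_on S (\<lambda>p. Fx (fst p) (snd p))" for S
    by (rule continuous_on_blinfun_componentwise, unfold Fx)
      (rule continuous_on_ray_integrand[OF C1_continuous_fd[OF f(1)]])
  have cont_t: "continuous_on S (Fx z0)" for S
  proof -
    have "continuous_on S (\<lambda>t. (z0, t))" by (intro continuous_intros)
    then have "continuous_on S (\<lambda>t. Fx (fst (z0, t)) (snd (z0, t)))"
      by (rule continuous_on_compose2[OF contFx]) (rule subset_UNIV)
    then show ?thesis by simp
  qed
  have "((\<lambda>z. integral (cbox 0 M) (\<lambda>t. f (z - of_real t * e))) has_derivative
      blinfun_apply (integral (cbox 0 M) (Fx z0))) (at z0 within ball z0 1)"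
  proof (rule leibniz_rule)
    fix z :: complex and t :: real
    have "((\<lambda>z. z - of_real t * e) has_derivative (\<lambda>v. v)) (at z)"
      by (rule has_derivative_eq_rhs[OF has_derivative_diff[OF has_derivative_ident has_derivative_const]]) simp
    from has_derivative_compose[OF this C1_has_derivative[OF f(1)]]
    show "((\<lambda>z. f (z - of_real t * e)) has_derivative blinfun_apply (Fx z t)) (at z within ball z0 1)"
      unfolding Fx by (rule has_derivative_at_withinI)
    show "(\<lambda>t. f (z - of_real t * e)) integrable_on cbox 0 M"
    proof (rule integrable_continuous)
      have "continuous_on (cbox 0 M) (\<lambda>t. z - of_real t * e)" by (intro continuous_intros)
      then show "continuous_on (cbox 0 M) (\<lambda>t. f (z - of_real t * e))"
        by (rule continuous_on_compose2[OF C1_continuous[OF f(1)]]) (rule subset_UNIV)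
    qed
    show "continuous_on (ball z0 1 \<times> cbox 0 M) (\<lambda>(x, t). Fx x t)"
      using contFx by (simp add: case_prod_beta)
  qed auto
  then have "((\<lambda>z. integral (cbox 0 M) (\<lambda>t. f (z - of_real t * e))) has_derivative
      blinfun_apply (integral (cbox 0 M) (Fx z0))) (at z0)"
    using at_within_open[of z0 "ball z0 1"] by simp
  then have "(ray e f has_derivative blinfun_apply (integral (cbox 0 M) (Fx z0))) (at z0)"
  proof (rule has_derivative_transform_within_open[where s = "ball z0 1"])
    fix z assume "z \<in> ball z0 1"
    then show "integral (cbox 0 M) (\<lambda>t. f (z - of_real t * e)) = ray e f z"
      using ray_eq[OF f(2) e, of z M] norm_triangle_ineq4[of z0 "z0 - z"] by (simp add: M_def dist_norm)
  qed auto
  moreover have "blinfun_apply (integral (cbox 0 M) (Fx z0)) v = ray e (\<lambda>w. fd f w v) z0" for v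
  proof -
    have "Fx z0 integrable_on cbox 0 M" by (rule integrable_continuous[OF cont_t])
    from blinfun_apply_integral[OF this] show ?thesis
      using ray_eq[OF supp_in_fd[OF closed_cball f(2)] e, of z0 M v] by (simp add: Fx M_def)
  qed
  then have "blinfun_apply (integral (cbox 0 M) (Fx z0)) = (\<lambda>v. ray e (\<lambda>w. fd f w v) z0)" by (rule ext)
  ultimately show ?thesis by simp
qed

lemma ray_C1:
  assumes f: "C1 f" "supp_in (cball 0 R) f" and e: "norm e = 1"
  shows "C1 (ray e f)" "fd (ray e f) z v = ray e (\<lambda>w. fd f w v) z" "fd (ray e f) z e = f z"
proof -
  note d = ray_has_derivative[OF f e]
  have c: "continuous_on UNIV (\<lambda>z. ray e (\<lambda>w. fd f w v) z)" for v
    using continuous_on_ray[OF C1_continuous_fd[OF f(1)] supp_in_fd[OF closed_cball f(2)] e] .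
  show "C1 (ray e f)" and fd: "fd (ray e f) z v = ray e (\<lambda>w. fd f w v) z" for z v
    using C1I[OF d c] by auto
  define R' where "R' = max R 0"
  define M where "M = norm z + R' + 1"
  have R': "supp_in (cball 0 R') f" using f(2) by (auto simp: supp_in_def R'_def)
  have vd: "((\<lambda>t. - f (z - of_real t * e)) has_vector_derivative fd f (z - of_real t * e) e) (at t within S)" for t S
  proof -
    have "((\<lambda>t. z - of_real t * e) has_derivative (\<lambda>h. - (of_real h * e))) (at t)"
      by (auto intro!: derivative_eq_intros)
    from has_derivative_minus[OF has_derivative_compose[OF this C1_has_derivative[OF f(1)]]]
    have "((\<lambda>t. - f (z - of_real t * e)) has_derivative (\<lambda>h. - fd f (z - of_real t * e) (- (h *\<^sub>R e)))) (at t)"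
      by (simp add: scaleR_conv_of_real)
    then show ?thesis
      unfolding has_vector_derivative_def
      by (simp add: linear_neg[OF C1_linear[OF f(1)]] linear_scale[OF C1_linear[OF f(1)]] has_derivative_at_withinI)
  qed
  have "0 \<le> M" by (simp add: M_def R'_def)
  from fundamental_theorem_of_calculus[OF this vd]
  have "integral {0..M} (\<lambda>t. fd f (z - of_real t * e) e) = f z - f (z - of_real M * e)"
    by (auto dest: integral_unique)
  moreover have "f (z - of_real M * e) = 0"
  proof -
    have "norm (of_real M * e) = M" using \<open>0 \<le> M\<close> e by (simp add: norm_mult)
    then have "norm (of_real M * e) > norm z + R'" by (simp add: M_def)
    then have "norm (z - of_real M * e) > R'"
      using norm_triangle_ineq4[of z "z - of_real M * e"] by simp
    then show ?thesis using R' by (simp add: supp_in_def)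
  qed
  moreover have "ray e (\<lambda>w. fd f w e) z = integral {0..M} (\<lambda>t. fd f (z - of_real t * e) e)"
    by (rule ray_eq[OF supp_in_fd[OF closed_cball R'] e]) (simp add: M_def)
  ultimately show "fd (ray e f) z e = f z" by (simp add: fd)
qed

lemma C1_const_along:
  assumes F: "C1 (F :: complex \<Rightarrow> real)" and z: "\<And>t. 0 \<le> t \<Longrightarrow> t \<le> s \<Longrightarrow> fd F (z + of_real t * e) e = 0" and s: "0 \<le> s"
  shows "F (z + of_real s * e) = F z"
proof -
  have "((\<lambda>t. F (z + of_real t * e)) has_derivative (\<lambda>h. 0)) (at t within {0..s})" if "t \<in> {0..s}" for t
  proof -
    have "((\<lambda>t. z + of_real t * e) has_derivative (\<lambda>h. of_real h * e)) (at t)"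
      by (auto intro!: derivative_eq_intros)
    from has_derivative_compose[OF this C1_has_derivative[OF F]]
    have "((\<lambda>t. F (z + of_real t * e)) has_derivative (\<lambda>h. fd F (z + of_real t * e) (h *\<^sub>R e))) (at t)"
      by (simp add: scaleR_conv_of_real)
    then show ?thesis
      using z[of t] that by (simp add: linear_scale[OF C1_linear[OF F]] has_derivative_at_withinI)
  qed
  then obtain c where "\<And>t. t \<in> {0..s} \<Longrightarrow> F (z + of_real t * e) = c"
    using has_derivative_zero_constant[of "{0..s}" "\<lambda>t. F (z + of_real t * e)"] by auto
  from this[of 0] this[of s] s show ?thesis by simp
qed

definition rect :: "real \<Rightarrow> real \<Rightarrow> real \<Rightarrow> complex set" where
  "rect a c d = {z. \<bar>Re z\<bar> \<le> a \<and> c \<le> Im z \<and> Im z \<le> d}"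

lemma compact_rect: "compact (rect a c d)"
proof -
  have "rect a c d = cbox (Complex (- a) c) (Complex a d)"
    by (auto simp: rect_def in_cbox_complex_iff abs_le_iff)
  then show ?thesis by simp
qed

lemma rect_upper_half: "c > 0 \<Longrightarrow> rect a c d \<subseteq> upper_half"
  by (auto simp: rect_def upper_half_def)

lemma compact_in_rect:
  assumes "compact K" "K \<subseteq> upper_half"
  obtains a c d where "0 < a" "0 < c" "c < d" "K \<subseteq> rect a c d"
proof -
  obtain R where R: "R > 0" "\<And>z. z \<in> K \<Longrightarrow> norm z \<le> R"
    using compact_imp_bounded[OF assms(1)] unfolding bounded_pos by auto
  have "\<exists>c>0. \<forall>z\<in>K. c \<le> Im z"
  proof (cases "K = {}")
    case False
    then obtain w where w: "w \<in> K" "\<And>z. z \<in> K \<Longrightarrow> Im w \<le> Im z"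
      using continuous_attains_inf[OF assms(1) False continuous_on_Im[OF continuous_on_id]] by blast
    then show ?thesis using assms(2) by (auto simp: upper_half_def)
  qed (auto intro: exI[of _ 1])
  then obtain c where c: "c > 0" "\<And>z. z \<in> K \<Longrightarrow> c \<le> Im z" by auto
  have "K \<subseteq> rect R c (R + c)"
  proof
    fix z assume z: "z \<in> K"
    then show "z \<in> rect R c (R + c)"
      using R(2)[OF z] c abs_Re_le_cmod[of z] abs_Im_le_cmod[of z] by (force simp: rect_def)
  qed
  with R(1) c(1) show ?thesis by (intro that[of R c "R + c"]) auto
qed

lemma rect_cball: "\<exists>R. rect a c d \<subseteq> cball 0 R"
  using compact_imp_bounded[OF compact_rect] unfolding bounded_iff by (metis mem_cball_0 subsetI)

text \<open>Integrating P horizontally from the left gives the primitive; closedness supplies its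
  vertical derivative. Compact support is the issue only to the right of the rectangle.\<close>

lemma closed_form_exact:
  assumes \<eta>: "test \<eta>" and closed: "\<And>z. curl \<eta> z = 0"
  shows "\<exists>\<theta>. test \<theta> \<and> (\<forall>z v. fd \<theta> z v = Re (\<eta> z * v))"
proof -
  obtain K where K: "compact K" "K \<subseteq> upper_half" "supp_in K \<eta>" using \<eta> by (auto simp: test_def)
  obtain a c d where r: "0 < a" "0 < c" "c < d" "K \<subseteq> rect a c d" using compact_in_rect[OF K(1,2)] .
  obtain R where R: "rect a c d \<subseteq> cball 0 R" using rect_cball by blast
  have C: "C1 \<eta>" using \<eta> by (rule test_C1)
  have sr: "supp_in (rect a c d) \<eta>" using K(3) r(4) by (rule supp_in_mono)
  define P where "P z = Re (\<eta> z)" for z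
  define Q where "Q z = - Im (\<eta> z)" for z
  have PQ: "C1 P" "C1 Q" unfolding P_def[abs_def] Q_def[abs_def] by (intro C1_minus C1_Re C1_Im C)+
  have s: "supp_in (cball 0 R) P" "supp_in (cball 0 R) Q"
    using supp_in_mono[OF sr R] by (auto simp: supp_in_def P_def Q_def)
  have fdeq: "fd P z \<i> = fd Q z 1" for z
    using closed[of z] unfolding P_def[abs_def] Q_def[abs_def]
    by (simp add: curl_def fd_Re fd_Im fd_minus C C1_Im)
  define \<theta> where "\<theta> = ray 1 P"
  note rP = ray_C1[OF PQ(1) s(1), of 1] and rQ = ray_C1[OF PQ(2) s(2), of 1]
  have C\<theta>: "C1 \<theta>" unfolding \<theta>_def by (rule rP) simp
  have "fd \<theta> z \<i> = Q z" for z
  proof -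
    have "fd \<theta> z \<i> = ray 1 (\<lambda>w. fd Q w 1) z"
      unfolding \<theta>_def using rP(2)[of z \<i>] by (simp add: fdeq)
    then show ?thesis using rQ(2)[of z 1] rQ(3)[of z] by simp
  qed
  moreover have "fd \<theta> z 1 = P z" for z unfolding \<theta>_def using rP(3)[of z] by simp
  ultimately have fd: "fd \<theta> z v = Re (\<eta> z * v)" for z v
    by (subst C1_fd_basis[OF C\<theta>]) (simp add: P_def Q_def)
  have "supp_in (rect a c d) \<theta>"
    unfolding supp_in_def
  proof (intro allI impI)
    fix z assume z: "z \<notin> rect a c d"
    have zero: "\<theta> z = 0" if "Im z < c \<or> Im z > d \<or> Re z < - a" for z
      unfolding \<theta>_def
    proof (rule ray_zero)
      fix s :: real assume "s \<ge> 0"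
      then have "z - of_real s * 1 \<notin> rect a c d" using that by (auto simp: rect_def)
      then show "P (z - of_real s * 1) = 0" using sr by (simp add: P_def supp_in_def)
    qed
    show "\<theta> z = 0"
    proof (cases "Im z < c \<or> Im z > d \<or> Re z < - a")
      case False
      then have "Re z > a" using z by (auto simp: rect_def)
      \<comment> \<open>The half plane to the right of the rectangle is convex and \<eta> vanishes
        there, so \<theta> is constant on it. It reaches above the rectangle, where \<theta> is
        0.\<close>
      have "(\<theta> has_derivative (\<lambda>_. 0)) (at w within {w. Re w > a})" if "w \<in> {w. Re w > a}" for w
      proof -
        have "w \<notin> rect a c d" using that by (auto simp: rect_def)
        then have "\<eta> w = 0" using sr by (simp add: supp_in_def)
        then have "fd \<theta> w = (\<lambda>_. 0)" by (simp add: fd fun_eq_iff)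
        then show ?thesis using C1_has_derivative[OF C\<theta>, of w] by (simp add: has_derivative_at_withinI)
      qed
      then obtain k where k: "\<And>w. Re w > a \<Longrightarrow> \<theta> w = k"
        using has_derivative_zero_constant[of "{w. Re w > a}" \<theta>] convex_halfspace_Re_gt[of a] by auto
      have "\<theta> z = \<theta> (Complex (Re z) (d + 1))" using k[of z] k[of "Complex (Re z) (d + 1)"] \<open>Re z > a\<close> by simp
      then show ?thesis using zero[of "Complex (Re z) (d + 1)"] by simp
    qed (rule zero)
  qed
  then have "test \<theta>"
    using testI[OF C\<theta> compact_rect rect_upper_half] r(2) by blast
  with fd show ?thesis by blast
qed

lemma has_real_derivative_max_power:
  "((\<lambda>t. max 0 t ^ Suc (Suc n)) has_real_derivative real (Suc (Suc n)) * max 0 t ^ Suc n) (at t)"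
proof -
  consider "t > 0" | "t < 0" | "t = 0" by linarith
  then show ?thesis
  proof cases
    case 1
    then have "max 0 t = t" by simp
    then have "((\<lambda>t. t ^ Suc (Suc n)) has_real_derivative real (Suc (Suc n)) * max 0 t ^ Suc n) (at t)"
      using DERIV_pow[of "Suc (Suc n)" t] by simp
    then show ?thesis
      by (rule has_field_derivative_transform_within_open[where S = "{0<..}"]) (use 1 in auto)
  next
    case 2
    have "((\<lambda>t. 0) has_real_derivative real (Suc (Suc n)) * max 0 t ^ Suc n) (at t)"
      by (rule DERIV_cong[OF DERIV_const]) (use 2 in auto)
    then show ?thesis
      by (rule has_field_derivative_transform_within_open[where S = "{..<0}"]) (use 2 in auto)
  next
    case 3
    have bound: "norm (max 0 h ^ Suc (Suc n) / h) \<le> \<bar>h\<bar> ^ Suc n" for h :: real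
    proof (cases "h > 0")
      case False
      then have "max 0 h = 0" by simp
      moreover have "0 \<le> \<bar>h\<bar> ^ Suc n" by (intro zero_le_power) simp
      ultimately show ?thesis by (simp del: power_Suc add: power_0_Suc)
    qed (simp add: max_def)
    have "((\<lambda>h::real. max 0 h ^ Suc (Suc n) / h) \<longlongrightarrow> 0) (at 0)"
    proof (rule Lim_null_comparison)
      show "\<forall>\<^sub>F h::real in at 0. norm (max 0 h ^ Suc (Suc n) / h) \<le> \<bar>h\<bar> ^ Suc n"
        by (rule always_eventually) (rule allI, rule bound)
      have "((\<lambda>h::real. \<bar>h\<bar> ^ Suc n) \<longlongrightarrow> \<bar>0\<bar> ^ Suc n) (at 0)" by (intro tendsto_intros)
      then show "((\<lambda>h::real. \<bar>h\<bar> ^ Suc n) \<longlongrightarrow> 0) (at 0)" by simp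
    qed
    then show ?thesis using 3 by (simp add: DERIV_def)
  qed
qed

text \<open>The step is the integrated quadratic B-spline with knots 0, 1, 2, 3, rescaled.\<close>

lemma step_function:
  assumes "c < (d::real)"
  obtains s s' s'' where "\<And>y. (s has_real_derivative s' y) (at y)" "\<And>y. (s' has_real_derivative s'' y) (at y)"
    "continuous_on UNIV s'" "continuous_on UNIV s''"
    "\<And>y. y \<le> c \<Longrightarrow> s y = 0" "\<And>y. y \<ge> d \<Longrightarrow> s y = 1" "\<And>y. s' y \<ge> 0"
    "\<And>y. c < y \<Longrightarrow> y < d \<Longrightarrow> s' y > 0" "\<And>y. y \<le> c \<or> d \<le> y \<Longrightarrow> s' y = 0"
proof -
  \<comment> \<open>The third difference of truncated powers. For cubes it is the constant 3! = 6
    beyond the last knot, hence the division by 6 below.\<close>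
  define B where "B n t = max 0 t ^ n - 3 * max 0 (t - 1) ^ n + 3 * max 0 (t - 2) ^ n - max 0 (t - 3) ^ n" for n and t :: real
  have dB: "(B (Suc (Suc n)) has_real_derivative real (Suc (Suc n)) * B (Suc n) t) (at t)" for n t
  proof -
    have sh: "((\<lambda>t. max 0 (t - j) ^ Suc (Suc n)) has_real_derivative real (Suc (Suc n)) * max 0 (t - j) ^ Suc n) (at t)" for j
      using DERIV_chain2[OF has_real_derivative_max_power[of n "t - j"] DERIV_diff[OF DERIV_ident DERIV_const, of j]] by simp
    show ?thesis
      unfolding B_def[abs_def]
      by (rule DERIV_cong[OF DERIV_diff[OF DERIV_add[OF DERIV_diff[OF has_real_derivative_max_power DERIV_cmult[OF sh[of 1]]] DERIV_cmult[OF sh[of 2]]] sh[of 3]]])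
        (simp add: algebra_simps)
  qed
  have B0: "B (Suc n) t = 0" if "t \<le> 0" for n t using that by (simp add: B_def)
  have B3: "B 3 t = 6" "B 2 t = 0" if "t \<ge> 3" for t
    using that by (simp_all add: B_def power2_eq_square power3_eq_cube algebra_simps)
  have Bpos: "B 2 t > 0" if "0 < t" "t < 3" for t
  proof -
    consider "t \<le> 1" | "1 < t" "t \<le> 2" | "2 < t" by linarith
    then show ?thesis
    proof cases
      case 1
      then show ?thesis using that by (simp add: B_def)
    next
      case 2
      have "B 2 t = (t - 1) * (2 - t) * 2 + 1"
        using 2 by (simp add: B_def power2_eq_square algebra_simps)
      moreover have "(t - 1) * (2 - t) \<ge> 0" using 2 by (intro mult_nonneg_nonneg) auto
      ultimately show ?thesis by linarith
    next
      case 3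
      have "B 2 t = (3 - t)\<^sup>2"
        using 3 that by (simp add: B_def power2_eq_square algebra_simps)
      then show ?thesis using that by simp
    qed
  qed
  define k where "k = 3 / (d - c)"
  have k: "k > 0" using assms by (simp add: k_def)
  have k3: "k * (y - c) \<ge> 3 \<longleftrightarrow> y \<ge> d" for y
    using assms by (simp add: k_def pos_le_divide_eq)
  have k0: "k * (y - c) \<le> 0 \<longleftrightarrow> y \<le> c" for y
    using k by (simp add: mult_le_0_iff)
  have lin: "((\<lambda>y. k * (y - c)) has_real_derivative k) (at y)" for y
    by (auto intro!: derivative_eq_intros)
  have d1: "((\<lambda>y. B 3 (k * (y - c)) / 6) has_real_derivative k * B 2 (k * (y - c)) / 2) (at y)" for y
    using DERIV_cdivide[OF DERIV_chain2[OF dB[of 1] lin], of 6 y]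
    by (simp add: numeral_3_eq_3 numeral_2_eq_2 field_simps)
  have d2: "((\<lambda>y. k * B 2 (k * (y - c)) / 2) has_real_derivative k * k * B 1 (k * (y - c))) (at y)" for y
    using DERIV_cdivide[OF DERIV_cmult[OF DERIV_chain2[OF dB[of 0] lin], of k], of 2 y]
    by (simp add: numeral_2_eq_2 field_simps)
  show ?thesis
  proof (rule that[OF d1 d2])
    show "continuous_on UNIV (\<lambda>y. k * B 2 (k * (y - c)) / 2)"
      using d2 by (meson DERIV_isCont continuous_at_imp_continuous_on)
    show "continuous_on UNIV (\<lambda>y. k * k * B 1 (k * (y - c)))"
      unfolding B_def by (intro continuous_intros)
    show "B 3 (k * (y - c)) / 6 = 0" if "y \<le> c" for y
      using B0[of "k * (y - c)" 2] k0 that by (simp add: numeral_3_eq_3 numeral_2_eq_2)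
    show "B 3 (k * (y - c)) / 6 = 1" if "y \<ge> d" for y
      using B3(1) k3 that by simp
    show pos: "k * B 2 (k * (y - c)) / 2 > 0" if "c < y" "y < d" for y
    proof -
      have "\<not> k * (y - c) \<le> 0" "\<not> k * (y - c) \<ge> 3" using that k0 k3 by auto
      then show ?thesis using Bpos[of "k * (y - c)"] k by simp
    qed
    show zero: "k * B 2 (k * (y - c)) / 2 = 0" if "y \<le> c \<or> d \<le> y" for y
      using that B0[of "k * (y - c)" 1] k0[of y] k3[of y] B3(2)[of "k * (y - c)"] by (auto simp: numeral_2_eq_2)
    show "k * B 2 (k * (y - c)) / 2 \<ge> 0" for y
    proof (cases "y \<le> c \<or> d \<le> y")
      case True
      from zero[OF this] show ?thesis by linarith
    next
      case False
      then have "k * B 2 (k * (y - c)) / 2 > 0" by (intro pos) auto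
      then show ?thesis by linarith
    qed
  qed
qed

lemma rect_bump:
  assumes "0 < a" "0 < c" "c < d"
  obtains \<beta> where "test \<beta>" "\<And>z. \<beta> z \<ge> (0::real)" "\<And>z. \<bar>Re z\<bar> < a \<Longrightarrow> c < Im z \<Longrightarrow> Im z < d \<Longrightarrow> \<beta> z > 0"
proof -
  obtain s s' s'' where s: "\<And>y. (s' has_real_derivative s'' y) (at y)" "continuous_on UNIV s''"
    "\<And>y. s' y \<ge> 0" "\<And>y. c < y \<Longrightarrow> y < d \<Longrightarrow> s' y > 0" "\<And>y. y \<le> c \<or> d \<le> y \<Longrightarrow> s' y = 0"
    using step_function[OF assms(3)] by metis
  obtain r r' r'' where r: "\<And>y. (r' has_real_derivative r'' y) (at y)" "continuous_on UNIV r''"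
    "\<And>y. r' y \<ge> 0" "\<And>y. - a < y \<Longrightarrow> y < a \<Longrightarrow> r' y > 0" "\<And>y. y \<le> - a \<or> a \<le> y \<Longrightarrow> r' y = 0"
    using step_function[of "- a" a] assms(1) by (metis neg_less_pos)
  have C: "C1 (\<lambda>z. s' (Im z) * r' (Re z))"
    by (intro C1_mult C1_real_comp(1)[OF s(1,2)] C1_real_comp(1)[OF r(1,2)] C1_ReIm)
  have "supp_in (rect a c d) (\<lambda>z. s' (Im z) * r' (Re z))"
    unfolding supp_in_def rect_def using s(5) r(5) by (auto simp: abs_le_iff not_le)
  then have "test (\<lambda>z. s' (Im z) * r' (Re z))"
    using testI[OF C compact_rect rect_upper_half] assms(2) by blast
  then show ?thesis
    by (rule that) (use s r in \<open>auto simp: abs_less_iff\<close>)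
qed

text \<open>A bump positive on a slightly larger rectangle is divided by half its minimum on K, or
  by half of another positive lower bound. The value 2 makes the orbit sum on K strictly larger than
  1, an open condition.\<close>

lemma bump_ge:
  assumes "compact K" "K \<subseteq> upper_half"
  obtains \<beta> where "test \<beta>" "\<And>z. \<beta> z \<ge> (0::real)" "\<And>z. z \<in> K \<Longrightarrow> \<beta> z \<ge> 2"
proof -
  obtain a c d where r: "0 < a" "0 < c" "c < d" "K \<subseteq> rect a c d" using compact_in_rect[OF assms] .
  obtain \<beta> where \<beta>: "test \<beta>" "\<And>z. \<beta> z \<ge> (0::real)"
    "\<And>z. \<bar>Re z\<bar> < a + 1 \<Longrightarrow> c / 2 < Im z \<Longrightarrow> Im z < d + 1 \<Longrightarrow> \<beta> z > 0"
  proof (rule rect_bump[of "a + 1" "c / 2" "d + 1"])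
    show "0 < a + 1" "0 < c / 2" "c / 2 < d + 1" using r by auto
  qed blast
  have pos: "\<beta> z > 0" if "z \<in> K" for z
    using \<beta>(3)[of z] that r by (force simp: rect_def)
  have "\<exists>m>0. \<forall>z\<in>K. m \<le> \<beta> z"
  proof (cases "K = {}")
    case False
    then obtain w where "w \<in> K" "\<And>z. z \<in> K \<Longrightarrow> \<beta> w \<le> \<beta> z"
      using continuous_attains_inf[OF assms(1) False C1_continuous[OF test_C1[OF \<beta>(1)]]] by blast
    then show ?thesis using pos by blast
  qed (auto intro: exI[of _ 1])
  then obtain m where m: "m > 0" "\<And>z. z \<in> K \<Longrightarrow> m \<le> \<beta> z" by blast
  show ?thesis
  proof (rule that)
    show "test (\<lambda>z. (2 / m) *\<^sub>R \<beta> z)" by (rule test_scaleR[OF \<beta>(1)])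
  qed (use \<beta>(2) m in \<open>auto simp: field_simps\<close>)
qed

text \<open>Vertical integration solves the equation but leaves the full column integrals above the
  support. Cutting these off with s creates the error s'(y) F(x), which is integrated horizontally
  and cut off with r. The last error is a multiple T of a fixed bump, and the vanishing integral
  forces T = 0.\<close>

lemma zero_integral_exact:
  assumes f: "test f" and int: "plane_int f = 0"
  shows "\<exists>\<eta>. test \<eta> \<and> (\<forall>z. curl \<eta> z = f z)"
proof -
  obtain K where K: "compact K" "K \<subseteq> upper_half" "supp_in K f" using f by (auto simp: test_def)
  obtain a c d where r0: "0 < a" "0 < c" "c < d" "K \<subseteq> rect a c d" using compact_in_rect[OF K(1,2)] .
  define b where "b = d + 1"
  define q where "q = a + 1"
  have sf: "f z = 0" if "\<bar>Re z\<bar> > a \<or> Im z < c \<or> Im z > d" for z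
    using K(3) r0(4) that by (auto simp: supp_in_def rect_def)
  have Cf: "C1 f" using f by (rule test_C1)
  have cb: "c < b" "- q < q" using r0 by (auto simp: b_def q_def)
  obtain s s' s'' where s: "\<And>y. (s has_real_derivative s' y) (at y)" "\<And>y. (s' has_real_derivative s'' y) (at y)"
    "continuous_on UNIV s'" "continuous_on UNIV s''" "\<And>y. y \<le> c \<Longrightarrow> s y = 0" "\<And>y. y \<ge> b \<Longrightarrow> s y = 1"
    "\<And>y. s' y \<ge> 0" "\<And>y. c < y \<Longrightarrow> y < b \<Longrightarrow> s' y > 0" "\<And>y. y \<le> c \<or> b \<le> y \<Longrightarrow> s' y = 0"
    using step_function[OF cb(1)] by blast
  obtain r r' r'' where r: "\<And>y. (r has_real_derivative r' y) (at y)" "\<And>y. (r' has_real_derivative r'' y) (at y)"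
    "continuous_on UNIV r'" "continuous_on UNIV r''" "\<And>y. y \<le> - q \<Longrightarrow> r y = 0" "\<And>y. y \<ge> q \<Longrightarrow> r y = 1"
    "\<And>y. r' y \<ge> 0" "\<And>y. - q < y \<Longrightarrow> y < q \<Longrightarrow> r' y > 0" "\<And>y. y \<le> - q \<or> q \<le> y \<Longrightarrow> r' y = 0"
    using step_function[OF cb(2)] by blast
  note Cs = C1_real_comp[OF s(1,3) C1_ReIm(2)] and Cs' = C1_real_comp[OF s(2,4) C1_ReIm(2)]
    and Cr = C1_real_comp[OF r(1,3) C1_ReIm(1)] and Cr' = C1_real_comp[OF r(2,4) C1_ReIm(1)]
  obtain R where R: "rect a c d \<subseteq> cball 0 R" using rect_cball by blast
  have sR: "supp_in (cball 0 R) f" using supp_in_mono[OF supp_in_mono[OF K(3) r0(4)] R] .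
  define V where "V = ray \<i> f"
  note rV = ray_C1[OF Cf sR, of \<i>, folded V_def, simplified]
  have V0: "V z = 0" if "\<bar>Re z\<bar> > a \<or> Im z < c" for z
    unfolding V_def by (rule ray_zero) (use that in \<open>auto intro!: sf\<close>)
  \<comment> \<open>The height b lies above the support, so F is the integral of f over the whole
    vertical line through z and depends only on \<open>Re z\<close>.\<close>
  define F where "F z = V (Complex (Re z) b)" for z
  have dF: "(F has_derivative (\<lambda>v. fd V (Complex (Re z) b) 1 * Re v)) (at z)" for z
  proof -
    have "((\<lambda>z. of_real (Re z) + \<i> * of_real b) has_derivative (\<lambda>v. of_real (Re v))) (at z)"
      by (rule has_derivative_eq_rhs[OF has_derivative_add[OF bounded_linear.has_derivative[OF bounded_linear_of_real
         bounded_linear.has_derivative[OF bounded_linear_Re has_derivative_ident]] has_derivative_const]]) simp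
    then have "((\<lambda>z. Complex (Re z) b) has_derivative (\<lambda>v. of_real (Re v))) (at z)"
      by (simp add: Complex_eq)
    from has_derivative_compose[OF this C1_has_derivative[OF rV(1)]]
    have "(F has_derivative (\<lambda>v. fd V (Complex (Re z) b) (of_real (Re v)))) (at z)"
      by (simp add: F_def[abs_def])
    moreover have "fd V w (of_real x) = fd V w 1 * x" for w x
      using linear_scale[OF C1_linear[OF rV(1)], of w x 1] by (simp add: scaleR_conv_of_real)
    ultimately show ?thesis by simp
  qed
  have cF: "continuous_on UNIV (\<lambda>z. fd V (Complex (Re z) b) 1 * Re v)" for v
    by (intro continuous_intros continuous_on_compose2[OF C1_continuous_fd[OF rV(1), of UNIV]])
      (auto simp: Complex_eq intro!: continuous_intros)
  note CF = C1I[OF dF cF]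
  have F0: "F z = 0" if "\<bar>Re z\<bar> > a" for z using that V0 by (simp add: F_def)
  have FRe: "F z = F w" if "Re z = Re w" for z w using that by (simp add: F_def)
  have VF: "V z = F z" if "Im z \<ge> b" for z
  proof -
    have "V (Complex (Re z) b + of_real (Im z - b) * \<i>) = V (Complex (Re z) b)"
    proof (rule C1_const_along[OF rV(1)])
      fix t :: real assume "0 \<le> t"
      have "f (Complex (Re z) b + of_real t * \<i>) = 0"
        by (rule sf) (use \<open>0 \<le> t\<close> in \<open>simp add: b_def\<close>)
      then show "fd V (Complex (Re z) b + of_real t * \<i>) \<i> = 0" by (simp add: rV(3))
    qed (use that in simp)
    moreover have "Complex (Re z) b + of_real (Im z - b) * \<i> = z" by (simp add: complex_eq_iff)
    ultimately show ?thesis by (simp add: F_def)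
  qed
  define P where "P z = - (V z - s (Im z) * F z)" for z
  have CP: "C1 P" unfolding P_def[abs_def] by (intro C1_minus C1_diff rV(1) C1_mult Cs(1) CF(1))
  have fdP: "fd P z \<i> = - f z + s' (Im z) * F z" for z
    unfolding P_def[abs_def]
    by (simp add: fd_minus fd_diff fd_mult C1_diff C1_mult rV(1,3) Cs CF fd_ReIm)
  have P0: "P z = 0" if "z \<notin> rect q c b" for z
  proof -
    consider "\<bar>Re z\<bar> > q" | "Im z < c" | "Im z > b" using \<open>z \<notin> rect q c b\<close> by (auto simp: rect_def)
    then show ?thesis
    proof cases
      case 1
      then have "\<bar>Re z\<bar> > a" by (simp add: q_def)
      then show ?thesis by (simp add: P_def V0 F0)
    next
      case 2 then show ?thesis by (simp add: P_def V0 s(5))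
    next
      case 3 then show ?thesis by (simp add: P_def VF s(6))
    qed
  qed
  define f2 where "f2 z = s' (Im z) * F z" for z
  have Cf2: "C1 f2" unfolding f2_def[abs_def] by (intro C1_mult Cs'(1) CF(1))
  have f20: "f2 z = 0" if "\<bar>Re z\<bar> > a \<or> Im z \<le> c \<or> Im z \<ge> b" for z
    using that F0 s(9) by (auto simp: f2_def)
  obtain R2 where R2: "rect a c b \<subseteq> cball 0 R2" using rect_cball by blast
  have sR2: "supp_in (cball 0 R2) f2"
    unfolding supp_in_def
  proof (intro allI impI)
    fix z :: complex assume "z \<notin> cball 0 R2"
    then have "z \<notin> rect a c b" using R2 by blast
    then show "f2 z = 0" by (intro f20) (auto simp: rect_def)
  qed
  define H where "H = ray 1 f2"
  note rH = ray_C1[OF Cf2 sR2, of 1, folded H_def, simplified]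
  define T where "T = integral {0..} (\<lambda>t. F (Complex (q - t) 0))"
  have HT: "H z = s' (Im z) * T" if "Re z \<ge> q" for z
  proof -
    have "H (Complex q (Im z) + of_real (Re z - q) * 1) = H (Complex q (Im z))"
    proof (rule C1_const_along[OF rH(1)])
      fix t :: real assume "0 \<le> t"
      have "f2 (Complex q (Im z) + of_real t * 1) = 0"
        by (rule f20) (use \<open>0 \<le> t\<close> r0 in \<open>simp add: q_def\<close>)
      then show "fd H (Complex q (Im z) + of_real t * 1) 1 = 0" by (simp add: rH(3))
    qed (use that in simp)
    moreover have "Complex q (Im z) + of_real (Re z - q) * 1 = z" by (simp add: complex_eq_iff)
    moreover have "H (Complex q (Im z)) = s' (Im z) * T"
    proof -
      have "f2 (Complex q (Im z) - of_real t * 1) = s' (Im z) * F (Complex (q - t) 0)" for t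
        using FRe[of "Complex q (Im z) - of_real t * 1" "Complex (q - t) 0"] by (simp add: f2_def)
      then show ?thesis unfolding H_def ray_def T_def by simp
    qed
    ultimately show ?thesis by simp
  qed
  define Q where "Q z = H z - T * (s' (Im z) * r (Re z))" for z
  have CQ: "C1 Q" unfolding Q_def[abs_def] by (intro C1_diff rH(1) C1_mult C1_const Cs'(1) Cr(1))
  have fdQ: "fd Q z 1 = f2 z - T * (s' (Im z) * r' (Re z))" for z
    unfolding Q_def[abs_def]
    by (simp add: fd_diff fd_mult fd_const C1_mult rH(1,3) Cs' Cr fd_ReIm)
  have Q0: "Q z = 0" if "z \<notin> rect q c b" for z
  proof -
    consider "Re z < - q" | "Re z > q" | "Im z \<le> c \<or> Im z \<ge> b"
      using \<open>z \<notin> rect q c b\<close> by (auto simp: rect_def abs_le_iff not_le)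
    then show ?thesis
    proof cases
      case 1
      have "H z = 0" unfolding H_def by (rule ray_zero, rule f20) (use 1 r0 in \<open>simp add: q_def\<close>)
      then show ?thesis using 1 by (simp add: Q_def r(5))
    next
      case 2 then show ?thesis by (simp add: Q_def HT r(6))
    next
      case 3
      have "H z = 0" unfolding H_def by (rule ray_zero, rule f20) (use 3 in auto)
      then show ?thesis using 3 by (simp add: Q_def s(9))
    qed
  qed
  define \<eta> where "\<eta> z = of_real (P z) - \<i> * of_real (Q z)" for z
  have C\<eta>: "C1 \<eta>" unfolding \<eta>_def[abs_def] by (intro C1_diff C1_mult C1_const C1_of_real CP CQ)
  have "supp_in (rect q c b) \<eta>" using P0 Q0 by (simp add: supp_in_def \<eta>_def)
  then have t\<eta>: "test \<eta>" using testI[OF C\<eta> compact_rect rect_upper_half] r0(2) by blast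
  have "supp_in (rect q c b) P" "supp_in (rect q c b) Q" using P0 Q0 by (simp_all add: supp_in_def)
  then have tP: "test P" "test Q"
    by (auto intro: testI[OF CP compact_rect rect_upper_half[OF r0(2)]] testI[OF CQ compact_rect rect_upper_half[OF r0(2)]])
  define \<nu> where "\<nu> z = s' (Im z) * r' (Re z)" for z
  have C\<nu>: "C1 \<nu>" unfolding \<nu>_def[abs_def] by (intro C1_mult Cs'(1) Cr'(1))
  have "supp_in (rect q c b) \<nu>"
    unfolding supp_in_def \<nu>_def rect_def using s(9) r(9) by (auto simp: abs_le_iff not_le)
  then have t\<nu>: "test \<nu>" using testI[OF C\<nu> compact_rect rect_upper_half] r0(2) by blast
  have fdReIm: "fd \<eta> z v = of_real (fd P z v) - \<i> * of_real (fd Q z v)" for z v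
    unfolding \<eta>_def[abs_def] by (simp add: fd_diff fd_mult fd_const fd_of_real C1_mult C1_of_real CP CQ)
  have curl: "curl \<eta> z = fd Q z 1 - fd P z \<i>" for z
    by (simp add: curl_def fdReIm)
  have eq: "fd Q z 1 - fd P z \<i> = f z - T * \<nu> z" for z
    by (simp add: fdQ fdP f2_def \<nu>_def)
  \<comment> \<open>Stokes' theorem takes the place of Fubini here: both a curl and f have integral
    0, so T times the positive integral of \<nu> is 0.\<close>
  have "plane_int (\<lambda>z. fd Q z 1 - fd P z \<i>) = 0"
    by (subst plane_int_diff) (simp_all add: test_fd_cs tP plane_int_fd)
  then have "plane_int (\<lambda>z. f z - T * \<nu> z) = 0"
    by (simp only: eq)
  then have "T * plane_int \<nu> = 0"
    using int plane_int_diff[OF test_cs[OF f] cs_scale[OF test_cs[OF t\<nu>], of T]] by (simp add: plane_int_scale)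
  moreover have "plane_int \<nu> > 0"
    by (rule plane_int_pos[OF test_cs[OF t\<nu>], of "Complex 0 ((c + b) / 2)"])
      (use s(7,8) r(7,8) cb in \<open>auto simp: \<nu>_def\<close>)
  ultimately have "T = 0" by simp
  then show ?thesis using t\<eta> curl eq by auto
qed

subsection \<open>Partitions of unity for free actions\<close>

locale free_action =
  fixes G :: "(real^2^2) set"
  assumes fuchsian: "fuchsian_free_pd G"
begin

lemma G_SL2: "g \<in> G \<Longrightarrow> g \<in> SL2"
  and one_G [simp]: "mat 1 \<in> G"
  and mult_G [simp]: "g \<in> G \<Longrightarrow> h \<in> G \<Longrightarrow> g ** h \<in> G"
  using fuchsian by (auto simp: fuchsian_free_pd_def)

lemma inv_G [simp]:
  assumes "g \<in> G"
  shows "SL2_inv g \<in> G"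
proof -
  obtain h where h: "h \<in> G" "g ** h = mat 1" using fuchsian assms by (auto simp: fuchsian_free_pd_def)
  have "SL2_inv g = SL2_inv g ** (g ** h)" by (simp add: h)
  also have "\<dots> = h" using SL2_inv(3)[OF G_SL2[OF assms]] by (simp add: matrix_mul_assoc)
  finally show ?thesis using h by simp
qed

lemma inv_mult [simp]:
  assumes "g \<in> G"
  shows "g ** SL2_inv g = mat 1" "SL2_inv g ** g = mat 1"
    "h ** g ** SL2_inv g = h" "h ** SL2_inv g ** g = h"
  using SL2_inv[OF G_SL2[OF assms]] by (simp_all flip: matrix_mul_assoc)

lemma inv_inv [simp]: "SL2_inv (SL2_inv g) = g"
  by (simp add: vec_eq_iff forall_2)

lemma inv_prod: "SL2_inv (g ** h) = SL2_inv h ** SL2_inv g"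
  by (simp add: vec_eq_iff forall_2 mat2_mult_nth algebra_simps)

lemma finite_return:
  assumes "compact K" "K \<subseteq> upper_half" "compact L" "L \<subseteq> upper_half"
  shows "finite {g \<in> G. \<exists>z\<in>K. moeb g z \<in> L}"
proof (rule finite_subset)
  show "{g \<in> G. \<exists>z\<in>K. moeb g z \<in> L} \<subseteq> {g \<in> G. moeb g ` (K \<union> L) \<inter> (K \<union> L) \<noteq> {}}"
    by blast
  have "compact (K \<union> L)" "K \<union> L \<subseteq> upper_half" using assms by (auto simp: compact_Un)
  then show "finite {g \<in> G. moeb g ` (K \<union> L) \<inter> (K \<union> L) \<noteq> {}}"
    using fuchsian unfolding fuchsian_free_pd_def by blast
qed

lemma test_finite:
  assumes f: "test f" and K: "compact K" "K \<subseteq> upper_half"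
  shows "finite {g \<in> G. \<exists>z\<in>K. f (moeb g z) \<noteq> 0}"
proof -
  obtain L where L: "compact L" "L \<subseteq> upper_half" "supp_in L f" using f by (auto simp: test_def)
  show ?thesis
    by (rule finite_subset[OF _ finite_return[OF K L(1,2)]]) (use L(3) in \<open>auto simp: supp_in_def\<close>)
qed

text \<open>Sums over the possibly infinite group, meant for finite support. An infinite support
  gives 0 by the convention for sums, so reindexing needs no finiteness assumption while linearity
  does.\<close>

definition gsum :: "(real^2^2 \<Rightarrow> 'a::comm_monoid_add) \<Rightarrow> 'a" where
  "gsum f = (\<Sum>g\<in>{g \<in> G. f g \<noteq> 0}. f g)"

lemma gsum_eq: "finite F \<Longrightarrow> F \<subseteq> G \<Longrightarrow> (\<And>g. g \<in> G \<Longrightarrow> g \<notin> F \<Longrightarrow> f g = 0) \<Longrightarrow> gsum f = sum f F"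
  unfolding gsum_def by (rule sum.mono_neutral_left) auto

lemma gsum_cong: "(\<And>g. g \<in> G \<Longrightarrow> f g = f' g) \<Longrightarrow> gsum f = gsum f'"
  unfolding gsum_def by (rule sum.cong) auto

lemma gsum_right: "h \<in> G \<Longrightarrow> gsum (\<lambda>g. f (g ** h)) = gsum f"
  unfolding gsum_def
  by (rule sum.reindex_bij_witness[where i = "\<lambda>g. g ** SL2_inv h" and j = "\<lambda>g. g ** h"]) auto

lemma gsum_left: "h \<in> G \<Longrightarrow> gsum (\<lambda>g. f (h ** g)) = gsum f"
  unfolding gsum_def
  by (rule sum.reindex_bij_witness[where i = "\<lambda>g. SL2_inv h ** g" and j = "\<lambda>g. h ** g"])
    (auto simp: matrix_mul_assoc)

lemma gsum_inv: "gsum (\<lambda>g. f (SL2_inv g)) = gsum f"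
  unfolding gsum_def
  by (rule sum.reindex_bij_witness[where i = SL2_inv and j = SL2_inv]) auto

lemma gsum_linear:
  assumes "linear T" "finite {g \<in> G. f g \<noteq> 0}"
  shows "gsum (\<lambda>g. T (f g)) = T (gsum f)"
proof -
  have "gsum (\<lambda>g. T (f g)) = (\<Sum>g\<in>{g \<in> G. f g \<noteq> 0}. T (f g))"
    by (rule gsum_eq) (use assms in \<open>auto simp: linear_0\<close>)
  then show ?thesis
    by (simp add: gsum_def linear_sum[OF assms(1)])
qed

definition orbit_sum :: "(complex \<Rightarrow> real) \<Rightarrow> complex \<Rightarrow> real" where
  "orbit_sum f z = gsum (\<lambda>g. f (moeb g z))"

lemma orbit_sum_eq:
  assumes "test f" "compact K" "K \<subseteq> upper_half"
  obtains F where "finite F" "F \<subseteq> G" "\<And>g z. g \<in> G \<Longrightarrow> g \<notin> F \<Longrightarrow> z \<in> K \<Longrightarrow> f (moeb g z) = 0"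
    "\<And>z. z \<in> K \<Longrightarrow> orbit_sum f z = (\<Sum>g\<in>F. f (moeb g z))"
proof -
  let ?F = "{g \<in> G. \<exists>z\<in>K. f (moeb g z) \<noteq> 0}"
  have f: "finite ?F" by (rule test_finite[OF assms])
  moreover have "orbit_sum f z = (\<Sum>g\<in>?F. f (moeb g z))" if "z \<in> K" for z
    unfolding orbit_sum_def by (rule gsum_eq[OF f]) (use that in auto)
  ultimately show ?thesis by (intro that[of ?F]) auto
qed

lemma orbit_sum_invariant: "h \<in> G \<Longrightarrow> z \<in> upper_half \<Longrightarrow> orbit_sum f (moeb h z) = orbit_sum f z"
  unfolding orbit_sum_def
  by (subst gsum_right[symmetric, of h]) (auto intro!: gsum_cong simp: moeb_mult G_SL2)

lemma continuous_on_orbit_sum: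
  assumes "test f"
  shows "continuous_on upper_half (orbit_sum f)"
proof -
  have "continuous (at z) (orbit_sum f)" if z: "z \<in> upper_half" for z
  proof -
    obtain r where r: "r > 0" "cball z r \<subseteq> upper_half"
      using open_contains_cball open_upper_half z by blast
    obtain F where F: "finite F" "F \<subseteq> G" "\<And>w. w \<in> cball z r \<Longrightarrow> orbit_sum f w = (\<Sum>g\<in>F. f (moeb g w))"
      using orbit_sum_eq[OF assms compact_cball r(2)] by metis
    have "continuous_on (cball z r) (\<lambda>w. \<Sum>g\<in>F. f (moeb g w))"
      using F(2) by (intro continuous_on_sum C1_continuous test_C1 test_moeb(1) assms G_SL2) auto
    then have "continuous_on (cball z r) (orbit_sum f)"
      using F(3) by (metis (no_types, lifting) continuous_on_cong)
    then show ?thesis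
      by (rule continuous_on_interior) (use r in auto)
  qed
  then show ?thesis by (simp add: continuous_at_imp_continuous_on)
qed

text \<open>The denominator \<open>s + max 0 (1 - s)\<^sup>2\<close> is positive for every \<open>s\<close> and equals \<open>s\<close> for \<open>s \<ge> 1\<close>.\<close>

lemma partition_of_unity:
  assumes "compact K" "K \<subseteq> upper_half"
  obtains \<kappa> U where "test \<kappa>" "open U" "U \<subseteq> upper_half" "K \<subseteq> U"
    "\<And>g z. g \<in> G \<Longrightarrow> z \<in> upper_half \<Longrightarrow> moeb g z \<in> U \<longleftrightarrow> z \<in> U"
    "\<And>z. z \<in> U \<Longrightarrow> orbit_sum \<kappa> z = 1"
proof -
  obtain \<beta> where \<beta>: "test \<beta>" "\<And>z. \<beta> z \<ge> (0::real)" "\<And>z. z \<in> K \<Longrightarrow> \<beta> z \<ge> 2"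
    using bump_ge[OF assms] by blast
  obtain L where L: "compact L" "L \<subseteq> upper_half" "supp_in L \<beta>" using \<beta>(1) by (auto simp: test_def)
  define den where "den s = s + (max 0 (1 - s))\<^sup>2" for s :: real
  have den_pos: "den s > 0" for s
  proof (cases "s \<ge> 1")
    case False
    have "den s = (s - 1/2)\<^sup>2 + 3/4" using False by (simp add: den_def power2_eq_square algebra_simps)
    then show ?thesis using zero_le_power2[of "s - 1/2"] by linarith
  qed (simp add: den_def)
  have d_den: "(den has_real_derivative 1 - 2 * max 0 (1 - s)) (at s)" for s
  proof -
    have "((\<lambda>s. (max 0 (1 - s)) ^ Suc (Suc 0)) has_real_derivative (real (Suc (Suc 0)) * max 0 (1 - s) ^ Suc 0) * (0 - 1)) (at s)"
      by (rule DERIV_chain2[OF has_real_derivative_max_power DERIV_diff[OF DERIV_const DERIV_ident]])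
    from DERIV_add[OF DERIV_ident this] show ?thesis
      unfolding den_def[abs_def] by (simp add: numeral_2_eq_2)
  qed
  define \<rho> where "\<rho> s = inverse (den s)" for s
  have d_\<rho>: "(\<rho> has_real_derivative - (inverse (den s) * (1 - 2 * max 0 (1 - s)) * inverse (den s))) (at s)" for s
    unfolding \<rho>_def[abs_def] using den_pos[of s] by (intro DERIV_inverse' d_den) simp
  have c_den: "continuous_on UNIV den" using d_den by (meson DERIV_isCont continuous_at_imp_continuous_on)
  have c_\<rho>: "continuous_on UNIV (\<lambda>s. - (inverse (den s) * (1 - 2 * max 0 (1 - s)) * inverse (den s)))"
    using less_imp_neq[OF den_pos, symmetric] by (intro continuous_intros c_den) auto
  define S where "S = orbit_sum \<beta>"
  define \<kappa> where "\<kappa> z = \<beta> z * \<rho> (S z)" for z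
  \<comment> \<open>On the support of \<beta> the orbit sum is one fixed finite sum, which makes
    \<kappa> a test function.\<close>
  obtain F where F: "finite F" "F \<subseteq> G" "\<And>z. z \<in> L \<Longrightarrow> S z = (\<Sum>g\<in>F. \<beta> (moeb g z))"
    unfolding S_def using orbit_sum_eq[OF \<beta>(1) L(1,2)] by metis
  have "\<kappa> = (\<lambda>z. \<beta> z * \<rho> (\<Sum>g\<in>F. \<beta> (moeb g z)))"
  proof
    fix z
    show "\<kappa> z = \<beta> z * \<rho> (\<Sum>g\<in>F. \<beta> (moeb g z))"
      using F(3)[of z] L(3) by (cases "z \<in> L") (auto simp: \<kappa>_def supp_in_def)
  qed
  moreover have "test (\<lambda>z. \<beta> z * \<rho> (\<Sum>g\<in>F. \<beta> (moeb g z)))"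
    by (rule test_mult1[OF \<beta>(1) C1_real_comp(1)[OF d_\<rho> c_\<rho> C1_sum]])
      (use F(2) in \<open>auto intro!: test_C1[OF test_moeb(1)[OF _ \<beta>(1)]] G_SL2\<close>)
  ultimately have test\<kappa>: "test \<kappa>" by simp
  \<comment> \<open>Where S > 1 the factor \<rho>(S) is 1 / S, so the orbit sum of \<kappa> is 1.
    The set is open and invariant, and it contains K because S is at least 2 there.\<close>
  define U where "U = {z \<in> upper_half. S z > 1}"
  have S_inv: "S (moeb g z) = S z" if "g \<in> G" "z \<in> upper_half" for g z
    unfolding S_def by (rule orbit_sum_invariant[OF that])
  have S_ge: "S z \<ge> \<beta> z" if z: "z \<in> upper_half" for z
  proof -
    obtain F where F: "finite F" "F \<subseteq> G" "\<And>g. g \<in> G \<Longrightarrow> g \<notin> F \<Longrightarrow> \<beta> (moeb g z) = 0"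
      "S z = (\<Sum>g\<in>F. \<beta> (moeb g z))"
      unfolding S_def using orbit_sum_eq[OF \<beta>(1), of "{z}"] z by (metis compact_sing empty_subsetI insert_subset singletonI)
    show ?thesis
    proof (cases "mat 1 \<in> F")
      case True
      then have "\<beta> (moeb (mat 1) z) \<le> S z"
        unfolding F(4) using F(1) \<beta>(2) by (intro member_le_sum) auto
      then show ?thesis by simp
    next
      case False
      then have "\<beta> z = 0" using F(3)[of "mat 1"] by simp
      then show ?thesis unfolding F(4) using \<beta>(2) by (simp add: sum_nonneg)
    qed
  qed
  show ?thesis
  proof (rule that[OF test\<kappa>])
    have "openin (top_of_set upper_half) (upper_half \<inter> S -` {1<..})"
      by (rule continuous_openin_preimage_gen[OF _ open_greaterThan])
        (simp add: S_def continuous_on_orbit_sum \<beta>(1))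
    then have "open (upper_half \<inter> S -` {1<..})" by (rule openin_open_trans) simp
    moreover have "upper_half \<inter> S -` {1<..} = U" by (auto simp: U_def)
    ultimately show "open U" by simp
    show "U \<subseteq> upper_half" by (auto simp: U_def)
    show "K \<subseteq> U"
    proof
      fix z assume z: "z \<in> K"
      then have "z \<in> upper_half" using assms(2) by blast
      then show "z \<in> U" using S_ge[of z] \<beta>(3)[OF z] by (simp add: U_def)
    qed
    show "moeb g z \<in> U \<longleftrightarrow> z \<in> U" if "g \<in> G" "z \<in> upper_half" for g z
      using that S_inv moeb_upper_half_iff[OF G_SL2] by (simp add: U_def)
    show "orbit_sum \<kappa> z = 1" if "z \<in> U" for z
    proof -
      have z: "z \<in> upper_half" "S z > 1" using that by (auto simp: U_def)
      have fin: "finite {g \<in> G. \<beta> (moeb g z) \<noteq> 0}" using test_finite[OF \<beta>(1), of "{z}"] z by simp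
      have "orbit_sum \<kappa> z = gsum (\<lambda>g. \<rho> (S z) * \<beta> (moeb g z))"
        unfolding orbit_sum_def \<kappa>_def using S_inv[OF _ z(1)] by (intro gsum_cong) simp
      also have "\<dots> = \<rho> (S z) * S z"
        unfolding S_def orbit_sum_def
        by (rule gsum_linear[OF _ fin]) (auto intro!: linearI simp: algebra_simps)
      also have "\<dots> = 1" using z(2) by (simp add: \<rho>_def den_def)
      finally show ?thesis .
    qed
  qed
qed

end

subsection \<open>Cocycles and equivariant forms\<close>

text \<open>In contrast to \<open>cs\<close> the support must lie in the half plane; only then is
  the integral invariant under pullback.\<close>

definition csH :: "(complex \<Rightarrow> real) \<Rightarrow> bool" where
  "csH f \<longleftrightarrow> continuous_on UNIV f \<and> (\<exists>K. compact K \<and> K \<subseteq> upper_half \<and> supp_in K f)"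

lemma csH_cs: "csH f \<Longrightarrow> cs f"
  unfolding csH_def using csI_compact by blast

lemma test_csH: "test f \<Longrightarrow> csH f"
  unfolding csH_def test_def using C1_continuous by blast

lemma csH_mult: "csH f \<Longrightarrow> continuous_on UNIV g \<Longrightarrow> csH (\<lambda>z. g z * f z)"
  unfolding csH_def supp_in_def by (auto intro!: continuous_on_mult)

lemma csH_add: "csH f \<Longrightarrow> csH g \<Longrightarrow> csH (\<lambda>z. f z + g z)"
proof -
  assume f: "csH f" and g: "csH g"
  then obtain K L where "compact K" "K \<subseteq> upper_half" "supp_in K f" "compact L" "L \<subseteq> upper_half" "supp_in L g"
    by (auto simp: csH_def)
  then have "compact (K \<union> L)" "K \<union> L \<subseteq> upper_half" "supp_in (K \<union> L) (\<lambda>z. f z + g z)"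
    by (auto simp: supp_in_def compact_Un)
  moreover have "continuous_on UNIV (\<lambda>z. f z + g z)"
    using f g by (auto simp: csH_def intro!: continuous_on_add)
  ultimately show ?thesis unfolding csH_def by blast
qed

lemma csH_0 [simp]: "csH (\<lambda>_. 0)"
  using test_csH[OF test_0] .

lemma csH_sum: "(\<And>i. i \<in> I \<Longrightarrow> csH (f i)) \<Longrightarrow> csH (\<lambda>z. \<Sum>i\<in>I. f i z)"
  by (induction I rule: infinite_finite_induct) (auto simp: csH_add)

lemma plane_int_pull2_csH:
  assumes "g \<in> SL2" "csH f"
  shows "plane_int (pull2 g f) = plane_int f"
  using assms csH_cs[OF assms(2)] plane_int_pull2 unfolding csH_def by blast

lemma test_outside: "test f \<Longrightarrow> z \<notin> upper_half \<Longrightarrow> f z = 0"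
  unfolding test_def supp_in_def by blast

lemma fd_zero_open:
  assumes "open S" "z \<in> S" "\<And>w. w \<in> S \<Longrightarrow> f w = c"
  shows "fd f z v = 0"
proof -
  have "(f has_derivative (\<lambda>_. 0)) (at z)"
    by (rule has_derivative_transform_within_open[OF has_derivative_const[of c] assms(1,2)]) (use assms(3) in simp)
  then show ?thesis by (simp add: fd_eq)
qed

lemma test_fd_outside:
  assumes "test f" "z \<notin> upper_half"
  shows "fd f z v = 0"
proof -
  obtain K where "compact K" "K \<subseteq> upper_half" "supp_in K f" using assms by (auto simp: test_def)
  then show ?thesis using fd_zero_supp[OF compact_imp_closed] assms(2) by blast
qed

lemma test_csH_wedge: "C1 f \<Longrightarrow> test \<eta> \<Longrightarrow> csH (wedge f \<eta>)"
proof -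
  assume f: "C1 f" and \<eta>: "test \<eta>"
  obtain K where K: "compact K" "K \<subseteq> upper_half" "supp_in K \<eta>" using \<eta> by (auto simp: test_def)
  have "supp_in K (wedge f \<eta>)" using K(3) by (simp add: supp_in_def wedge_def)
  moreover have "continuous_on UNIV (wedge f \<eta>)" using cs_wedge[OF f \<eta>] by (simp add: cs_def)
  ultimately show ?thesis using K unfolding csH_def by blast
qed

lemma wedge_pull:
  assumes g: "g \<in> SL2" and f: "test f" and z: "z \<in> upper_half"
  shows "wedge (\<lambda>z. f (moeb g z)) (pull1 g \<eta>) z = pull2 g (wedge f \<eta>) z"
proof -
  define w where "w = 1 / (jfac g z)\<^sup>2"
  define a where "a = fd f (moeb g z) 1"
  define b where "b = fd f (moeb g z) \<i>"
  have lin: "fd f (moeb g z) v = Re v * a + Im v * b" for v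
    unfolding a_def b_def using C1_fd_basis[OF test_C1[OF f], of "moeb g z" v] by simp
  have fd: "fd (\<lambda>z. f (moeb g z)) z v = fd f (moeb g z) (v * w)" for v
    using test_moeb(2)[OF g f z] by (simp add: w_def)
  have p: "pull1 g \<eta> z = \<eta> (moeb g z) * w" by (simp add: pull1_def w_def)
  have "wedge (\<lambda>z. f (moeb g z)) (pull1 g \<eta>) z = (- (a * Im (\<eta> (moeb g z))) - b * Re (\<eta> (moeb g z))) * ((Re w)\<^sup>2 + (Im w)\<^sup>2)"
    unfolding wedge_def fd p lin by (simp add: algebra_simps power2_eq_square)
  also have "(Re w)\<^sup>2 + (Im w)\<^sup>2 = 1 / (norm (jfac g z)) ^ 4"
    unfolding cmod_power2[symmetric] w_def by (simp add: norm_divide norm_power power_divide flip: power_mult)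
  finally show ?thesis by (simp add: pull2_def wedge_def a_def b_def)
qed

lemma bracket_pull:
  assumes g: "g \<in> SL2" and f: "test f" and h: "test h" and z: "z \<in> upper_half"
  shows "bracket (\<lambda>z. f (moeb g z)) (\<lambda>z. h (moeb g z)) z = pull2 g (bracket f h) z"
proof -
  define w where "w = 1 / (jfac g z)\<^sup>2"
  have lin: "fd k (moeb g z) v = Re v * fd k (moeb g z) 1 + Im v * fd k (moeb g z) \<i>" if "test k" for k v
    using C1_fd_basis[OF test_C1[OF that], of "moeb g z" v] by simp
  have fd: "fd (\<lambda>z. k (moeb g z)) z v = fd k (moeb g z) (v * w)" if "test k" for k v
    using test_moeb(2)[OF g that z] by (simp add: w_def)
  have "bracket (\<lambda>z. f (moeb g z)) (\<lambda>z. h (moeb g z)) z = bracket f h (moeb g z) * ((Re w)\<^sup>2 + (Im w)\<^sup>2)"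
    unfolding bracket_def fd[OF f] fd[OF h] lin[OF f, of "_ * w"] lin[OF h, of "_ * w"]
    by (simp add: algebra_simps power2_eq_square)
  also have "(Re w)\<^sup>2 + (Im w)\<^sup>2 = 1 / (norm (jfac g z)) ^ 4"
    unfolding cmod_power2[symmetric] w_def by (simp add: norm_divide norm_power power_divide flip: power_mult)
  finally show ?thesis by (simp add: pull2_def)
qed

lemma pull_mult:
  assumes "g \<in> SL2" "h \<in> SL2" "z \<in> upper_half"
  shows "pull1 (g ** h) \<eta> z = pull1 h (pull1 g \<eta>) z" "pull2 (g ** h) f z = pull2 h (pull2 g f) z"
  using assms by (simp_all add: pull1_def pull2_def moeb_mult jfac_mult norm_mult power_mult_distrib)

text \<open>A right module. If a compact set meets every orbit, H^2 is dual to the invariant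
  functionals, so these have to vanish; an open quotient has no second cohomology for any
  coefficients, so nothing is asked there.\<close>

locale coefficient_module = free_action +
  fixes act :: "real^2^2 \<Rightarrow> 'v::euclidean_space \<Rightarrow> 'v"
  assumes act_linear: "\<And>g. g \<in> G \<Longrightarrow> linear (act g)"
    and act_mult: "\<And>g h v. g \<in> G \<Longrightarrow> h \<in> G \<Longrightarrow> act (g ** h) v = act h (act g v)"
    and act_one [simp]: "\<And>v. act (mat 1) v = v"
    and no_invariants: "\<And>\<Lambda> K v. linear \<Lambda> \<Longrightarrow> (\<And>g v. g \<in> G \<Longrightarrow> \<Lambda> (act g v) = \<Lambda> v) \<Longrightarrow>
      compact K \<Longrightarrow> K \<subseteq> upper_half \<Longrightarrow> (\<And>z. z \<in> upper_half \<Longrightarrow> \<exists>g\<in>G. moeb g z \<in> K) \<Longrightarrow> \<Lambda> v = (0::real)"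

text \<open>A 2-cocycle \<open>c\<close>, a bump \<open>\<phi>\<close> of integral 1, primitives of \<open>\<phi> - \<gamma>\<^sup>*\<phi>\<close>, and a partition of unity \<open>\<kappa> \<circ> \<sigma>\<close>
  over the invariant open set \<open>U\<close>.\<close>

locale cocycle_data = coefficient_module G act
  for G :: "(real^2^2) set" and act :: "real^2^2 \<Rightarrow> 'v::euclidean_space \<Rightarrow> 'v" +
  fixes c :: "real^2^2 \<Rightarrow> real^2^2 \<Rightarrow> 'v" and bmp :: "complex \<Rightarrow> real" and prim :: "real^2^2 \<Rightarrow> complex \<Rightarrow> complex"
    and \<kappa> :: "complex \<Rightarrow> real" and U :: "complex set"
  assumes cocycle: "\<And>g h k. g \<in> G \<Longrightarrow> h \<in> G \<Longrightarrow> k \<in> G \<Longrightarrow> c (g ** h) k + act k (c g h) = c g (h ** k) + c h k"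
    and bmp: "test bmp" "plane_int bmp = 1"
    and prim: "\<And>g. g \<in> G \<Longrightarrow> test (prim g)"
      "\<And>g z. g \<in> G \<Longrightarrow> z \<in> upper_half \<Longrightarrow> curl (prim g) z = bmp z - pull2 g bmp z"
    and part: "test \<kappa>" "open U" "U \<subseteq> upper_half"
      "\<And>g z. g \<in> G \<Longrightarrow> z \<in> upper_half \<Longrightarrow> moeb g z \<in> U \<longleftrightarrow> z \<in> U"
      "\<And>z. z \<in> U \<Longrightarrow> orbit_sum \<kappa> z = 1"
begin

text \<open>A homogeneous cochain of 1-forms: a smoothed path between the translates of the bump by
  x and y. Pulling back by y makes it equivariant under simultaneous right translation.\<close>

definition form :: "real^2^2 \<Rightarrow> real^2^2 \<Rightarrow> complex \<Rightarrow> complex" where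
  "form x y = pull1 y (prim (x ** SL2_inv y))"

text \<open>The homogeneous form of the cocycle, with c(g, h) recovered at (g h, h, 1). Its cocycle
  identity is an alternating sum, so a further vertex can be inserted and averaged over the
  group.\<close>

definition hc :: "real^2^2 \<Rightarrow> real^2^2 \<Rightarrow> real^2^2 \<Rightarrow> 'v" where
  "hc x y w = act w (c (x ** SL2_inv y) (y ** SL2_inv w))"

definition pu :: "real^2^2 \<Rightarrow> complex \<Rightarrow> real" where
  "pu s z = \<kappa> (moeb s z)"

text \<open>The integral of \<open>pu t\<close> d(\<open>pu s\<close>) \<and>
  \<open>form x y\<close>.\<close>

definition W :: "real^2^2 \<Rightarrow> real^2^2 \<Rightarrow> real^2^2 \<Rightarrow> real^2^2 \<Rightarrow> real" where
  "W x y t s = plane_int (\<lambda>z. pu t z * wedge (pu s) (form x y) z)"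

text \<open>The cone construction with apex s, averaged with the weights of the translated bump.
  Since the weights depend on y, it is a primitive only up to a further correction.\<close>

definition b1 :: "real^2^2 \<Rightarrow> real^2^2 \<Rightarrow> 'v" where
  "b1 x y = gsum (\<lambda>s. plane_int (\<lambda>z. pull2 y bmp z * pu s z) *\<^sub>R hc x y s)"

text \<open>The further correction: by Stokes' theorem a change of the weights in \<open>b1\<close>
  is an integral of \<open>form x y\<close> against partition functions, and a second vertex t is
  averaged accordingly.\<close>

definition b2 :: "real^2^2 \<Rightarrow> real^2^2 \<Rightarrow> 'v" where
  "b2 x y = gsum (\<lambda>t. gsum (\<lambda>s. W x y t s *\<^sub>R hc x t s))"

lemma hc_equivariant:
  assumes "x \<in> G" "y \<in> G" "w \<in> G" "g \<in> G"
  shows "hc (x ** g) (y ** g) (w ** g) = act g (hc x y w)"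
  using assms by (simp add: hc_def inv_prod matrix_mul_assoc act_mult)

lemma hc_cocycle:
  assumes "x \<in> G" "y \<in> G" "w \<in> G" "v \<in> G"
  shows "hc y w v - hc x w v + hc x y v = hc x y w"
proof -
  let ?g = "x ** SL2_inv y" and ?h = "y ** SL2_inv w" and ?k = "w ** SL2_inv v"
  have G: "?g \<in> G" "?h \<in> G" "?k \<in> G" using assms by simp_all
  have p: "?g ** ?h = x ** SL2_inv w" "?h ** ?k = y ** SL2_inv v" using assms by (simp_all add: matrix_mul_assoc)
  have "act v (c (?g ** ?h) ?k + act ?k (c ?g ?h)) = act v (c ?g (?h ** ?k) + c ?h ?k)"
    using cocycle[OF G] by simp
  then have "act v (c (?g ** ?h) ?k) + act v (act ?k (c ?g ?h)) = act v (c ?g (?h ** ?k)) + act v (c ?h ?k)"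
    by (simp only: linear_add[OF act_linear[OF assms(4)]])
  moreover have "act v (act ?k (c ?g ?h)) = act w (c ?g ?h)"
    using assms by (simp flip: act_mult)
  ultimately have "hc x w v + hc x y w = hc x y v + hc y w v"
    unfolding hc_def p by simp
  then show ?thesis by (simp add: algebra_simps)
qed

lemma test_pu: "s \<in> G \<Longrightarrow> test (pu s)"
  unfolding pu_def[abs_def] by (rule test_moeb(1)[OF G_SL2 part(1)])

lemma C1_pu: "s \<in> G \<Longrightarrow> C1 (pu s)"
  by (rule test_C1[OF test_pu])

lemma continuous_pu: "s \<in> G \<Longrightarrow> continuous_on S (pu s)"
  by (rule C1_continuous[OF C1_pu])

lemma pu_mult:
  assumes "s \<in> G" "g \<in> G"
  shows "pu (s ** g) = (\<lambda>z. pu s (moeb g z))"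
proof
  fix z
  show "pu (s ** g) z = pu s (moeb g z)"
  proof (cases "z \<in> upper_half")
    case True
    then show ?thesis using assms by (simp add: pu_def moeb_mult G_SL2)
  next
    case False
    then show ?thesis
      using test_outside[OF test_pu] test_outside[OF part(1)] assms
      by (simp add: moeb_upper_half_iff G_SL2 pu_def)
  qed
qed

lemma test_form: "x \<in> G \<Longrightarrow> y \<in> G \<Longrightarrow> test (form x y)"
  unfolding form_def by (rule test_pull1) (simp_all add: G_SL2 prim)

lemma csH_pull2_bmp: "y \<in> G \<Longrightarrow> csH (pull2 y bmp)"
proof -
  assume y: "y \<in> G"
  obtain K where K: "compact K" "K \<subseteq> upper_half" "supp_in K bmp" using bmp(1) by (auto simp: test_def)
  have "cs (pull2 y bmp)" by (rule pull2_cs[OF G_SL2[OF y] test_cs[OF bmp(1)] K])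
  moreover have "supp_in (moeb_inv y ` K) (pull2 y bmp)"
    using supp_in_moeb[OF G_SL2[OF y] K(3,2)] by (simp add: supp_in_def pull2_def)
  ultimately show ?thesis
    unfolding csH_def cs_def using compact_moeb_inv[OF G_SL2[OF y] K(1,2)] by blast
qed

lemma pull2_outside: "g \<in> G \<Longrightarrow> z \<notin> upper_half \<Longrightarrow> csH f \<Longrightarrow> pull2 g f z = 0"
  unfolding csH_def pull2_def supp_in_def using moeb_upper_half_iff[OF G_SL2] by fastforce

text \<open>Pullback commutes with \<open>curl\<close>. The differences telescope, so the
  alternating sum of the forms on the sides of a triangle is closed.\<close>

lemma curl_form:
  assumes "x \<in> G" "y \<in> G"
  shows "curl (form x y) z = pull2 y bmp z - pull2 x bmp z"
proof (cases "z \<in> upper_half")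
  case True
  have G: "x ** SL2_inv y \<in> G" using assms by simp
  have m: "moeb y z \<in> upper_half" using True assms by (simp add: moeb_upper_half_iff G_SL2)
  have "curl (form x y) z = pull2 y (curl (prim (x ** SL2_inv y))) z"
    unfolding form_def by (rule curl_pull1[OF G_SL2[OF assms(2)] prim(1)[OF G] True])
  also have "\<dots> = pull2 y bmp z - pull2 y (pull2 (x ** SL2_inv y) bmp) z"
    unfolding pull2_def[of y] prim(2)[OF G m] by (simp add: diff_divide_distrib)
  also have "pull2 y (pull2 (x ** SL2_inv y) bmp) z = pull2 x bmp z"
    using pull_mult(2)[OF G_SL2[OF G] G_SL2[OF assms(2)] True, of bmp] assms by simp
  finally show ?thesis .
next
  case False
  then show ?thesis
    using assms pull2_outside[OF _ False test_csH[OF bmp(1)]] test_fd_outside[OF test_form[OF assms] False]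
    by (simp add: curl_def)
qed

lemma form_equivariant:
  assumes "x \<in> G" "y \<in> G" "g \<in> G"
  shows "form (x ** g) (y ** g) = pull1 g (form x y)"
proof
  fix z
  have e: "x ** g ** SL2_inv (y ** g) = x ** SL2_inv y" using assms by (simp add: inv_prod matrix_mul_assoc)
  show "form (x ** g) (y ** g) z = pull1 g (form x y) z"
  proof (cases "z \<in> upper_half")
    case True
    then show ?thesis unfolding form_def e using assms by (simp add: pull_mult(1) G_SL2)
  next
    case False
    then show ?thesis
      using assms test_outside[OF test_form] by (simp add: pull1_def[of g] moeb_upper_half_iff G_SL2)
  qed
qed

lemma finite_pu:
  assumes "compact K" "K \<subseteq> upper_half"
  obtains F where "finite F" "F \<subseteq> G" "\<And>s z. s \<in> G \<Longrightarrow> s \<notin> F \<Longrightarrow> z \<in> K \<Longrightarrow> pu s z = 0"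
  using test_finite[OF part(1) assms] unfolding pu_def by (intro that[of "{g \<in> G. \<exists>z\<in>K. \<kappa> (moeb g z) \<noteq> 0}"]) (auto simp: pu_def)

lemma b1_equivariant:
  assumes "x \<in> G" "y \<in> G" "g \<in> G"
  shows "b1 (x ** g) (y ** g) = act g (b1 x y)"
proof -
  have csH: "csH (\<lambda>z. pull2 y bmp z * pu s z)" if "s \<in> G" for s
    using csH_mult[OF csH_pull2_bmp[OF assms(2)] continuous_pu[OF that]] by (simp add: mult.commute)
  have "plane_int (\<lambda>z. pull2 (y ** g) bmp z * pu (s ** g) z) = plane_int (\<lambda>z. pull2 y bmp z * pu s z)"
    if s: "s \<in> G" for s
  proof -
    have "(\<lambda>z. pull2 (y ** g) bmp z * pu (s ** g) z) = pull2 g (\<lambda>z. pull2 y bmp z * pu s z)"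
    proof
      fix z
      show "pull2 (y ** g) bmp z * pu (s ** g) z = pull2 g (\<lambda>z. pull2 y bmp z * pu s z) z"
      proof (cases "z \<in> upper_half")
        case True
        then show ?thesis
          using assms s by (simp add: pull_mult(2) G_SL2 pu_mult pull2_def[of g])
      next
        case False
        then show ?thesis
          using pull2_outside[OF _ False csH[OF s]] test_outside[OF test_pu] assms s by simp
      qed
    qed
    then show ?thesis using plane_int_pull2_csH[OF G_SL2 csH] assms s by simp
  qed
  then have "b1 (x ** g) (y ** g) = gsum (\<lambda>s. act g (plane_int (\<lambda>z. pull2 y bmp z * pu s z) *\<^sub>R hc x y s))"
    unfolding b1_def using assms
    by (subst gsum_right[symmetric, OF assms(3)])
      (auto intro!: gsum_cong simp: hc_equivariant linear_scale[OF act_linear])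
  also have "\<dots> = act g (b1 x y)"
    unfolding b1_def
  proof (rule gsum_linear[OF act_linear[OF assms(3)]])
    obtain K where K: "compact K" "K \<subseteq> upper_half" "supp_in K (pull2 y bmp)"
      using csH_pull2_bmp[OF assms(2)] by (auto simp: csH_def)
    obtain F where F: "finite F" "F \<subseteq> G" "\<And>s z. s \<in> G \<Longrightarrow> s \<notin> F \<Longrightarrow> z \<in> K \<Longrightarrow> pu s z = 0" using finite_pu[OF K(1,2)] by blast
    have z: "plane_int (\<lambda>z. pull2 y bmp z * pu s z) = 0" if "s \<in> G" "s \<notin> F" for s
    proof -
      have "(\<lambda>z. pull2 y bmp z * pu s z) = (\<lambda>_. 0)"
        using F(3)[OF that] K(3) by (fastforce simp: supp_in_def)
      then show ?thesis by simp
    qed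
    show "finite {s \<in> G. plane_int (\<lambda>z. pull2 y bmp z * pu s z) *\<^sub>R hc x y s \<noteq> 0}"
      by (rule finite_subset[OF _ F(1)]) (use z in auto)
  qed
  finally show ?thesis .
qed

text \<open>The function is known to vanish only where \<eta> is nonzero; this set is open, so its
  derivative vanishes there as well.\<close>

lemma fd_pu_zero:
  assumes \<eta>: "continuous_on UNIV \<eta>" and z: "\<eta> z \<noteq> (0 :: 'b::real_normed_vector)"
    and "\<And>z. \<eta> z \<noteq> 0 \<Longrightarrow> pu s z = 0"
  shows "fd (pu s) z v = 0"
proof (rule fd_zero_open)
  have "open (\<eta> -` (- {0}))" by (rule open_vimage[OF _ \<eta>]) auto
  moreover have "\<eta> -` (- {0}) = {z. \<eta> z \<noteq> 0}" by auto
  ultimately show "open {z. \<eta> z \<noteq> 0}" by simp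
qed (use assms in auto)

lemma W_zero:
  assumes G: "x \<in> G" "y \<in> G" and "\<And>z. form x y z \<noteq> 0 \<Longrightarrow> pu t z = 0 \<or> pu s z = 0"
    and "(\<forall>z. form x y z \<noteq> 0 \<longrightarrow> pu t z = 0) \<or> (\<forall>z. form x y z \<noteq> 0 \<longrightarrow> pu s z = 0)"
  shows "W x y t s = 0"
proof -
  have c: "continuous_on UNIV (form x y)" using C1_continuous[OF test_C1[OF test_form[OF G]]] .
  have "pu t z * wedge (pu s) (form x y) z = 0" for z
  proof (cases "form x y z = 0")
    case True
    then show ?thesis by (simp add: wedge_def)
  next
    case False
    from assms(4) show ?thesis
    proof
      assume "\<forall>z. form x y z \<noteq> 0 \<longrightarrow> pu s z = 0"
      then have "fd (pu s) z v = 0" for v by (intro fd_pu_zero[OF c False]) auto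
      then show ?thesis by (simp add: wedge_def)
    qed (use False in auto)
  qed
  then have "(\<lambda>z. pu t z * wedge (pu s) (form x y) z) = (\<lambda>_. 0)" by (rule ext)
  then show ?thesis by (simp add: W_def)
qed

lemma W_equivariant:
  assumes "x \<in> G" "y \<in> G" "g \<in> G" "t \<in> G" "s \<in> G"
  shows "W (x ** g) (y ** g) (t ** g) (s ** g) = W x y t s"
proof -
  have csH: "csH (\<lambda>z. pu t z * wedge (pu s) (form x y) z)"
    by (rule csH_mult[OF test_csH_wedge[OF C1_pu test_form] continuous_pu]) (use assms in auto)
  have "(\<lambda>z. pu (t ** g) z * wedge (pu (s ** g)) (form (x ** g) (y ** g)) z) = pull2 g (\<lambda>z. pu t z * wedge (pu s) (form x y) z)"
  proof
    fix z
    show "pu (t ** g) z * wedge (pu (s ** g)) (form (x ** g) (y ** g)) z = pull2 g (\<lambda>z. pu t z * wedge (pu s) (form x y) z) z"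
    proof (cases "z \<in> upper_half")
      case True
      then show ?thesis
        using assms by (simp add: form_equivariant pu_mult wedge_pull G_SL2 test_pu) (simp add: pull2_def)
    next
      case False
      then show ?thesis
        using pull2_outside[OF assms(3) False csH] test_outside[OF test_pu False] assms by simp
    qed
  qed
  then show ?thesis
    unfolding W_def using plane_int_pull2_csH[OF G_SL2[OF assms(3)] csH] by simp
qed

lemma W_finite:
  assumes "x \<in> G" "y \<in> G"
  obtains F where "finite F" "F \<subseteq> G" "\<And>t s. t \<in> G \<Longrightarrow> s \<in> G \<Longrightarrow> t \<notin> F \<or> s \<notin> F \<Longrightarrow> W x y t s = 0"
proof -
  obtain K where K: "compact K" "K \<subseteq> upper_half" "supp_in K (form x y)" using test_form[OF assms] by (auto simp: test_def)
  obtain F where F: "finite F" "F \<subseteq> G" "\<And>s z. s \<in> G \<Longrightarrow> s \<notin> F \<Longrightarrow> z \<in> K \<Longrightarrow> pu s z = 0" using finite_pu[OF K(1,2)] by blast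
  have "form x y z \<noteq> 0 \<Longrightarrow> pu s z = 0" if "s \<in> G" "s \<notin> F" for s z
    using F(3)[OF that] K(3) by (auto simp: supp_in_def)
  then show ?thesis
    by (intro that[OF F(1,2)] W_zero[OF assms]) blast+
qed

lemma gsum2_eq:
  assumes "finite F" "F \<subseteq> G" "\<And>t s. t \<in> G \<Longrightarrow> s \<in> G \<Longrightarrow> t \<notin> F \<or> s \<notin> F \<Longrightarrow> f t s = 0"
  shows "gsum (\<lambda>t. gsum (f t)) = (\<Sum>t\<in>F. \<Sum>s\<in>F. f t s)"
proof -
  have "gsum (f t) = (\<Sum>s\<in>F. f t s)" if "t \<in> G" for t
    by (rule gsum_eq[OF assms(1,2)]) (use assms(3) that in auto)
  then have "gsum (\<lambda>t. gsum (f t)) = gsum (\<lambda>t. \<Sum>s\<in>F. f t s)" by (rule gsum_cong)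
  also have "\<dots> = (\<Sum>t\<in>F. \<Sum>s\<in>F. f t s)"
    by (rule gsum_eq[OF assms(1,2)]) (use assms(2,3) in \<open>auto intro!: sum.neutral\<close>)
  finally show ?thesis .
qed

lemma b2_equivariant:
  assumes "x \<in> G" "y \<in> G" "g \<in> G"
  shows "b2 (x ** g) (y ** g) = act g (b2 x y)"
proof -
  have lin: "linear (act g)" by (rule act_linear[OF assms(3)])
  have "b2 (x ** g) (y ** g) = gsum (\<lambda>t. gsum (\<lambda>s. W (x ** g) (y ** g) (t ** g) (s ** g) *\<^sub>R hc (x ** g) (t ** g) (s ** g)))"
    unfolding b2_def
    by (subst gsum_right[symmetric, OF assms(3)], rule gsum_cong, subst gsum_right[symmetric, OF assms(3)]) simp
  also have "\<dots> = gsum (\<lambda>t. gsum (\<lambda>s. act g (W x y t s *\<^sub>R hc x t s)))"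
    using assms by (auto intro!: gsum_cong simp: W_equivariant hc_equivariant linear_scale[OF lin])
  also have "\<dots> = act g (b2 x y)"
  proof -
    obtain F where F: "finite F" "F \<subseteq> G" "\<And>t s. t \<in> G \<Longrightarrow> s \<in> G \<Longrightarrow> t \<notin> F \<or> s \<notin> F \<Longrightarrow> W x y t s = 0"
      using W_finite[OF assms(1,2)] by blast
    have "b2 x y = (\<Sum>t\<in>F. \<Sum>s\<in>F. W x y t s *\<^sub>R hc x t s)"
      unfolding b2_def by (rule gsum2_eq[OF F(1,2)]) (use F(3) in auto)
    moreover have "gsum (\<lambda>t. gsum (\<lambda>s. act g (W x y t s *\<^sub>R hc x t s))) = (\<Sum>t\<in>F. \<Sum>s\<in>F. act g (W x y t s *\<^sub>R hc x t s))"
      by (rule gsum2_eq[OF F(1,2)]) (use F(3) in \<open>auto simp: linear_0[OF lin]\<close>)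
    ultimately show ?thesis by (simp add: linear_sum[OF lin])
  qed
  finally show ?thesis .
qed

lemma sum_pu:
  assumes "finite F" "F \<subseteq> G" "\<And>s. s \<in> G \<Longrightarrow> s \<notin> F \<Longrightarrow> pu s z = 0" "z \<in> U"
  shows "(\<Sum>s\<in>F. pu s z) = 1"
proof -
  have "orbit_sum \<kappa> z = (\<Sum>s\<in>F. \<kappa> (moeb s z))"
    unfolding orbit_sum_def by (rule gsum_eq) (use assms in \<open>auto simp: pu_def\<close>)
  then show ?thesis using part(5)[OF assms(4)] by (simp add: pu_def)
qed

text \<open>On the open set where \<open>\<eta> \<noteq> 0\<close> the finite sum of the partition functions is constant.\<close>

lemma sum_fd_pu:
  assumes F: "finite F" "F \<subseteq> G" and \<eta>: "continuous_on UNIV \<eta>" and z: "\<eta> z \<noteq> (0 :: 'b::real_normed_vector)"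
    and "\<And>s z. s \<in> G \<Longrightarrow> s \<notin> F \<Longrightarrow> \<eta> z \<noteq> 0 \<Longrightarrow> pu s z = 0" and U: "\<And>z. \<eta> z \<noteq> 0 \<Longrightarrow> z \<in> U"
  shows "(\<Sum>s\<in>F. fd (pu s) z v) = 0"
proof -
  have "fd (\<lambda>z. \<Sum>s\<in>F. pu s z) z v = 0"
  proof (rule fd_zero_open)
    have "open (\<eta> -` (- {0}))" by (rule open_vimage[OF _ \<eta>]) auto
    moreover have "\<eta> -` (- {0}) = {z. \<eta> z \<noteq> 0}" by auto
    ultimately show "open {z. \<eta> z \<noteq> 0}" by simp
    show "(\<Sum>s\<in>F. pu s w) = 1" if "w \<in> {z. \<eta> z \<noteq> 0}" for w
      by (rule sum_pu[OF F]) (use assms(5) U that in auto)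
  qed (use z in simp)
  then show ?thesis using F(2) by (subst (asm) fd_sum) (auto intro!: C1_pu)
qed

text \<open>A descent through the double complex of forms and partition functions: up to the
  coboundary of \<open>b1\<close> and \<open>b2\<close> the cocycle is a double sum of integrals
  against \<theta>. Only the bump at w and the form between y and w need to lie over U, since
  partition functions are summed only there.\<close>

lemma triple_identity:
  assumes G: "x \<in> G" "y \<in> G" "w \<in> G"
    and \<theta>: "test \<theta>" "\<And>z v. fd \<theta> z v = Re ((form y w z - form x w z + form x y z) * v)"
    and U: "\<And>z. pull2 w bmp z \<noteq> 0 \<Longrightarrow> z \<in> U" "\<And>z. form y w z \<noteq> 0 \<Longrightarrow> z \<in> U"
    and F: "finite F" "F \<subseteq> G"
    and FF: "\<And>s z. s \<in> G \<Longrightarrow> s \<notin> F \<Longrightarrow> pull2 w bmp z \<noteq> 0 \<or> pull2 y bmp z \<noteq> 0 \<or> form y w z \<noteq> 0 \<or> form x w z \<noteq> 0 \<or> form x y z \<noteq> 0 \<Longrightarrow> pu s z = 0"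
  shows "hc x y w = (b1 y w - b1 x w + b1 x y) + (b2 y w - b2 x w + b2 x y)
    + (\<Sum>t\<in>F. \<Sum>s\<in>F. plane_int (\<lambda>z. \<theta> z * bracket (pu s) (pu t) z) *\<^sub>R hc x t s)"
proof -
  have Fg: "s \<in> G" if "s \<in> F" for s using F(2) that by blast
  define P where "P a s = plane_int (\<lambda>z. pull2 a bmp z * pu s z)" for a s
  have csP: "cs (\<lambda>z. pull2 a bmp z * pu s z)" if "a \<in> G" "s \<in> G" for a s
    by (rule cs_mult1[OF csH_cs[OF csH_pull2_bmp]]) (use that continuous_pu in auto)
  have tf: "test (form y w)" "test (form x w)" "test (form x y)" using G by (auto intro: test_form)
  have csW: "cs (\<lambda>z. pu t z * wedge (pu s) (form a b) z)" if "t \<in> G" "s \<in> G" "a \<in> G" "b \<in> G" for t s a b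
    by (rule cs_mult2[OF cs_wedge[OF C1_pu test_form]]) (use that continuous_pu in auto)
  have c: "continuous_on UNIV (form y w)" using C1_continuous[OF test_C1[OF tf(1)]] .
  have b1: "b1 a b = (\<Sum>s\<in>F. P b s *\<^sub>R hc a b s)" if "(a, b) \<in> {(y, w), (x, w), (x, y)}" for a b
    unfolding b1_def P_def
  proof (rule gsum_eq[OF F])
    fix s assume s: "s \<in> G" "s \<notin> F"
    have "(\<lambda>z. pull2 b bmp z * pu s z) = (\<lambda>_. 0)"
      using FF[OF s] that by (auto simp: fun_eq_iff)
    then show "plane_int (\<lambda>z. pull2 b bmp z * pu s z) *\<^sub>R hc a b s = 0" by simp
  qed
  have b2: "b2 a b = (\<Sum>t\<in>F. \<Sum>s\<in>F. W a b t s *\<^sub>R hc a t s)" if "(a, b) \<in> {(y, w), (x, w), (x, y)}" for a b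
    unfolding b2_def
  proof (rule gsum2_eq[OF F])
    fix t s assume ts: "t \<in> G" "s \<in> G" "t \<notin> F \<or> s \<notin> F"
    have ab: "a \<in> G" "b \<in> G" using that G by auto
    have FFab: "pu r z = 0" if "r \<in> G" "r \<notin> F" "form a b z \<noteq> 0" for r z
      using FF[OF that(1,2), of z] that(3) \<open>(a, b) \<in> _\<close> by auto
    have "W a b t s = 0"
      by (rule W_zero[OF ab]) (use FFab ts in blast)+
    then show "W a b t s *\<^sub>R hc a t s = 0" by simp
  qed
  have a: "(\<Sum>s\<in>F. P w s) = 1"
  proof -
    have "(\<Sum>s\<in>F. P w s) = plane_int (\<lambda>z. \<Sum>s\<in>F. pull2 w bmp z * pu s z)"
      unfolding P_def by (rule plane_int_sum[symmetric]) (use csP G Fg in auto)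
    also have "(\<lambda>z. \<Sum>s\<in>F. pull2 w bmp z * pu s z) = pull2 w bmp"
    proof
      fix z
      show "(\<Sum>s\<in>F. pull2 w bmp z * pu s z) = pull2 w bmp z"
      proof (cases "pull2 w bmp z = 0")
        case False
        then have "(\<Sum>s\<in>F. pu s z) = 1" using FF U(1) by (intro sum_pu[OF F]) auto
        then show ?thesis by (simp flip: sum_distrib_left)
      qed simp
    qed
    also have "plane_int (pull2 w bmp) = 1"
      using plane_int_pull2_csH[OF G_SL2[OF G(3)] test_csH[OF bmp(1)]] bmp(2) by simp
    finally show ?thesis .
  qed
  \<comment> \<open>The difference of the two bumps is the curl of \<open>form y w\<close>; Stokes'
    theorem moves the derivative to \<open>pu s\<close>, and 1 is then written as the sum of the
    \<open>pu t\<close>.\<close>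
  have b: "P w s - P y s = - (\<Sum>t\<in>F. W y w t s)" if s: "s \<in> F" for s
  proof -
    have sG: "s \<in> G" by (rule Fg[OF s])
    have "P w s - P y s = plane_int (\<lambda>z. pull2 w bmp z * pu s z - pull2 y bmp z * pu s z)"
      unfolding P_def by (rule plane_int_diff[symmetric]) (use csP G sG in auto)
    also have "\<dots> = plane_int (\<lambda>z. pu s z * curl (form y w) z)"
      by (simp add: curl_form G algebra_simps)
    also have "\<dots> = - plane_int (wedge (pu s) (form y w))"
      by (rule plane_int_curl[OF tf(1) test_pu[OF sG]])
    also have "wedge (pu s) (form y w) = (\<lambda>z. \<Sum>t\<in>F. pu t z * wedge (pu s) (form y w) z)"
    proof
      fix z
      show "wedge (pu s) (form y w) z = (\<Sum>t\<in>F. pu t z * wedge (pu s) (form y w) z)"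
      proof (cases "form y w z = 0")
        case True
        then show ?thesis by (simp add: wedge_def)
      next
        case False
        then have "(\<Sum>s\<in>F. pu s z) = 1" using FF U(2) by (intro sum_pu[OF F]) auto
        then show ?thesis by (simp flip: sum_distrib_right)
      qed
    qed
    also have "plane_int \<dots> = (\<Sum>t\<in>F. W y w t s)"
      unfolding W_def by (rule plane_int_sum) (use csW sG G Fg in auto)
    finally show ?thesis .
  qed
  have c0: "(\<Sum>s\<in>F. W y w t s) = 0" if t: "t \<in> F" for t
  proof -
    have "(\<Sum>s\<in>F. W y w t s) = plane_int (\<lambda>z. \<Sum>s\<in>F. pu t z * wedge (pu s) (form y w) z)"
      unfolding W_def by (rule plane_int_sum[symmetric]) (use csW t G Fg in auto)
    also have "(\<lambda>z. \<Sum>s\<in>F. pu t z * wedge (pu s) (form y w) z) = (\<lambda>_. 0)"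
    proof
      fix z
      show "(\<Sum>s\<in>F. pu t z * wedge (pu s) (form y w) z) = 0"
      proof (cases "form y w z = 0")
        case True
        then show ?thesis by (simp add: wedge_def)
      next
        case False
        have "(\<Sum>s\<in>F. fd (pu s) z v) = 0" for v
          by (rule sum_fd_pu[OF F c False]) (use FF U(2) in auto)
        then have "(\<Sum>s\<in>F. wedge (pu s) (form y w) z) = 0"
          by (simp add: wedge_def sum_subtractf sum_negf flip: sum_distrib_right)
        then show ?thesis by (simp flip: sum_distrib_left)
      qed
    qed
    finally show ?thesis by simp
  qed
  \<comment> \<open>The alternating sum of the three forms is d\<theta>, and
    \<open>plane_int_bracket3\<close> moves the derivative from \<theta> to
    \<open>pu t\<close>.\<close>
  have d: "W y w t s - W x w t s + W x y t s = - plane_int (\<lambda>z. \<theta> z * bracket (pu s) (pu t) z)"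
    if "t \<in> F" "s \<in> F" for t s
  proof -
    have tG: "t \<in> G" "s \<in> G" using Fg that by auto
    have "W y w t s - W x w t s + W x y t s = plane_int (\<lambda>z. pu t z * wedge (pu s) (form y w) z
        - pu t z * wedge (pu s) (form x w) z + pu t z * wedge (pu s) (form x y) z)"
      unfolding W_def
      using plane_int_add[OF cs_diff[OF csW[OF tG G(2,3)] csW[OF tG G(1,3)]] csW[OF tG G(1,2)]]
        plane_int_diff[OF csW[OF tG G(2,3)] csW[OF tG G(1,3)]] by simp
    also have "\<dots> = plane_int (\<lambda>z. pu t z * bracket (pu s) \<theta> z)"
      by (simp add: wedge_def bracket_def \<theta>(2) algebra_simps)
    also have "\<dots> = - plane_int (\<lambda>z. \<theta> z * bracket (pu s) (pu t) z)"
      by (rule plane_int_bracket3[OF test_pu[OF tG(1)] test_pu[OF tG(2)] \<theta>(1)])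
    finally show ?thesis .
  qed
  have "hc x y w = (\<Sum>s\<in>F. P w s *\<^sub>R hc x y w)"
    using a by (simp flip: scaleR_sum_left)
  also have "\<dots> = (\<Sum>s\<in>F. P w s *\<^sub>R hc y w s) - (\<Sum>s\<in>F. P w s *\<^sub>R hc x w s) + (\<Sum>s\<in>F. P w s *\<^sub>R hc x y s)"
    unfolding sum_subtractf[symmetric] sum.distrib[symmetric]
  proof (intro sum.cong refl)
    fix s assume s: "s \<in> F"
    have e: "hc x y w = hc y w s - hc x w s + hc x y s" using hc_cocycle[OF G Fg[OF s]] by simp
    show "P w s *\<^sub>R hc x y w = P w s *\<^sub>R hc y w s - P w s *\<^sub>R hc x w s + P w s *\<^sub>R hc x y s"
      unfolding e by (simp add: scaleR_add_right scaleR_diff_right)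
  qed
  \<comment> \<open>Among the three sums only this one has weights at the wrong vertex, w instead of
    y.\<close>
  also have "(\<Sum>s\<in>F. P w s *\<^sub>R hc x y s) = b1 x y + (\<Sum>s\<in>F. (P w s - P y s) *\<^sub>R hc x y s)"
    by (simp add: b1 scaleR_diff_left sum_subtractf)
  also have "(\<Sum>s\<in>F. (P w s - P y s) *\<^sub>R hc x y s) = - (\<Sum>t\<in>F. \<Sum>s\<in>F. W y w t s *\<^sub>R hc x y s)"
    by (subst sum.swap) (simp add: b scaleR_sum_left sum_negf)
  \<comment> \<open>The cocycle identity inserts the vertex t; the resulting term
    \<open>hc x y t\<close> does not involve s and is killed by \<open>c0\<close>.\<close>
  also have "(\<Sum>t\<in>F. \<Sum>s\<in>F. W y w t s *\<^sub>R hc x y s) =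
      (\<Sum>t\<in>F. \<Sum>s\<in>F. W y w t s *\<^sub>R hc x t s) - (\<Sum>t\<in>F. \<Sum>s\<in>F. W y w t s *\<^sub>R hc y t s)"
  proof -
    have "(\<Sum>s\<in>F. W y w t s *\<^sub>R hc x y s) = (\<Sum>s\<in>F. W y w t s *\<^sub>R hc x t s) - (\<Sum>s\<in>F. W y w t s *\<^sub>R hc y t s)"
      if t: "t \<in> F" for t
    proof -
      have "(\<Sum>s\<in>F. W y w t s *\<^sub>R hc x y t) = 0"
        using c0[OF t] by (simp flip: scaleR_sum_left)
      moreover have "hc x y s = hc x t s - hc y t s + hc x y t" if "s \<in> F" for s
        using hc_cocycle[OF G(1,2) Fg[OF t] Fg[OF that]] by (simp add: algebra_simps)
      ultimately show ?thesis
        by (simp add: scaleR_add_right scaleR_diff_right sum.distrib sum_subtractf)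
    qed
    then show ?thesis by (simp add: sum_subtractf)
  qed
  finally have 1: "hc x y w = b1 y w - b1 x w + (b1 x y + - ((\<Sum>t\<in>F. \<Sum>s\<in>F. W y w t s *\<^sub>R hc x t s) - b2 y w))"
    by (simp add: b1 b2)
  have "(\<Sum>t\<in>F. \<Sum>s\<in>F. plane_int (\<lambda>z. \<theta> z * bracket (pu s) (pu t) z) *\<^sub>R hc x t s) =
     - (\<Sum>t\<in>F. \<Sum>s\<in>F. (W y w t s - W x w t s + W x y t s) *\<^sub>R hc x t s)"
    by (simp add: d sum_negf)
  also have "\<dots> = - ((\<Sum>t\<in>F. \<Sum>s\<in>F. W y w t s *\<^sub>R hc x t s) - b2 x w + b2 x y)"
    by (simp add: b2 scaleR_add_left scaleR_diff_left sum.distrib sum_subtractf)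
  finally show ?thesis
    unfolding 1 by (simp add: algebra_simps)
qed

end

lemma inv_mat_1 [simp]: "SL2_inv (mat 1) = mat 1"
  by (simp add: vec_eq_iff forall_2 mat_def)

section \<open>The pairing of a 2-cocycle with a finite 2-cycle\<close>

context cocycle_data
begin

text \<open>The Cech-de Rham representative of the cocycle: a 2-form with values in the module, the
  sum of d(\<open>pu s\<close>) \<and> d(\<open>pu t\<close>) weighted by the homogeneous
  cocycle.\<close>

definition Fld :: "real^2^2 \<Rightarrow> complex \<Rightarrow> 'v" where
  "Fld x z = gsum (\<lambda>t. gsum (\<lambda>s. bracket (pu s) (pu t) z *\<^sub>R hc x t s))"

lemma finite_pu_near:
  assumes "z \<in> upper_half"
  obtains S F where "open S" "z \<in> S" "finite F" "F \<subseteq> G" "\<And>s w. s \<in> G \<Longrightarrow> s \<notin> F \<Longrightarrow> w \<in> S \<Longrightarrow> pu s w = 0"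
proof -
  obtain r where r: "r > 0" "cball z r \<subseteq> upper_half"
    using open_contains_cball open_upper_half assms by blast
  obtain F where F: "finite F" "F \<subseteq> G" "\<And>s w. s \<in> G \<Longrightarrow> s \<notin> F \<Longrightarrow> w \<in> cball z r \<Longrightarrow> pu s w = 0"
    using finite_pu[OF compact_cball r(2)] by blast
  show ?thesis
    by (rule that[of "ball z r", OF _ _ F(1,2)]) (use r(1) F(3) in auto)
qed

lemma Fld_eq:
  assumes "finite F" "F \<subseteq> G" "open S" "z \<in> S" "\<And>s w. s \<in> G \<Longrightarrow> s \<notin> F \<Longrightarrow> w \<in> S \<Longrightarrow> pu s w = 0"
  shows "Fld x z = (\<Sum>t\<in>F. \<Sum>s\<in>F. bracket (pu s) (pu t) z *\<^sub>R hc x t s)"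
  unfolding Fld_def
proof (rule gsum2_eq[OF assms(1,2)])
  fix t s assume "t \<in> G" "s \<in> G" "t \<notin> F \<or> s \<notin> F"
  then have "(\<forall>v. fd (pu t) z v = 0) \<or> (\<forall>v. fd (pu s) z v = 0)"
    using fd_zero_open[OF assms(3,4)] assms(5) by metis
  then have "bracket (pu s) (pu t) z = 0" by (auto simp: bracket_def)
  then show "bracket (pu s) (pu t) z *\<^sub>R hc x t s = 0" by simp
qed

text \<open>Replacing x changes each weight by a difference of two expressions, one depending only
  on t and the other only on s. Summing over the free index differentiates the constant 1.\<close>

lemma Fld_indep:
  assumes z: "z \<in> U" and x: "x \<in> G" "y \<in> G"
  shows "Fld x z = Fld y z"
proof -
  obtain S F where SF: "open S" "z \<in> S" "finite F" "F \<subseteq> G" "\<And>s w. s \<in> G \<Longrightarrow> s \<notin> F \<Longrightarrow> w \<in> S \<Longrightarrow> pu s w = 0"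
    using finite_pu_near[of z] z part(3) by (metis subsetD)
  have Fg: "s \<in> G" if "s \<in> F" for s using SF(4) that by blast
  have d: "(\<Sum>s\<in>F. fd (pu s) z v) = 0" for v
  proof -
    have "fd (\<lambda>z. \<Sum>s\<in>F. pu s z) z v = 0"
    proof (rule fd_zero_open)
      show "open (S \<inter> U)" "z \<in> S \<inter> U" using SF z part(2) by auto
      show "(\<Sum>s\<in>F. pu s w) = 1" if "w \<in> S \<inter> U" for w
        by (rule sum_pu[OF SF(3,4)]) (use SF(5) that in auto)
    qed
    then show ?thesis using fd_sum[of F pu z v] C1_pu Fg by simp
  qed
  have b1: "(\<Sum>s\<in>F. bracket (pu s) (pu t) z) = 0" for t
    using d[of 1] d[of \<i>] by (simp add: bracket_def sum_subtractf flip: sum_distrib_right)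
  have b2: "(\<Sum>t\<in>F. bracket (pu s) (pu t) z) = 0" for s
    using d[of 1] d[of \<i>] by (simp add: bracket_def sum_subtractf flip: sum_distrib_left)
  have "Fld a z = (\<Sum>t\<in>F. \<Sum>s\<in>F. bracket (pu s) (pu t) z *\<^sub>R hc a t s)" for a
    by (rule Fld_eq[OF SF(3,4,1,2)]) (rule SF(5))
  then have "Fld x z - Fld y z = (\<Sum>t\<in>F. \<Sum>s\<in>F. bracket (pu s) (pu t) z *\<^sub>R (hc x t s - hc y t s))"
    by (simp add: scaleR_diff_right sum_subtractf)
  also have "\<dots> = (\<Sum>t\<in>F. \<Sum>s\<in>F. bracket (pu s) (pu t) z *\<^sub>R hc y x t - bracket (pu s) (pu t) z *\<^sub>R hc y x s)"
  proof (intro sum.cong refl)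
    fix t s assume ts: "t \<in> F" "s \<in> F"
    have "hc x t s - hc y t s = hc y x t - hc y x s"
      using hc_cocycle[OF x(2,1) Fg[OF ts(1)] Fg[OF ts(2)]] by (simp add: algebra_simps)
    then show "bracket (pu s) (pu t) z *\<^sub>R (hc x t s - hc y t s) =
        bracket (pu s) (pu t) z *\<^sub>R hc y x t - bracket (pu s) (pu t) z *\<^sub>R hc y x s"
      by (simp add: scaleR_diff_right)
  qed
  also have "\<dots> = (\<Sum>t\<in>F. \<Sum>s\<in>F. bracket (pu s) (pu t) z *\<^sub>R hc y x t) - (\<Sum>t\<in>F. \<Sum>s\<in>F. bracket (pu s) (pu t) z *\<^sub>R hc y x s)"
    by (simp add: sum_subtractf)
  also have "(\<Sum>t\<in>F. \<Sum>s\<in>F. bracket (pu s) (pu t) z *\<^sub>R hc y x t) = 0"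
    by (simp add: b1 flip: scaleR_sum_left)
  also have "(\<Sum>t\<in>F. \<Sum>s\<in>F. bracket (pu s) (pu t) z *\<^sub>R hc y x s) = 0"
    by (subst sum.swap) (simp add: b2 flip: scaleR_sum_left)
  finally show ?thesis by simp
qed

lemma Fld_equivariant:
  assumes x: "x \<in> G" "g \<in> G" and z: "z \<in> upper_half"
  shows "Fld (x ** g) z = (1 / norm (jfac g z) ^ 4) *\<^sub>R act g (Fld x (moeb g z))"
proof -
  have lin: "linear (act g)" by (rule act_linear[OF x(2)])
  let ?k = "1 / norm (jfac g z) ^ 4"
  have m: "moeb g z \<in> upper_half" using x z by (simp add: moeb_upper_half_iff G_SL2)
  have "Fld (x ** g) z = gsum (\<lambda>t. gsum (\<lambda>s. bracket (pu (s ** g)) (pu (t ** g)) z *\<^sub>R hc (x ** g) (t ** g) (s ** g)))"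
    unfolding Fld_def
    by (subst gsum_right[symmetric, OF x(2)], rule gsum_cong, subst gsum_right[symmetric, OF x(2)]) simp
  also have "\<dots> = gsum (\<lambda>t. gsum (\<lambda>s. ?k *\<^sub>R act g (bracket (pu s) (pu t) (moeb g z) *\<^sub>R hc x t s)))"
  proof (intro gsum_cong)
    fix t s assume ts: "t \<in> G" "s \<in> G"
    have "bracket (pu (s ** g)) (pu (t ** g)) z = bracket (pu s) (pu t) (moeb g z) / norm (jfac g z) ^ 4"
      unfolding pu_mult[OF ts(1) x(2)] pu_mult[OF ts(2) x(2)]
      by (simp add: bracket_pull[OF G_SL2[OF x(2)] test_pu[OF ts(2)] test_pu[OF ts(1)] z] pull2_def)
    then show "bracket (pu (s ** g)) (pu (t ** g)) z *\<^sub>R hc (x ** g) (t ** g) (s ** g) =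
        ?k *\<^sub>R act g (bracket (pu s) (pu t) (moeb g z) *\<^sub>R hc x t s)"
      by (simp add: hc_equivariant x ts linear_scale[OF lin])
  qed
  also have "\<dots> = ?k *\<^sub>R act g (Fld x (moeb g z))"
  proof -
    obtain S F where SF: "open S" "moeb g z \<in> S" "finite F" "F \<subseteq> G" "\<And>s w. s \<in> G \<Longrightarrow> s \<notin> F \<Longrightarrow> w \<in> S \<Longrightarrow> pu s w = 0"
      using finite_pu_near[OF m] by blast
    have "gsum (\<lambda>t. gsum (\<lambda>s. ?k *\<^sub>R act g (bracket (pu s) (pu t) (moeb g z) *\<^sub>R hc x t s))) =
        (\<Sum>t\<in>F. \<Sum>s\<in>F. ?k *\<^sub>R act g (bracket (pu s) (pu t) (moeb g z) *\<^sub>R hc x t s))"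
    proof (rule gsum2_eq[OF SF(3,4)])
      fix t s assume "t \<in> G" "s \<in> G" "t \<notin> F \<or> s \<notin> F"
      then have "(\<forall>v. fd (pu t) (moeb g z) v = 0) \<or> (\<forall>v. fd (pu s) (moeb g z) v = 0)"
        using fd_zero_open[OF SF(1,2)] SF(5) by metis
      then have "bracket (pu s) (pu t) (moeb g z) = 0" by (auto simp: bracket_def)
      then show "?k *\<^sub>R act g (bracket (pu s) (pu t) (moeb g z) *\<^sub>R hc x t s) = 0"
        by (simp add: linear_0[OF lin])
    qed
    then show ?thesis
      by (simp add: Fld_eq[OF SF(3,4,1,2,5)] linear_sum[OF lin] scaleR_sum_right)
  qed
  finally show ?thesis .
qed

text \<open>A finite 2-cycle with coefficients in the dual module, each \<open>l i\<close> acting as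
  a functional by the inner product. That its boundary vanishes is expressed by pairing to 0 with
  all coboundaries, which is what duality supplies. The functions \<theta> play the role of smoothed
  triangles.\<close>

context
  fixes I :: "'i set" and gs ds :: "'i \<Rightarrow> real^2^2" and l :: "'i \<Rightarrow> 'v" and \<theta> :: "'i \<Rightarrow> complex \<Rightarrow> real"
  assumes I: "finite I" "\<And>i. i \<in> I \<Longrightarrow> gs i \<in> G" "\<And>i. i \<in> I \<Longrightarrow> ds i \<in> G"
    and cyc: "\<And>b. (\<Sum>i\<in>I. l i \<bullet> (act (ds i) (b (gs i)) - b (gs i ** ds i) + b (ds i))) = 0"
    and \<theta>: "\<And>i. i \<in> I \<Longrightarrow> test (\<theta> i)"
      "\<And>i z v. i \<in> I \<Longrightarrow> fd (\<theta> i) z v =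
        Re ((form (ds i) (mat 1) z - form (gs i ** ds i) (mat 1) z + form (gs i ** ds i) (ds i) z) * v)"
begin

text \<open>The multiplicity function of the cycle.  It is locally constant because the boundary of the
  cycle vanishes, and its value is an invariant functional.\<close>

definition Theta :: "'v \<Rightarrow> complex \<Rightarrow> real" where
  "Theta v z = (\<Sum>i\<in>I. gsum (\<lambda>g. \<theta> i (moeb g z) * (l i \<bullet> act (SL2_inv g) v)))"

lemma Theta_finite:
  assumes K: "compact K" "K \<subseteq> upper_half"
  obtains F where "finite F" "F \<subseteq> G" "\<And>i g z. i \<in> I \<Longrightarrow> g \<in> G \<Longrightarrow> g \<notin> F \<Longrightarrow> z \<in> K \<Longrightarrow> \<theta> i (moeb g z) = 0"
proof -
  let ?F = "\<Union>i\<in>I. {g \<in> G. \<exists>z\<in>K. \<theta> i (moeb g z) \<noteq> 0}"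
  have "finite ?F" using I(1) test_finite[OF \<theta>(1) K] by auto
  then show ?thesis by (rule that) auto
qed

lemma Theta_eq:
  assumes "finite F" "F \<subseteq> G" "\<And>i g. i \<in> I \<Longrightarrow> g \<in> G \<Longrightarrow> g \<notin> F \<Longrightarrow> \<theta> i (moeb g z) = 0"
  shows "Theta v z = (\<Sum>i\<in>I. \<Sum>g\<in>F. \<theta> i (moeb g z) * (l i \<bullet> act (SL2_inv g) v))"
  unfolding Theta_def
proof (intro sum.cong refl gsum_eq[OF assms(1,2)])
  fix i g assume "i \<in> I" "g \<in> G" "g \<notin> F"
  then show "\<theta> i (moeb g z) * (l i \<bullet> act (SL2_inv g) v) = 0" using assms(3) by simp
qed

text \<open>The derivative of the multiplicity function is itself a pairing of the cycle with a
  coboundary: the sides of the triangles, summed over the group, form a 1-cochain.\<close>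

lemma boundary_zero:
  assumes z: "z \<in> upper_half" and F: "finite F" "F \<subseteq> G"
    and FF: "\<And>i g. i \<in> I \<Longrightarrow> g \<in> G \<Longrightarrow> g \<notin> F \<Longrightarrow> form (ds i) (mat 1) (moeb g z) = 0 \<and>
        form (gs i ** ds i) (mat 1) (moeb g z) = 0 \<and> form (gs i ** ds i) (ds i) (moeb g z) = 0"
  shows "(\<Sum>i\<in>I. \<Sum>g\<in>F. fd (\<lambda>z. \<theta> i (moeb g z)) z e * (l i \<bullet> act (SL2_inv g) v)) = 0"
proof -
  \<comment> \<open>The value at \<gamma> evaluates all translates of the path from \<gamma> to 1 on
    the tangent vector e at z. Equivariance of the forms turns the coboundary of b into the three
    sides of the triangle.\<close>
  define b where "b \<gamma> = gsum (\<lambda>g. Re (form (\<gamma> ** g) g z * e) *\<^sub>R act (SL2_inv g) v)" for \<gamma>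
  define p where "p g \<eta> = Re (pull1 g \<eta> z * e)" for g \<eta>
  have p0: "p g \<eta> = 0" if "\<eta> (moeb g z) = 0" for g \<eta>
    using that by (simp add: p_def pull1_def)
  have form_p: "Re (form (x ** g) (y ** g) z * e) = p g (form x y)" if "x \<in> G" "y \<in> G" "g \<in> G" for x y g
    by (simp add: form_equivariant that p_def)
  have b_eq: "b \<gamma> = (\<Sum>g\<in>F. p g (form \<gamma> (mat 1)) *\<^sub>R act (SL2_inv g) v)"
    if \<gamma>: "\<gamma> \<in> G" and "\<And>g. g \<in> G \<Longrightarrow> g \<notin> F \<Longrightarrow> form \<gamma> (mat 1) (moeb g z) = 0" for \<gamma>
  proof -
    have "b \<gamma> = gsum (\<lambda>g. p g (form \<gamma> (mat 1)) *\<^sub>R act (SL2_inv g) v)"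
      unfolding b_def using form_p[OF \<gamma> one_G] by (intro gsum_cong) (simp add: matrix_mul_lid)
    also have "\<dots> = (\<Sum>g\<in>F. p g (form \<gamma> (mat 1)) *\<^sub>R act (SL2_inv g) v)"
      by (rule gsum_eq[OF F]) (use that(2) p0 in simp)
    finally show ?thesis .
  qed
  have act_b: "act \<delta> (b \<gamma>) = (\<Sum>g\<in>F. p g (form (\<gamma> ** \<delta>) \<delta>) *\<^sub>R act (SL2_inv g) v)"
    if \<gamma>: "\<gamma> \<in> G" and \<delta>: "\<delta> \<in> G" and zero: "\<And>g. g \<in> G \<Longrightarrow> g \<notin> F \<Longrightarrow> form (\<gamma> ** \<delta>) \<delta> (moeb g z) = 0" for \<gamma> \<delta>
  proof -
    have lin: "linear (act \<delta>)" by (rule act_linear[OF \<delta>])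
    have fin: "finite {g \<in> G. Re (form (\<gamma> ** g) g z * e) *\<^sub>R act (SL2_inv g) v \<noteq> 0}"
    proof (rule finite_subset)
      show "finite {g \<in> G. \<exists>w\<in>{z}. form \<gamma> (mat 1) (moeb g w) \<noteq> 0}"
        by (rule test_finite[OF test_form[OF \<gamma> one_G]]) (use z in auto)
      show "{g \<in> G. Re (form (\<gamma> ** g) g z * e) *\<^sub>R act (SL2_inv g) v \<noteq> 0} \<subseteq> {g \<in> G. \<exists>w\<in>{z}. form \<gamma> (mat 1) (moeb g w) \<noteq> 0}"
        using form_p[OF \<gamma> one_G] p0 by (auto simp: matrix_mul_lid simp del: times_complex.sel)
    qed
    have "act \<delta> (b \<gamma>) = gsum (\<lambda>g. act \<delta> (Re (form (\<gamma> ** g) g z * e) *\<^sub>R act (SL2_inv g) v))"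
      unfolding b_def by (rule gsum_linear[OF lin fin, symmetric])
    also have "\<dots> = gsum (\<lambda>g. act \<delta> (Re (form (\<gamma> ** (\<delta> ** g)) (\<delta> ** g) z * e) *\<^sub>R act (SL2_inv (\<delta> ** g)) v))"
      by (rule gsum_left[OF \<delta>, symmetric])
    also have "\<dots> = gsum (\<lambda>g. p g (form (\<gamma> ** \<delta>) \<delta>) *\<^sub>R act (SL2_inv g) v)"
    proof (rule gsum_cong)
      fix g assume g: "g \<in> G"
      have "act \<delta> (act (SL2_inv (\<delta> ** g)) v) = act (SL2_inv g) v"
        using g \<delta> by (simp add: inv_prod flip: act_mult)
      then show "act \<delta> (Re (form (\<gamma> ** (\<delta> ** g)) (\<delta> ** g) z * e) *\<^sub>R act (SL2_inv (\<delta> ** g)) v) =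
          p g (form (\<gamma> ** \<delta>) \<delta>) *\<^sub>R act (SL2_inv g) v"
        using form_p[OF mult_G[OF \<gamma> \<delta>] \<delta> g] by (simp add: linear_scale[OF lin] matrix_mul_assoc)
    qed
    also have "\<dots> = (\<Sum>g\<in>F. p g (form (\<gamma> ** \<delta>) \<delta>) *\<^sub>R act (SL2_inv g) v)"
      by (rule gsum_eq[OF F]) (use zero p0 in simp)
    finally show ?thesis .
  qed
  have "(\<Sum>g\<in>F. fd (\<lambda>z. \<theta> i (moeb g z)) z e * (l i \<bullet> act (SL2_inv g) v)) =
      l i \<bullet> (act (ds i) (b (gs i)) - b (gs i ** ds i) + b (ds i))" if i: "i \<in> I" for i
  proof -
    note G = I(2,3)[OF i]
    have fd: "fd (\<lambda>z. \<theta> i (moeb g z)) z e = p g (form (gs i ** ds i) (ds i)) - p g (form (gs i ** ds i) (mat 1)) + p g (form (ds i) (mat 1))"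
      if g: "g \<in> F" for g
    proof -
      have gG: "g \<in> G" using F(2) g by blast
      have "fd (\<lambda>z. \<theta> i (moeb g z)) z e = fd (\<theta> i) (moeb g z) (e / (jfac g z)\<^sup>2)"
        by (rule test_moeb(2)[OF G_SL2[OF gG] \<theta>(1)[OF i] z])
      then show ?thesis
        unfolding \<theta>(2)[OF i] p_def pull1_def by (simp add: algebra_simps diff_divide_distrib add_divide_distrib)
    qed
    show ?thesis
      using FF[OF i] G
      by (subst act_b[OF G], simp, subst (1 2) b_eq)
        (simp_all add: fd inner_sum_right inner_add_right inner_diff_right sum.distrib sum_subtractf algebra_simps)
  qed
  then show ?thesis using cyc[of b] by simp
qed

lemma Theta_const: "\<exists>k. \<forall>z\<in>upper_half. Theta v z = k"
proof (rule has_derivative_zero_constant[OF convex_upper_half])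
  fix z assume z: "z \<in> upper_half"
  obtain r where r: "r > 0" "cball z r \<subseteq> upper_half"
    using open_contains_cball open_upper_half z by blast
  obtain F1 where F1: "finite F1" "F1 \<subseteq> G" "\<And>i g w. i \<in> I \<Longrightarrow> g \<in> G \<Longrightarrow> g \<notin> F1 \<Longrightarrow> w \<in> cball z r \<Longrightarrow> \<theta> i (moeb g w) = 0"
    using Theta_finite[OF compact_cball r(2)] by blast
  define F2 where "F2 = (\<Union>i\<in>I. {g \<in> G. \<exists>w\<in>{z}. form (ds i) (mat 1) (moeb g w) \<noteq> 0} \<union>
      {g \<in> G. \<exists>w\<in>{z}. form (gs i ** ds i) (mat 1) (moeb g w) \<noteq> 0} \<union>
      {g \<in> G. \<exists>w\<in>{z}. form (gs i ** ds i) (ds i) (moeb g w) \<noteq> 0})"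
  have sub: "{z} \<subseteq> upper_half" using z by simp
  have "finite F2"
    unfolding F2_def using I
    by (intro finite_UN_I finite_UnI test_finite[OF test_form _ sub]) auto
  define F where "F = F1 \<union> F2"
  have F: "finite F" "F \<subseteq> G" using F1 \<open>finite F2\<close> by (auto simp: F_def F2_def)
  have FG: "g \<in> G" if "g \<in> F" for g using F that by blast
  let ?T = "\<lambda>w. \<Sum>i\<in>I. \<Sum>g\<in>F. \<theta> i (moeb g w) * (l i \<bullet> act (SL2_inv g) v)"
  have CT: "C1 (\<lambda>w. \<theta> i (moeb g w))" if "i \<in> I" "g \<in> F" for i g
    using test_moeb(1)[OF G_SL2[OF FG] \<theta>(1)] that test_C1 by blast
  have CT': "C1 (\<lambda>w. \<theta> i (moeb g w) * (l i \<bullet> act (SL2_inv g) v))" if "i \<in> I" "g \<in> F" for i g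
    using CT[OF that] by (intro C1_mult C1_const)
  have C: "C1 ?T" by (intro C1_sum CT')
  have "fd ?T z e = 0" for e
  proof -
    have "fd ?T z e = (\<Sum>i\<in>I. \<Sum>g\<in>F. fd (\<lambda>w. \<theta> i (moeb g w)) z e * (l i \<bullet> act (SL2_inv g) v))"
      by (simp add: fd_sum C1_sum CT' fd_mult CT fd_const)
    also have "\<dots> = 0"
      by (rule boundary_zero[OF z F]) (auto simp: F_def F2_def)
    finally show ?thesis .
  qed
  then have "(?T has_derivative (\<lambda>_. 0)) (at z)"
    using C1_has_derivative[OF C, of z] by (metis (no_types, lifting) ext)
  then have "(Theta v has_derivative (\<lambda>_. 0)) (at z)"
  proof (rule has_derivative_transform_within_open[where s = "ball z r"])
    fix w assume w: "w \<in> ball z r"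
    show "?T w = Theta v w"
      by (rule Theta_eq[OF F, symmetric]) (use F1(3) w in \<open>auto simp: F_def\<close>)
  qed (use r in auto)
  then show "(Theta v has_derivative (\<lambda>h. 0)) (at z within upper_half)"
    by (rule has_derivative_at_withinI)
qed

text \<open>A nonzero value, being constant, forces every orbit to meet the supports of the
  \<theta>. Cocompactness is thus derived from the assumption to be refuted, and then
  \<open>no_invariants\<close> applies.\<close>

lemma Theta_zero:
  assumes z: "z \<in> upper_half"
  shows "Theta v z = 0"
proof (rule ccontr)
  assume nz: "Theta v z \<noteq> 0"
  have const: "Theta v w = Theta v w'" if "w \<in> upper_half" "w' \<in> upper_half" for v w w'
    using Theta_const[of v] that by metis
  have "{z} \<subseteq> upper_half" using z by simp
  from Theta_finite[OF compact_sing this] obtain F where F0: "finite F" "F \<subseteq> G"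
    "\<And>i g w. i \<in> I \<Longrightarrow> g \<in> G \<Longrightarrow> g \<notin> F \<Longrightarrow> w \<in> {z} \<Longrightarrow> \<theta> i (moeb g w) = 0" by blast
  note F = F0(1,2) F0(3)[OF _ _ _ singletonI]
  have lin: "linear (act (SL2_inv g))" if "g \<in> F" for g
    using that F(2) by (intro act_linear inv_G) auto
  have Te: "Theta v z = (\<Sum>i\<in>I. \<Sum>g\<in>F. \<theta> i (moeb g z) * (l i \<bullet> act (SL2_inv g) v))" for v
    by (rule Theta_eq[OF F(1,2)]) (rule F(3))
  have "linear (\<lambda>v. Theta v z)"
    by (rule linearI) (simp_all add: Te linear_add[OF lin] linear_scale[OF lin] inner_add_right distrib_left
        sum.distrib sum_distrib_left mult.left_commute)
  \<comment> \<open>Reindexing the sum over the group moves h from the vector to the point, and the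
    value does not depend on the point.\<close>
  moreover have "Theta (act h v) z = Theta v z" if h: "h \<in> G" for h v
  proof -
    have "gsum (\<lambda>g. \<theta> i (moeb g z) * (l i \<bullet> act (SL2_inv g) (act h v))) =
        gsum (\<lambda>g. \<theta> i (moeb g (moeb h z)) * (l i \<bullet> act (SL2_inv g) v))" for i
    proof -
      have "gsum (\<lambda>g. \<theta> i (moeb g z) * (l i \<bullet> act (SL2_inv g) (act h v))) =
          gsum (\<lambda>g. \<theta> i (moeb (g ** h) z) * (l i \<bullet> act (SL2_inv (g ** h)) (act h v)))"
        by (rule gsum_right[OF h, symmetric])
      also have "\<dots> = gsum (\<lambda>g. \<theta> i (moeb g (moeb h z)) * (l i \<bullet> act (SL2_inv g) v))"
      proof (rule gsum_cong)
        fix g assume g: "g \<in> G"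
        have "act (SL2_inv (g ** h)) (act h v) = act (SL2_inv g) v"
          using g h by (simp add: inv_prod matrix_mul_assoc flip: act_mult)
        then show "\<theta> i (moeb (g ** h) z) * (l i \<bullet> act (SL2_inv (g ** h)) (act h v)) =
            \<theta> i (moeb g (moeb h z)) * (l i \<bullet> act (SL2_inv g) v)"
          using g h z by (simp add: moeb_mult G_SL2)
      qed
      finally show ?thesis .
    qed
    then have "Theta (act h v) z = Theta v (moeb h z)" by (simp add: Theta_def)
    also have "\<dots> = Theta v z" by (rule const) (use h z in \<open>simp_all add: moeb_upper_half_iff G_SL2\<close>)
    finally show ?thesis .
  qed
  moreover obtain K where K: "compact K" "K \<subseteq> upper_half" "\<And>i. i \<in> I \<Longrightarrow> supp_in K (\<theta> i)"
  proof -
    have "\<forall>i\<in>I. \<exists>K. compact K \<and> K \<subseteq> upper_half \<and> supp_in K (\<theta> i)" using \<theta>(1) by (auto simp: test_def)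
    then obtain K where "\<forall>i\<in>I. compact (K i) \<and> K i \<subseteq> upper_half \<and> supp_in (K i) (\<theta> i)" by metis
    then show ?thesis
      using I(1) by (intro that[of "\<Union>i\<in>I. K i"]) (auto simp: supp_in_def)
  qed
  moreover have "\<exists>g\<in>G. moeb g w \<in> K" if w: "w \<in> upper_half" for w
  proof (rule ccontr)
    assume "\<not> (\<exists>g\<in>G. moeb g w \<in> K)"
    then have "\<theta> i (moeb g w) = 0" if "i \<in> I" "g \<in> G" for i g
      using K(3)[OF that(1)] that(2) by (auto simp: supp_in_def)
    then have "Theta v w = 0" using Theta_eq[of "{}" w v] by simp
    then show False using const[OF w z, of v] nz by simp
  qed
  ultimately have "Theta v z = 0" using no_invariants[of "\<lambda>v. Theta v z" K v] by blast
  with nz show False by simp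
qed

lemma finite_pu_csH:
  assumes "csH f"
  shows "finite {s \<in> G. \<exists>z. f z \<noteq> 0 \<and> pu s z \<noteq> 0}"
proof -
  obtain K where K: "compact K" "K \<subseteq> upper_half" "supp_in K f" using assms by (auto simp: csH_def)
  obtain F where F: "finite F" "F \<subseteq> G" "\<And>s z. s \<in> G \<Longrightarrow> s \<notin> F \<Longrightarrow> z \<in> K \<Longrightarrow> pu s z = 0" using finite_pu[OF K(1,2)] by blast
  show ?thesis
    by (rule finite_subset[OF _ F(1)]) (use F(3) K(3) in \<open>force simp: supp_in_def\<close>)
qed

lemma finite_pu_test:
  assumes "test \<eta>"
  shows "finite {s \<in> G. \<exists>z. \<eta> z \<noteq> 0 \<and> pu s z \<noteq> 0}"
proof -
  obtain K where K: "compact K" "K \<subseteq> upper_half" "supp_in K \<eta>" using assms by (auto simp: test_def)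
  obtain F where F: "finite F" "F \<subseteq> G" "\<And>s z. s \<in> G \<Longrightarrow> s \<notin> F \<Longrightarrow> z \<in> K \<Longrightarrow> pu s z = 0" using finite_pu[OF K(1,2)] by blast
  show ?thesis
    by (rule finite_subset[OF _ F(1)]) (use F(3) K(3) in \<open>force simp: supp_in_def\<close>)
qed

lemma csH_pull2:
  assumes g: "g \<in> G" and f: "csH f"
  shows "csH (pull2 g f)"
proof -
  obtain K where K: "compact K" "K \<subseteq> upper_half" "supp_in K f" using f by (auto simp: csH_def)
  have "cs (pull2 g f)" by (rule pull2_cs[OF G_SL2[OF g] csH_cs[OF f] K])
  moreover have "supp_in (moeb_inv g ` K) (pull2 g f)"
    using supp_in_moeb[OF G_SL2[OF g] K(3,2)] by (simp add: supp_in_def pull2_def)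
  ultimately show ?thesis
    unfolding csH_def cs_def using compact_moeb_inv[OF G_SL2[OF g] K(1,2)] by blast
qed

text \<open>The coboundary parts of the triple identities cancel because of the cycle condition. The
  rest is an integral of the \<theta> against one equivariant 2-form; unfolding it along the
  partition of unity produces the factor \<open>Theta\<close>, which is 0.\<close>

lemma cycle_zero:
  assumes U: "\<And>z. bmp z \<noteq> 0 \<Longrightarrow> z \<in> U" "\<And>i z. i \<in> I \<Longrightarrow> form (ds i) (mat 1) z \<noteq> 0 \<Longrightarrow> z \<in> U"
    "\<And>i z. i \<in> I \<Longrightarrow> \<theta> i z \<noteq> 0 \<Longrightarrow> z \<in> U"
  shows "(\<Sum>i\<in>I. l i \<bullet> c (gs i) (ds i)) = 0"
proof -
  define near where "near f = {s \<in> G. \<exists>z. f z \<noteq> 0 \<and> pu s z \<noteq> 0}" for f :: "complex \<Rightarrow> real"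
  define near' where "near' f = {s \<in> G. \<exists>z. f z \<noteq> 0 \<and> pu s z \<noteq> 0}" for f :: "complex \<Rightarrow> complex"
  \<comment> \<open>One finite set of group elements outside which the partition functions miss all
    supports that occur.\<close>
  define F where "F = near (pull2 (mat 1) bmp) \<union> (\<Union>i\<in>I. near (pull2 (ds i) bmp) \<union> near (\<theta> i) \<union>
     near' (form (ds i) (mat 1)) \<union> near' (form (gs i ** ds i) (mat 1)) \<union> near' (form (gs i ** ds i) (ds i)))"
  have "finite F"
    unfolding F_def near_def near'_def using I
    by (intro finite_UnI finite_UN_I finite_pu_csH finite_pu_test test_form \<theta> csH_pull2_bmp) auto
  have FG: "F \<subseteq> G" by (auto simp: F_def near_def near'_def)
  have F0: "pu s z = 0" if "s \<in> G" "s \<notin> F" "pull2 (mat 1) bmp z \<noteq> 0" for s z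
    using that by (auto simp: F_def near_def)
  have F1: "pu s z = 0" if "i \<in> I" "s \<in> G" "s \<notin> F" "pull2 (ds i) bmp z \<noteq> 0 \<or> \<theta> i z \<noteq> 0 \<or> form (ds i) (mat 1) z \<noteq> 0
      \<or> form (gs i ** ds i) (mat 1) z \<noteq> 0 \<or> form (gs i ** ds i) (ds i) z \<noteq> 0" for i s z
    using that by (auto simp: F_def near_def near'_def)
  have Fg: "s \<in> G" if "s \<in> F" for s using FG that by blast
  define bb where "bb \<gamma> = b1 \<gamma> (mat 1) + b2 \<gamma> (mat 1)" for \<gamma>
  define E where "E i = (\<Sum>t\<in>F. \<Sum>s\<in>F. plane_int (\<lambda>z. \<theta> i z * bracket (pu s) (pu t) z) *\<^sub>R hc (gs i ** ds i) t s)" for i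
  \<comment> \<open>The triple identity at (g h, h, 1). Equivariance turns the cochain on the side
    from g h to h into the action of h on the one from g to 1.\<close>
  have one: "c (gs i) (ds i) = (act (ds i) (bb (gs i)) - bb (gs i ** ds i) + bb (ds i)) + E i" if i: "i \<in> I" for i
  proof -
    note G = I(2,3)[OF i]
    have G3: "gs i ** ds i \<in> G" "ds i \<in> G" "mat 1 \<in> G" using G by simp_all
    have "hc (gs i ** ds i) (ds i) (mat 1) = (b1 (ds i) (mat 1) - b1 (gs i ** ds i) (mat 1) + b1 (gs i ** ds i) (ds i))
        + (b2 (ds i) (mat 1) - b2 (gs i ** ds i) (mat 1) + b2 (gs i ** ds i) (ds i)) + E i"
      unfolding E_def
    proof (rule triple_identity[OF G3 \<theta>(1)[OF i] \<theta>(2)[OF i]])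
      show "z \<in> U" if "pull2 (mat 1) bmp z \<noteq> 0" for z using that U(1)[of z] by (simp add: pull2_def)
      show "z \<in> U" if "form (ds i) (mat 1) z \<noteq> 0" for z by (rule U(2)[OF i that])
      show "pu s z = 0" if "s \<in> G" "s \<notin> F" "pull2 (mat 1) bmp z \<noteq> 0 \<or> pull2 (ds i) bmp z \<noteq> 0 \<or> form (ds i) (mat 1) z \<noteq> 0 \<or>
          form (gs i ** ds i) (mat 1) z \<noteq> 0 \<or> form (gs i ** ds i) (ds i) z \<noteq> 0" for s z
        using F0[OF that(1,2)] F1[OF i that(1,2)] that(3) by blast
    qed (rule \<open>finite F\<close> FG)+
    moreover have "b1 (gs i ** ds i) (ds i) = act (ds i) (b1 (gs i) (mat 1))" "b2 (gs i ** ds i) (ds i) = act (ds i) (b2 (gs i) (mat 1))"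
      using b1_equivariant[OF G(1) one_G G(2)] b2_equivariant[OF G(1) one_G G(2)] by (simp_all add: matrix_mul_lid)
    moreover have "hc (gs i ** ds i) (ds i) (mat 1) = c (gs i) (ds i)"
      using G by (simp add: hc_def matrix_mul_rid)
    ultimately show ?thesis
      by (simp add: bb_def linear_add[OF act_linear[OF G(2)]] algebra_simps)
  qed
  define h where "h i z = \<theta> i z * (l i \<bullet> Fld (mat 1) z)" for i z
  have h_eq: "h i z = (\<Sum>t\<in>F. \<Sum>s\<in>F. (l i \<bullet> hc (gs i ** ds i) t s) * (\<theta> i z * bracket (pu s) (pu t) z))" if i: "i \<in> I" for i z
  proof (cases "\<theta> i z = 0")
    case False
    have z: "z \<in> U" by (rule U(3)[OF i False])
    have op: "open {z. \<theta> i z \<noteq> 0}"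
    proof -
      have "open (\<theta> i -` (- {0}))" by (rule open_vimage[OF _ C1_continuous[OF test_C1[OF \<theta>(1)[OF i]]]]) auto
      moreover have "\<theta> i -` (- {0}) = {z. \<theta> i z \<noteq> 0}" by auto
      ultimately show ?thesis by simp
    qed
    have "Fld (mat 1) z = Fld (gs i ** ds i) z" by (rule Fld_indep[OF z]) (use I i in auto)
    also have "\<dots> = (\<Sum>t\<in>F. \<Sum>s\<in>F. bracket (pu s) (pu t) z *\<^sub>R hc (gs i ** ds i) t s)"
      by (rule Fld_eq[OF \<open>finite F\<close> FG op]) (use False F1[OF i] in auto)
    finally show ?thesis
      by (simp add: h_def inner_sum_right sum_distrib_left mult_ac)
  qed (simp add: h_def)
  have csb: "csH (\<lambda>z. \<theta> i z * bracket (pu s) (pu t) z)" if "i \<in> I" "s \<in> F" "t \<in> F" for i s t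
  proof -
    have "continuous_on UNIV (bracket (pu s) (pu t))"
      using cs_bracket[OF test_pu C1_pu] Fg that by (simp add: cs_def)
    from csH_mult[OF test_csH[OF \<theta>(1)[OF that(1)]] this] show ?thesis by (simp add: mult.commute)
  qed
  have csh: "csH (h i)" if i: "i \<in> I" for i
    unfolding h_eq[OF i, abs_def] by (intro csH_sum csH_mult[OF csb[OF i]] continuous_on_const)
  have E_int: "l i \<bullet> E i = plane_int (h i)" if i: "i \<in> I" for i
  proof -
    have "plane_int (h i) = plane_int (\<lambda>z. \<Sum>t\<in>F. \<Sum>s\<in>F. (l i \<bullet> hc (gs i ** ds i) t s) * (\<theta> i z * bracket (pu s) (pu t) z))"
      by (simp add: h_eq[OF i, abs_def])
    also have "\<dots> = (\<Sum>t\<in>F. \<Sum>s\<in>F. (l i \<bullet> hc (gs i ** ds i) t s) * plane_int (\<lambda>z. \<theta> i z * bracket (pu s) (pu t) z))"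
      by (subst plane_int_sum, intro cs_sum cs_scale csH_cs[OF csb[OF i]], assumption+, intro sum.cong refl,
          subst plane_int_sum, intro cs_scale csH_cs[OF csb[OF i]], assumption+) (simp add: plane_int_scale)
    also have "\<dots> = l i \<bullet> E i"
      by (simp add: E_def inner_sum_right mult.commute)
    finally show ?thesis by simp
  qed
  define k where "k i g z = \<kappa> z * (\<theta> i (moeb (SL2_inv g) z) * (l i \<bullet> act g (Fld (mat 1) z)))" for i g z
  have csph: "csH (\<lambda>z. pu g z * h i z)" if "i \<in> I" "g \<in> F" for i g
    by (rule csH_mult[OF csh[OF that(1)] continuous_pu[OF Fg[OF that(2)]]])
  have k_eq: "k i g = pull2 (SL2_inv g) (\<lambda>z. pu g z * h i z)" if i: "i \<in> I" and g: "g \<in> F" for i g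
  proof
    fix z
    have gG: "g \<in> G" by (rule Fg[OF g])
    show "k i g z = pull2 (SL2_inv g) (\<lambda>z. pu g z * h i z) z"
    proof (cases "z \<in> upper_half")
      case False
      then show ?thesis
        using pull2_outside[OF inv_G[OF gG] False csph[OF i g]] test_outside[OF part(1) False] by (simp add: k_def)
    next
      case z: True
      define w where "w = moeb (SL2_inv g) z"
      have w: "w \<in> upper_half" using z gG by (simp add: w_def moeb_upper_half_iff G_SL2)
      have gw: "moeb g w = z" using z gG by (simp add: w_def G_SL2 flip: moeb_mult)
      show ?thesis
      proof (cases "\<theta> i w = 0")
        case True
        then show ?thesis by (simp add: k_def pull2_def h_def w_def)
      next
        case False
        have "w \<in> U" by (rule U(3)[OF i False])
        then have "Fld g w = Fld (mat 1) w" by (rule Fld_indep) (use gG in auto)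
        then have "Fld (mat 1) z = (1 / norm (jfac (SL2_inv g) z) ^ 4) *\<^sub>R act (SL2_inv g) (Fld (mat 1) w)"
          using Fld_equivariant[OF gG inv_G[OF gG] z] gG by (simp add: w_def)
        then have "act g (Fld (mat 1) z) = (1 / norm (jfac (SL2_inv g) z) ^ 4) *\<^sub>R Fld (mat 1) w"
          using gG by (simp add: linear_scale[OF act_linear] flip: act_mult)
        moreover have "pu g w = \<kappa> z" by (simp add: pu_def gw)
        ultimately show ?thesis by (simp add: k_def pull2_def h_def flip: w_def)
      qed
    qed
  qed
  have "plane_int (h i) = (\<Sum>g\<in>F. plane_int (k i g))" if i: "i \<in> I" for i
  proof -
    have "h i z = (\<Sum>g\<in>F. pu g z * h i z)" for z
    proof (cases "\<theta> i z = 0")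
      case False
      then have "(\<Sum>s\<in>F. pu s z) = 1" using F1[OF i] U(3)[OF i] by (intro sum_pu[OF \<open>finite F\<close> FG]) auto
      then show ?thesis by (simp flip: sum_distrib_right)
    qed (simp add: h_def)
    then have "plane_int (h i) = plane_int (\<lambda>z. \<Sum>g\<in>F. pu g z * h i z)" by (simp only: ext)
    also have "\<dots> = (\<Sum>g\<in>F. plane_int (\<lambda>z. pu g z * h i z))"
      by (rule plane_int_sum) (rule csH_cs[OF csph[OF i]])
    also have "\<dots> = (\<Sum>g\<in>F. plane_int (k i g))"
      using plane_int_pull2_csH[OF G_SL2[OF inv_G[OF Fg]] csph[OF i]] k_eq[OF i] by (intro sum.cong) simp_all
    finally show ?thesis .
  qed
  then have "(\<Sum>i\<in>I. l i \<bullet> E i) = (\<Sum>i\<in>I. \<Sum>g\<in>F. plane_int (k i g))"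
    by (simp add: E_int)
  also have "\<dots> = plane_int (\<lambda>z. \<Sum>i\<in>I. \<Sum>g\<in>F. k i g z)"
  proof -
    have csk: "cs (k i g)" if "i \<in> I" "g \<in> F" for i g
      unfolding k_eq[OF that] by (rule csH_cs[OF csH_pull2[OF inv_G[OF Fg[OF that(2)]] csph[OF that]]])
    have "plane_int (\<lambda>z. \<Sum>i\<in>I. \<Sum>g\<in>F. k i g z) = (\<Sum>i\<in>I. plane_int (\<lambda>z. \<Sum>g\<in>F. k i g z))"
      by (rule plane_int_sum) (intro cs_sum csk)
    also have "\<dots> = (\<Sum>i\<in>I. \<Sum>g\<in>F. plane_int (k i g))"
      by (intro sum.cong refl plane_int_sum csk)
    finally show ?thesis by simp
  qed
  \<comment> \<open>Where \<kappa> is nonzero the sum over F may be extended to the whole group;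
    inverting the summation variable turns it into \<open>Theta\<close> at the vector
    \<open>Fld (mat 1) z\<close>.\<close>
  also have "(\<lambda>z. \<Sum>i\<in>I. \<Sum>g\<in>F. k i g z) = (\<lambda>_. 0)"
  proof
    fix z
    show "(\<Sum>i\<in>I. \<Sum>g\<in>F. k i g z) = 0"
    proof (cases "\<kappa> z = 0")
      case False
      then have z: "z \<in> upper_half" using test_outside[OF part(1)] by blast
      let ?v = "Fld (mat 1) z"
      have "(\<Sum>g\<in>F. \<theta> i (moeb (SL2_inv g) z) * (l i \<bullet> act g ?v)) = gsum (\<lambda>g. \<theta> i (moeb g z) * (l i \<bullet> act (SL2_inv g) ?v))"
        if i: "i \<in> I" for i
      proof -
        have "gsum (\<lambda>g. \<theta> i (moeb (SL2_inv g) z) * (l i \<bullet> act (SL2_inv (SL2_inv g)) ?v)) =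
            (\<Sum>g\<in>F. \<theta> i (moeb (SL2_inv g) z) * (l i \<bullet> act (SL2_inv (SL2_inv g)) ?v))"
        proof (rule gsum_eq[OF \<open>finite F\<close> FG])
          fix g assume g: "g \<in> G" "g \<notin> F"
          have "moeb g (moeb (SL2_inv g) z) = z" using z g(1) by (simp add: G_SL2 flip: moeb_mult)
          then have "pu g (moeb (SL2_inv g) z) \<noteq> 0" using False by (simp add: pu_def)
          then have "\<theta> i (moeb (SL2_inv g) z) = 0" using F1[OF i g] by blast
          then show "\<theta> i (moeb (SL2_inv g) z) * (l i \<bullet> act (SL2_inv (SL2_inv g)) ?v) = 0" by simp
        qed
        moreover have "gsum (\<lambda>g. \<theta> i (moeb (SL2_inv g) z) * (l i \<bullet> act (SL2_inv (SL2_inv g)) ?v)) =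
            gsum (\<lambda>g. \<theta> i (moeb g z) * (l i \<bullet> act (SL2_inv g) ?v))"
          by (rule gsum_inv)
        ultimately show ?thesis by simp
      qed
      then have "(\<Sum>i\<in>I. \<Sum>g\<in>F. \<theta> i (moeb (SL2_inv g) z) * (l i \<bullet> act g ?v)) = Theta ?v z"
        by (simp add: Theta_def)
      also have "\<dots> = 0" by (rule Theta_zero[OF z])
      finally show ?thesis
        by (simp add: k_def flip: sum_distrib_left)
    qed (simp add: k_def)
  qed
  finally have "(\<Sum>i\<in>I. l i \<bullet> E i) = 0" by simp
  then show ?thesis
    using cyc[of bb] by (simp add: one inner_add_right sum.distrib)
qed

end

end

section \<open>Choice of the bump, primitives and partition of unity\<close>

lemma curl_combination:
  assumes "C1 a" "C1 b" "C1 c"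
  shows "curl (\<lambda>z. a z - b z + c z) z = curl a z - curl b z + curl c z"
  using assms by (simp add: curl_def fd_add fd_diff C1_diff)

text \<open>The pullback of a square as a 2-form is the squared modulus of a pulled back 1-form, so
  its smoothness is already known. This is why the bump is taken to be a square.\<close>

lemma test_pull2_square:
  assumes g: "g \<in> SL2" and \<beta>: "test \<beta>"
  shows "test (pull2 g (\<lambda>z. \<beta> z * \<beta> z))"
proof -
  let ?p = "pull1 g (\<lambda>z. of_real (\<beta> z))"
  have p: "test ?p"
    by (rule test_pull1[OF g test_bounded_linear[OF bounded_linear_of_real \<beta>]])
  have "test (\<lambda>z. Re (?p z * cnj (?p z)))"
    by (rule test_bounded_linear[OF bounded_linear_Re test_mult1[OF p test_C1[OF test_bounded_linear[OF bounded_linear_cnj p]]]])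
  moreover have "Re (?p z * cnj (?p z)) = pull2 g (\<lambda>z. \<beta> z * \<beta> z) z" for z
  proof -
    have "Re (?p z * cnj (?p z)) = (norm (?p z))\<^sup>2"
      unfolding complex_norm_square[symmetric] by simp
    also have "\<dots> = (\<beta> (moeb g z))\<^sup>2 / norm (jfac g z) ^ 4"
      by (simp add: pull1_def norm_divide norm_power power_divide flip: power_mult)
    finally show ?thesis by (simp add: pull2_def power2_eq_square)
  qed
  ultimately show ?thesis by simp
qed

lemma square_bump:
  obtains \<phi> where "test \<phi>" "plane_int \<phi> = 1" "\<And>g. g \<in> SL2 \<Longrightarrow> test (pull2 g \<phi>)"
proof -
  obtain \<beta> where \<beta>: "test \<beta>" "\<And>z. \<beta> z \<ge> (0::real)"
    "\<And>z. \<bar>Re z\<bar> < 1 \<Longrightarrow> 1 < Im z \<Longrightarrow> Im z < 3 \<Longrightarrow> \<beta> z > 0"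
    using rect_bump[of 1 1 3] by auto
  define q where "q z = \<beta> z * \<beta> z" for z
  have q: "test q" unfolding q_def[abs_def] by (rule test_mult1[OF \<beta>(1) test_C1[OF \<beta>(1)]])
  have "plane_int q > 0"
    by (rule plane_int_pos[OF test_cs[OF q], of "2 * \<i>"]) (simp_all add: q_def \<beta>)
  have pull: "pull2 g (\<lambda>z. (1 / plane_int q) *\<^sub>R q z) = (\<lambda>z. (1 / plane_int q) *\<^sub>R pull2 g q z)" for g
    by (simp add: pull2_def fun_eq_iff)
  show ?thesis
  proof (rule that)
    show "test (\<lambda>z. (1 / plane_int q) *\<^sub>R q z)" by (rule test_scaleR[OF q])
    show "plane_int (\<lambda>z. (1 / plane_int q) *\<^sub>R q z) = 1"
      using plane_int_scale[of "1 / plane_int q" q] \<open>plane_int q > 0\<close> by simp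
    show "test (pull2 g (\<lambda>z. (1 / plane_int q) *\<^sub>R q z))" if "g \<in> SL2" for g
      unfolding pull using test_pull2_square[OF that \<beta>(1)] by (intro test_scaleR) (simp add: q_def[abs_def])
  qed
qed

context coefficient_module
begin

lemma cycle_pairing:
  fixes I :: "'i set" and l :: "'i \<Rightarrow> 'v"
  assumes cocycle: "\<And>g h k. g \<in> G \<Longrightarrow> h \<in> G \<Longrightarrow> k \<in> G \<Longrightarrow> c (g ** h) k + act k (c g h) = c g (h ** k) + c h k"
    and I: "finite I" "\<And>i. i \<in> I \<Longrightarrow> gs i \<in> G" "\<And>i. i \<in> I \<Longrightarrow> ds i \<in> G"
    and cyc: "\<And>b. (\<Sum>i\<in>I. l i \<bullet> (act (ds i) (b (gs i)) - b (gs i ** ds i) + b (ds i))) = 0"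
  shows "(\<Sum>i\<in>I. l i \<bullet> c (gs i) (ds i)) = 0"
proof -
  obtain \<phi> where \<phi>: "test \<phi>" "plane_int \<phi> = 1" "\<And>g. g \<in> SL2 \<Longrightarrow> test (pull2 g \<phi>)"
    using square_bump by blast
  have "\<exists>\<eta>. test \<eta> \<and> (\<forall>z. curl \<eta> z = \<phi> z - pull2 g \<phi> z)" if g: "g \<in> G" for g
  proof (rule zero_integral_exact)
    show "test (\<lambda>z. \<phi> z - pull2 g \<phi> z)" by (rule test_diff[OF \<phi>(1) \<phi>(3)[OF G_SL2[OF g]]])
    show "plane_int (\<lambda>z. \<phi> z - pull2 g \<phi> z) = 0"
      using plane_int_diff[OF test_cs[OF \<phi>(1)] test_cs[OF \<phi>(3)[OF G_SL2[OF g]]]]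
        plane_int_pull2_csH[OF G_SL2[OF g] test_csH[OF \<phi>(1)]] by simp
  qed
  then obtain prim where prim: "\<And>g. g \<in> G \<Longrightarrow> test (prim g)" "\<And>g z. g \<in> G \<Longrightarrow> curl (prim g) z = \<phi> z - pull2 g \<phi> z"
    by metis
  \<comment> \<open>The forms have to be available before the compact set is known over which the
    partition of unity must work. They do not involve the partition, so the locale is entered first
    with \<kappa> = 0 and the empty set.\<close>
  interpret D0: cocycle_data G act c \<phi> prim "\<lambda>_. 0" "{}"
    by unfold_locales (use cocycle \<phi> prim in auto)
  let ?\<eta> = "\<lambda>i z. D0.form (ds i) (mat 1) z - D0.form (gs i ** ds i) (mat 1) z + D0.form (gs i ** ds i) (ds i) z"
  have tf: "test (D0.form (ds i) (mat 1))" "test (D0.form (gs i ** ds i) (mat 1))" "test (D0.form (gs i ** ds i) (ds i))"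
    if "i \<in> I" for i
    using I(2,3)[OF that] by (auto intro: D0.test_form)
  have "\<exists>\<theta>. test \<theta> \<and> (\<forall>z v. fd \<theta> z v = Re (?\<eta> i z * v))" if i: "i \<in> I" for i
  proof (rule closed_form_exact)
    show "test (?\<eta> i)" by (rule test_add[OF test_diff[OF tf(1,2)[OF i]] tf(3)[OF i]])
    show "curl (?\<eta> i) z = 0" for z
      using I(2,3)[OF i] by (simp add: curl_combination test_C1 tf[OF i] D0.curl_form)
  qed
  then obtain \<theta> where \<theta>: "\<And>i. i \<in> I \<Longrightarrow> test (\<theta> i)" "\<And>i z v. i \<in> I \<Longrightarrow> fd (\<theta> i) z v = Re (?\<eta> i z * v)"
    by metis
  obtain K0 where K0: "compact K0" "K0 \<subseteq> upper_half" "supp_in K0 \<phi>" using \<phi>(1) by (auto simp: test_def)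
  obtain K1 where K1: "\<And>i. i \<in> I \<Longrightarrow> compact (K1 i) \<and> K1 i \<subseteq> upper_half \<and> supp_in (K1 i) (D0.form (ds i) (mat 1))"
    using tf(1) unfolding test_def by metis
  obtain K2 where K2: "\<And>i. i \<in> I \<Longrightarrow> compact (K2 i) \<and> K2 i \<subseteq> upper_half \<and> supp_in (K2 i) (\<theta> i)"
    using \<theta>(1) unfolding test_def by metis
  define K where "K = K0 \<union> (\<Union>i\<in>I. K1 i \<union> K2 i)"
  have "compact K"
    unfolding K_def using K0 K1 K2 I(1) by (auto intro!: compact_Un compact_UN)
  moreover have "K \<subseteq> upper_half"
    unfolding K_def using K0(2) K1 K2 by blast
  ultimately obtain \<kappa> U where \<kappa>: "test \<kappa>" "open U" "U \<subseteq> upper_half" "K \<subseteq> U"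
    "\<And>g z. g \<in> G \<Longrightarrow> z \<in> upper_half \<Longrightarrow> moeb g z \<in> U \<longleftrightarrow> z \<in> U" "\<And>z. z \<in> U \<Longrightarrow> orbit_sum \<kappa> z = 1"
    using partition_of_unity by blast
  interpret D: cocycle_data G act c \<phi> prim \<kappa> U
    by unfold_locales (use cocycle \<phi> prim \<kappa> in auto)
  show ?thesis
  proof (rule D.cycle_zero[OF I cyc \<theta>])
    show "z \<in> U" if "\<phi> z \<noteq> 0" for z
      using that K0(3) \<kappa>(4) by (auto simp: supp_in_def K_def)
    show "z \<in> U" if "i \<in> I" "D0.form (ds i) (mat 1) z \<noteq> 0" for i z
      using that K1[OF that(1)] \<kappa>(4) unfolding supp_in_def K_def by blast
    show "z \<in> U" if "i \<in> I" "\<theta> i z \<noteq> 0" for i z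
      using that K2[OF that(1)] \<kappa>(4) unfolding supp_in_def K_def by blast
  qed
qed

end

subsection \<open>Linear duality\<close>

instantiation "fun" :: (type, real_vector) real_vector
begin

definition "r *\<^sub>R f = (\<lambda>x. r *\<^sub>R f x)"

instance
  by standard (auto simp: scaleR_fun_def fun_eq_iff scaleR_add_right scaleR_add_left)

end

text \<open>A (possibly infinite) system of linear equations for a functional is solvable as soon as every
  finite linear relation between the left-hand sides also holds for the right-hand sides.\<close>

lemma linear_system_solvable:
  fixes r :: "'e \<Rightarrow> 'x::real_vector" and k :: "'e \<Rightarrow> real"
  assumes consistent: "\<And>J \<mu>. finite J \<Longrightarrow> (\<Sum>e\<in>J. \<mu> e *\<^sub>R r e) = 0 \<Longrightarrow> (\<Sum>e\<in>J. \<mu> e * k e) = 0"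
  shows "\<exists>\<Phi>. linear \<Phi> \<and> (\<forall>e. \<Phi> (r e) = k e)"
proof -
  obtain B where B: "B \<subseteq> range r" "independent B" "range r \<subseteq> span B"
    by (rule maximal_independent_subset)
  define q where "q b = (SOME e. r e = b)" for b
  have q: "r (q b) = b" if "b \<in> B" for b
    unfolding q_def by (rule someI_ex) (use B(1) that in auto)
  obtain \<Phi> where \<Phi>: "linear \<Phi>" "\<And>b. b \<in> B \<Longrightarrow> \<Phi> b = k (q b)"
    using linear_independent_extend[OF B(2), of "\<lambda>b. k (q b)"] by blast
  have "\<Phi> (r e) = k e" for e
  proof -
    have "r e \<in> span B" using B(3) by auto
    then obtain T u where T: "finite T" "T \<subseteq> B" "(\<Sum>b\<in>T. u b *\<^sub>R b) = r e"
      unfolding span_explicit by auto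
    \<comment> \<open>The coefficients of the relation between r e and its expansion in basis
      vectors. The two parts are subtracted because e itself may be one of the chosen
      representatives.\<close>
    define \<mu> where "\<mu> e' = (if e' \<in> q ` T then u (r e') else 0) - (if e' = e then 1 else 0)" for e'
    let ?J = "insert e (q ` T)"
    have fin: "finite ?J" using T(1) by simp
    have inj: "inj_on q T" using q T(2) by (metis inj_on_def subsetD)
    have split: "(\<Sum>e'\<in>?J. \<mu> e' *\<^sub>R f e') = (\<Sum>b\<in>T. u b *\<^sub>R f (q b)) - f e" for f :: "'e \<Rightarrow> 'y::real_vector"
    proof -
      have "(\<Sum>e'\<in>?J. \<mu> e' *\<^sub>R f e') = (\<Sum>e'\<in>?J. if e' \<in> q ` T then u (r e') *\<^sub>R f e' else 0) - (\<Sum>e'\<in>?J. if e' = e then f e' else 0)"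
        unfolding sum_subtractf[symmetric] by (intro sum.cong refl) (simp add: \<mu>_def scaleR_diff_left)
      also have "(\<Sum>e'\<in>?J. if e' \<in> q ` T then u (r e') *\<^sub>R f e' else 0) = (\<Sum>e'\<in>q ` T. u (r e') *\<^sub>R f e')"
        using fin by (intro sum.mono_neutral_cong_right) auto
      also have "\<dots> = (\<Sum>b\<in>T. u b *\<^sub>R f (q b))"
        using inj q T(2) by (subst sum.reindex) (auto intro!: sum.cong)
      also have "(\<Sum>e'\<in>?J. if e' = e then f e' else 0) = f e"
        using fin by simp
      finally show ?thesis .
    qed
    have "(\<Sum>b\<in>T. u b *\<^sub>R r (q b)) = r e"
      unfolding T(3)[symmetric] using q T(2) by (intro sum.cong) auto
    then have "(\<Sum>e'\<in>?J. \<mu> e' *\<^sub>R r e') = 0" unfolding split by simp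
    from consistent[OF fin this] have "(\<Sum>e'\<in>?J. \<mu> e' *\<^sub>R k e') = 0" by simp
    then have "(\<Sum>b\<in>T. u b *\<^sub>R k (q b)) = k e" unfolding split by simp
    moreover have "\<Phi> (r e) = (\<Sum>b\<in>T. u b *\<^sub>R \<Phi> b)"
      unfolding T(3)[symmetric] by (simp add: linear_sum[OF \<Phi>(1)] linear_scale[OF \<Phi>(1)])
    moreover have "(\<Sum>b\<in>T. u b *\<^sub>R \<Phi> b) = (\<Sum>b\<in>T. u b *\<^sub>R k (q b))"
      using \<Phi>(2) T(2) by (intro sum.cong) auto
    ultimately show ?thesis by simp
  qed
  with \<Phi>(1) show ?thesis by blast
qed

definition single :: "'x \<Rightarrow> 'v \<Rightarrow> 'x \<Rightarrow> 'v::zero" where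
  "single x v = (\<lambda>y. if y = x then v else 0)"

lemma linear_single: "linear (single x :: 'v::real_vector \<Rightarrow> _)"
  by (rule linearI) (auto simp: single_def fun_eq_iff scaleR_fun_def)

text \<open>The unknown 1-cochain is encoded as one linear functional on functions from the group to
  the module. Each pair (g, h) and vector v give one scalar equation; a finite relation between
  left-hand sides is a 2-cycle, so consistency is \<open>cycle_pairing\<close>.\<close>

theorem (in coefficient_module) H2_zero:
  assumes cocycle: "\<And>g h k. g \<in> G \<Longrightarrow> h \<in> G \<Longrightarrow> k \<in> G \<Longrightarrow> c (g ** h) k + act k (c g h) = c g (h ** k) + c h k"
  shows "\<exists>b. \<forall>g\<in>G. \<forall>h\<in>G. c g h = act h (b g) + b h - b (g ** h)"
proof -
  \<comment> \<open>The adjoint transfers the action of h from the unknown to v. Pairs outside the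
    group give the equation 0 = 0.\<close>
  define r where "r e = (case e of (g, h, v) \<Rightarrow> if g \<in> G \<and> h \<in> G
      then single g (adjoint (act h) v) - single (g ** h) v + single h v else 0)" for e :: "(real^2^2) \<times> (real^2^2) \<times> 'v"
  define k where "k e = (case e of (g, h, v) \<Rightarrow> if g \<in> G \<and> h \<in> G then v \<bullet> c g h else 0)"
    for e :: "(real^2^2) \<times> (real^2^2) \<times> 'v"
  have "(\<Sum>e\<in>J. \<mu> e * k e) = 0" if J: "finite J" and rel: "(\<Sum>e\<in>J. \<mu> e *\<^sub>R r e) = 0" for J \<mu>
  proof -
    define gs where "gs e = fst e" for e :: "(real^2^2) \<times> (real^2^2) \<times> 'v"
    define ds where "ds e = fst (snd e)" for e :: "(real^2^2) \<times> (real^2^2) \<times> 'v"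
    define l where "l e = \<mu> e *\<^sub>R snd (snd e)" for e
    define I where "I = {e \<in> J. gs e \<in> G \<and> ds e \<in> G}"
    have I: "finite I" "\<And>e. e \<in> I \<Longrightarrow> gs e \<in> G" "\<And>e. e \<in> I \<Longrightarrow> ds e \<in> G"
      using J by (auto simp: I_def)
    have "(\<Sum>e\<in>I. l e \<bullet> (act (ds e) (b (gs e)) - b (gs e ** ds e) + b (ds e))) = 0" for b
    proof -
      \<comment> \<open>A finite set containing every group element in the relation; pairing the
        relation with b over it gives the cycle condition.\<close>
      define S where "S = gs ` J \<union> ds ` J \<union> (\<lambda>e. gs e ** ds e) ` J"
      have S: "finite S" using J by (simp add: S_def)
      have sg: "(\<Sum>x\<in>S. single g v x \<bullet> b x) = v \<bullet> b g" if "g \<in> S" for g v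
      proof -
        have "single g v x \<bullet> b x = (if x = g then v \<bullet> b g else 0)" for x by (simp add: single_def)
        then show ?thesis using S that by simp
      qed
      have "(\<Sum>x\<in>S. r e x \<bullet> b x) * \<mu> e = (if e \<in> I then l e \<bullet> (act (ds e) (b (gs e)) - b (gs e ** ds e) + b (ds e)) else 0)"
        if e: "e \<in> J" for e
      proof (cases "e \<in> I")
        case True
        obtain g h v where ev: "e = (g, h, v)" by (cases e)
        have gh: "g \<in> G" "h \<in> G" using True by (auto simp: I_def gs_def ds_def ev)
        have inS: "g \<in> S" "h \<in> S" "g ** h \<in> S"
          using e by (force simp: S_def gs_def ds_def ev)+
        have "(\<Sum>x\<in>S. r e x \<bullet> b x) = adjoint (act h) v \<bullet> b g - v \<bullet> b (g ** h) + v \<bullet> b h"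
          using gh inS by (simp add: r_def ev inner_add_left inner_diff_left sum.distrib sum_subtractf sg)
        also have "adjoint (act h) v \<bullet> b g = v \<bullet> act h (b g)"
          using adjoint_works[OF act_linear[OF gh(2)], of "b g" v] by (simp add: inner_commute)
        finally have "(\<Sum>x\<in>S. r e x \<bullet> b x) = v \<bullet> (act h (b g) - b (g ** h) + b h)"
          by (simp add: inner_add_right inner_diff_right)
        then show ?thesis
          using True by (simp add: l_def gs_def ds_def ev mult.commute)
      next
        case False
        then have "r e = 0" using e by (auto simp: I_def r_def gs_def ds_def split: prod.splits)
        then show ?thesis using False by simp
      qed
      then have "(\<Sum>e\<in>J. (\<Sum>x\<in>S. r e x \<bullet> b x) * \<mu> e) = (\<Sum>e\<in>I. l e \<bullet> (act (ds e) (b (gs e)) - b (gs e ** ds e) + b (ds e)))"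
        using J by (simp add: I_def sum.inter_filter)
      moreover have "(\<Sum>e\<in>J. (\<Sum>x\<in>S. r e x \<bullet> b x) * \<mu> e) = (\<Sum>x\<in>S. (\<Sum>e\<in>J. \<mu> e *\<^sub>R r e) x \<bullet> b x)"
      proof -
        have ap: "(\<Sum>e\<in>J. \<mu> e *\<^sub>R r e) x = (\<Sum>e\<in>J. \<mu> e *\<^sub>R r e x)" for x
          using J by (induction J rule: finite_induct) (auto simp: scaleR_fun_def)
        show ?thesis
          unfolding ap inner_sum_left sum_distrib_right by (subst sum.swap) (simp add: mult.commute)
      qed
      ultimately show ?thesis using rel by simp
    qed
    from cycle_pairing[OF cocycle I this] have "(\<Sum>e\<in>I. l e \<bullet> c (gs e) (ds e)) = 0" by blast
    moreover have "(\<Sum>e\<in>J. \<mu> e * k e) = (\<Sum>e\<in>J. if gs e \<in> G \<and> ds e \<in> G then l e \<bullet> c (gs e) (ds e) else 0)"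
      by (intro sum.cong refl) (auto simp: k_def l_def gs_def ds_def split: prod.splits)
    ultimately show ?thesis using J by (simp add: I_def sum.inter_filter)
  qed
  from linear_system_solvable[of r k, OF this] obtain \<Phi> where \<Phi>: "linear \<Phi>" "\<And>e. \<Phi> (r e) = k e" by blast
  \<comment> \<open>The vector that represents the functional restricted to functions concentrated
    at g.\<close>
  define b where "b g = (\<Sum>i\<in>Basis. \<Phi> (single g i) *\<^sub>R i)" for g
  have \<Phi>b: "\<Phi> (single g v) = v \<bullet> b g" for g v
  proof -
    have lin: "linear (\<lambda>v. \<Phi> (single g v))"
      using linear_compose[OF linear_single \<Phi>(1)] by (simp add: o_def)
    have "\<Phi> (single g v) = \<Phi> (single g (\<Sum>i\<in>Basis. (v \<bullet> i) *\<^sub>R i))"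
      by (simp add: euclidean_representation)
    also have "\<dots> = (\<Sum>i\<in>Basis. (v \<bullet> i) *\<^sub>R \<Phi> (single g i))"
      by (simp add: linear_sum[OF lin] linear_scale[OF lin])
    also have "\<dots> = v \<bullet> b g"
      by (simp add: b_def inner_sum_right mult.commute)
    finally show ?thesis .
  qed
  have "c g h = act h (b g) + b h - b (g ** h)" if gh: "g \<in> G" "h \<in> G" for g h
  proof -
    have "v \<bullet> c g h = v \<bullet> (act h (b g) + b h - b (g ** h))" for v
    proof -
      have "v \<bullet> c g h = \<Phi> (r (g, h, v))" using gh by (simp add: \<Phi>(2) k_def)
      also have "\<dots> = adjoint (act h) v \<bullet> b g - v \<bullet> b (g ** h) + v \<bullet> b h"
        using gh by (simp add: r_def linear_add[OF \<Phi>(1)] linear_diff[OF \<Phi>(1)] \<Phi>b)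
      also have "adjoint (act h) v \<bullet> b g = v \<bullet> act h (b g)"
        using adjoint_works[OF act_linear[OF gh(2)], of "b g" v] by (simp add: inner_commute)
      finally show ?thesis by (simp add: inner_add_right inner_diff_right)
    qed
    then show ?thesis by (metis vector_eq_ldot)
  qed
  then show ?thesis by blast
qed

subsection \<open>Quadratic polynomials as coefficients\<close>

lemma qev_translate_square:
  assumes "g \<in> SL2" "u \<in> upper_half" "z \<in> upper_half"
  shows "moeb g z - moeb g u = (z - u) / (jfac g z * jfac g u)"
proof -
  have j: "jfac g z \<noteq> 0" "jfac g u \<noteq> 0" using assms jfac_nonzero by auto
  have det: "complex_of_real (g$1$1) * of_real (g$2$2) - of_real (g$1$2) * of_real (g$2$1) = 1"
    using assms(1) by (simp add: SL2_iff flip: of_real_mult of_real_diff)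
  define N where "N w = of_real (g$1$1) * w + of_real (g$1$2)" for w :: complex
  have "N z * jfac g u - N u * jfac g z = (of_real (g$1$1) * of_real (g$2$2) - of_real (g$1$2) * of_real (g$2$1)) * (z - u)"
    by (simp add: N_def jfac_def algebra_simps)
  then have "N z * jfac g u - N u * jfac g z = z - u" by (simp add: det)
  moreover have "moeb g w = N w / jfac g w" for w by (simp add: moeb_def jfac_def N_def)
  ultimately show ?thesis using j by (simp add: field_simps)
qed

definition sq :: "complex \<Rightarrow> quad" where
  "sq u = (u\<^sup>2, - 2 * u, 1)"

text \<open>Complex scalars are kept separate, since the functionals from the duality argument are
  only real linear.\<close>

definition cscale :: "complex \<Rightarrow> quad \<Rightarrow> quad" where
  "cscale k v = (k * fst v, k * fst (snd v), k * snd (snd v))"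

lemma qev_sq: "qev (sq u) z = (z - u)\<^sup>2"
  by (simp add: qev_def sq_def power2_eq_square algebra_simps)

lemma qev_cscale: "qev (cscale k v) z = k * qev v z"
  by (simp add: qev_def cscale_def algebra_simps)

lemma act_cscale: "quad_act g (cscale k v) = cscale k (quad_act g v)"
  by (simp add: quad_act_def cscale_def Let_def algebra_simps)

text \<open>In (g z - g u)^2 j(z)^2 the dependence on g in the variable z cancels, leaving the
  scalar j(u)^-2.\<close>

lemma act_sq:
  assumes "g \<in> SL2" "u \<in> upper_half"
  shows "quad_act g (sq (moeb g u)) = cscale (1 / (jfac g u)\<^sup>2) (sq u)"
proof (rule qev_eqI)
  fix z assume z: "z \<in> upper_half"
  have j: "jfac g z \<noteq> 0" "jfac g u \<noteq> 0" using assms z jfac_nonzero by auto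
  have "qev (quad_act g (sq (moeb g u))) z = (moeb g z - moeb g u)\<^sup>2 * (jfac g z)\<^sup>2"
    by (simp add: qev_act j qev_sq)
  also have "\<dots> = qev (cscale (1 / (jfac g u)\<^sup>2) (sq u)) z"
    using j by (simp add: qev_translate_square[OF assms z] qev_cscale qev_sq power_divide power_mult_distrib)
  finally show "qev (quad_act g (sq (moeb g u))) z = qev (cscale (1 / (jfac g u)\<^sup>2) (sq u)) z" .
qed

text \<open>An invariant functional \<open>\<Lambda>\<close> gives the quadratic polynomial \<open>q(u) = \<Lambda> ((X - u)\<^sup>2)\<close> for which
  \<open>|q| / Im\<close> is invariant, hence bounded in the cocompact case; so \<open>q\<close> vanishes on the real line.\<close>

lemma (in free_action) quad_no_invariants:
  assumes lin: "linear (\<Lambda> :: quad \<Rightarrow> real)" and inv: "\<And>g v. g \<in> G \<Longrightarrow> \<Lambda> (quad_act g v) = \<Lambda> v"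
    and K: "compact K" "K \<subseteq> upper_half" "\<And>z. z \<in> upper_half \<Longrightarrow> \<exists>g\<in>G. moeb g z \<in> K"
  shows "\<Lambda> v = 0"
proof -
  \<comment> \<open>The complex linear functional with real part \<Lambda>; it is invariant because
    the action commutes with complex scalars.\<close>
  define L where "L v = of_real (\<Lambda> v) - \<i> * of_real (\<Lambda> (cscale \<i> v))" for v
  have cs_add: "cscale k (v + w) = cscale k v + cscale k w" "cscale (k + k') v = cscale k v + cscale k' v"
    "cscale k (cscale k' v) = cscale (k * k') v" "cscale (of_real r) v = r *\<^sub>R v" for k k' v w r
    by (simp_all add: cscale_def prod_eq_iff algebra_simps scaleR_conv_of_real)
  have L_add: "L (v + w) = L v + L w" for v w
    by (simp add: L_def cs_add linear_add[OF lin] algebra_simps)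
  have L_scale: "L (cscale k v) = k * L v" for k v
  proof -
    have r: "L (cscale (of_real a) v) = of_real a * L v" for a v
    proof -
      have "cscale \<i> (a *\<^sub>R v) = a *\<^sub>R cscale \<i> v"
        by (simp add: cscale_def prod_eq_iff)
      then show ?thesis by (simp add: L_def cs_add(4) linear_scale[OF lin] algebra_simps)
    qed
    have i: "L (cscale \<i> v) = \<i> * L v" for v
    proof -
      have "cscale \<i> (cscale \<i> v) = (-1) *\<^sub>R v" by (simp add: cscale_def prod_eq_iff)
      then have "\<Lambda> (cscale \<i> (cscale \<i> v)) = - \<Lambda> v" by (simp add: linear_neg[OF lin])
      then show ?thesis by (simp add: L_def algebra_simps)
    qed
    have "cscale k v = cscale (of_real (Re k)) v + cscale \<i> (cscale (of_real (Im k)) v)"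
      by (simp add: cs_add(3) flip: cs_add(2) complex_eq)
    then have "L (cscale k v) = (of_real (Re k) + \<i> * of_real (Im k)) * L v"
      by (simp add: L_add r i algebra_simps)
    then show ?thesis by (simp flip: complex_eq)
  qed
  have L_inv: "L (quad_act g v) = L v" if "g \<in> G" for g v
    by (simp add: L_def inv[OF that] flip: act_cscale)
  define a where "a = L (1, 0, 0)"
  define b where "b = L (0, 1, 0)"
  define c where "c = L (0, 0, 1)"
  have L_eq: "L v = fst v * a + fst (snd v) * b + snd (snd v) * c" for v
  proof -
    have "v = cscale (fst v) (1, 0, 0) + (cscale (fst (snd v)) (0, 1, 0) + cscale (snd (snd v)) (0, 0, 1))"
      by (simp add: cscale_def prod_eq_iff)
    then have "L v = L (cscale (fst v) (1, 0, 0) + (cscale (fst (snd v)) (0, 1, 0) + cscale (snd (snd v)) (0, 0, 1)))"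
      by simp
    then show ?thesis by (simp only: L_add L_scale a_def b_def c_def add.assoc)
  qed
  define q where "q u = L (sq u)" for u
  have q_eq: "q u = a * u\<^sup>2 - 2 * b * u + c" for u
    by (simp add: q_def L_eq sq_def algebra_simps)
  have q_cont: "continuous_on S q" for S
    unfolding q_eq[abs_def] by (intro continuous_intros)
  have q_inv: "norm (q (moeb g u)) / Im (moeb g u) = norm (q u) / Im u" if g: "g \<in> G" and u: "u \<in> upper_half" for g u
  proof -
    have j: "jfac g u \<noteq> 0" using jfac_nonzero[OF G_SL2[OF g] u] .
    have "q (moeb g u) = q u / (jfac g u)\<^sup>2"
      using L_inv[OF g, of "sq (moeb g u)"] act_sq[OF G_SL2[OF g] u] by (simp add: q_def L_scale)
    then show ?thesis
      using j by (simp add: Im_moeb G_SL2 g norm_divide norm_power)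
  qed
  have "continuous_on K (\<lambda>u. norm (q u) / Im u)"
    using K(2) by (intro continuous_intros q_cont) (auto simp: upper_half_def)
  then have "compact ((\<lambda>u. norm (q u) / Im u) ` K)" by (rule compact_continuous_image[OF _ K(1)])
  then obtain M where M: "\<And>u. u \<in> K \<Longrightarrow> norm (q u) / Im u \<le> M"
    unfolding compact_eq_bounded_closed bounded_real by (fastforce dest: abs_le_D1)
  have bound: "norm (q u) \<le> M * Im u" if u: "u \<in> upper_half" for u
  proof -
    obtain g where g: "g \<in> G" "moeb g u \<in> K" using K(3)[OF u] by blast
    have "norm (q u) / Im u \<le> M" using M[OF g(2)] q_inv[OF g(1) u] by simp
    then show ?thesis using u by (simp add: upper_half_def pos_divide_le_eq)
  qed
  \<comment> \<open>The bound by M times the imaginary part is used along x + i/(n + 1), which tends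
    to the real point x.\<close>
  have real0: "q (of_real x) = 0" for x
  proof -
    let ?s = "\<lambda>n. Complex x (1 / real (Suc n))"
    have s: "?s \<longlonglongrightarrow> of_real x"
      using tendsto_Complex[OF tendsto_const[of x] seq_inverse(1)] by (simp add: complex_of_real_def)
    have "(\<lambda>n. norm (q (?s n))) \<longlonglongrightarrow> norm (q (of_real x))"
      by (intro tendsto_norm isCont_tendsto_compose[OF _ s])
        (use q_cont[of UNIV] in \<open>simp add: continuous_on_eq_continuous_at\<close>)
    moreover have "(\<lambda>n. norm (q (?s n))) \<longlonglongrightarrow> 0"
    proof (rule tendsto_sandwich[OF _ _ tendsto_const])
      show "(\<lambda>n. M * (1 / real (Suc n))) \<longlonglongrightarrow> 0" using tendsto_mult_left[OF seq_inverse(1), of M] by simp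
      show "\<forall>\<^sub>F n in sequentially. norm (q (?s n)) \<le> M * (1 / real (Suc n))"
        using bound[of "?s _"] by (intro always_eventually allI) (simp add: upper_half_def)
    qed simp
    ultimately have "norm (q (of_real x)) = 0" by (rule LIMSEQ_unique)
    then show ?thesis by simp
  qed
  \<comment> \<open>Three real zeros determine that a polynomial of degree at most 2
    vanishes.\<close>
  have "c = 0" "a - 2 * b + c = 0" "a + 2 * b + c = 0"
    using real0[of 0] real0[of 1] real0[of "-1"] by (simp_all add: q_eq)
  then have "a = 0" "b = 0" "c = 0" by (auto simp: add_eq_0_iff)
  then have "L v = 0" by (simp add: L_eq)
  then have "Re (L v) = 0" by simp
  then show ?thesis by (simp add: L_def)
qed

lemma (in free_action) quad_coefficient_module: "coefficient_module G quad_act"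
proof (intro coefficient_module.intro coefficient_module_axioms.intro)
  show "free_action G" by (rule free_action_axioms)
  show "linear (quad_act g)" for g by (rule quad_act_linear)
  show "quad_act (g ** h) v = quad_act h (quad_act g v)" if "g \<in> G" "h \<in> G" for g h v
    by (rule quad_act_mult[OF G_SL2[OF that(1)] G_SL2[OF that(2)]])
  show "quad_act (mat 1) v = v" for v by simp
  show "\<Lambda> v = (0::real)" if "linear \<Lambda>" "\<And>g v. g \<in> G \<Longrightarrow> \<Lambda> (quad_act g v) = \<Lambda> v"
    "compact K" "K \<subseteq> upper_half" "\<And>z. z \<in> upper_half \<Longrightarrow> \<exists>g\<in>G. moeb g z \<in> K" for \<Lambda> K v
    using that by (rule quad_no_invariants)
qed

text \<open>For every weight k the slash action on first-order operators is the same quadratic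
  module, transported by \<open>iota\<close>; injectivity brings the cocycle identity back to
  polynomials.\<close>

lemma (in free_action) unobstructed_iota: "unobstructed (range (iota k)) G (**) (slash_op k)"
proof
  interpret coefficient_module G quad_act by (rule quad_coefficient_module)
  fix c
  assume c: "\<And>g h. g \<in> G \<Longrightarrow> h \<in> G \<Longrightarrow> c g h \<in> range (iota k)"
    and coc: "\<And>g h r. g \<in> G \<Longrightarrow> h \<in> G \<Longrightarrow> r \<in> G \<Longrightarrow> c (g ** h) r + slash_op k r (c g h) = c g (h ** r) + c h r"
  obtain c' where c': "\<And>g h. g \<in> G \<Longrightarrow> h \<in> G \<Longrightarrow> c g h = iota k (c' g h)"
    using c unfolding image_iff by metis
  have "\<exists>b. \<forall>g\<in>G. \<forall>h\<in>G. c' g h = quad_act h (b g) + b h - b (g ** h)"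
  proof (rule H2_zero)
    fix g h r assume G: "g \<in> G" "h \<in> G" "r \<in> G"
    have "iota k (c' (g ** h) r + quad_act r (c' g h)) = iota k (c' g (h ** r) + c' h r)"
      using coc[OF G] G by (simp add: c' linear_add[OF iota_linear] slash_iota G_SL2)
    then show "c' (g ** h) r + quad_act r (c' g h) = c' g (h ** r) + c' h r"
      by (rule iota_inject)
  qed
  then obtain b where b: "\<And>g h. g \<in> G \<Longrightarrow> h \<in> G \<Longrightarrow> c' g h = quad_act h (b g) + b h - b (g ** h)" by blast
  show "\<exists>b. (\<forall>g\<in>G. b g \<in> range (iota k)) \<and> (\<forall>g\<in>G. \<forall>h\<in>G. c g h = slash_op k h (b g) + b h - b (g ** h))"
    by (rule exI[of _ "\<lambda>g. iota k (b g)"])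
      (simp add: c' b linear_add[OF iota_linear] linear_diff[OF iota_linear] slash_iota G_SL2)
qed (auto simp: lie_subspace_iota matrix_mul_assoc slash_op_hom slash_op_mult slash_iota G_SL2)

section \<open>Lifting the given first-order cocycles\<close>

lemma unit_idx_eq_iff [simp]: "unit_idx i = unit_idx j \<longleftrightarrow> i = j"
  by (auto simp: unit_idx_def fun_eq_iff split: if_splits)

lemma deg_unit_idx [simp]: "deg (unit_idx i) = 1"
  by (simp add: deg_def unit_idx_def)

theorem theorem3p12:
  fixes G :: "(real^2^2) set" and k :: int and a :: "'n::finite \<Rightarrow> real^2^2 \<Rightarrow> dop"
  assumes "fuchsian_free_pd G"
    and "\<forall>i. Z1_dk G k (a i)"
  shows "\<exists>A :: real^2^2 \<Rightarrow> 'n dps. Z1_Dk G k A \<and>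
           (\<forall>g\<in>G. dop_eq (A g (\<lambda>_. 0)) dop_id \<and>
                   (\<forall>i. dop_eq (A g (unit_idx i)) (a i g)))"
proof -
  interpret free_action G by unfold_locales (rule assms)
  interpret unobstructed "range (iota k)" G "(**)" "slash_op k" by (rule unobstructed_iota)
  have "\<exists>p. \<forall>i. \<forall>g\<in>G. dop_eq (a i g) (of_hop (iota k (p i g)))"
    using assms(2) unfolding Z1_dk_def in_dk_iff by metis
  then obtain p where p: "\<And>i g. g \<in> G \<Longrightarrow> dop_eq (a i g) (of_hop (iota k (p i g)))" by blast
  \<comment> \<open>The hypothesis holds up to \<open>dop_eq\<close>; the lifting argument needs an
    equation between operators.\<close>
  have p_cocycle: "slash_op k h (iota k (p i g)) + iota k (p i h) = iota k (p i (g ** h))" if G: "g \<in> G" "h \<in> G" for i g h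
  proof (rule of_hop_inject)
    have "dop_eq (a i (g ** h)) (dop_add (dop_slash k (a i g) h) (a i h))"
      using assms(2) G by (auto simp: Z1_dk_def)
    moreover have "dop_eq (dop_slash k (a i g) h) (of_hop (slash_op k h (iota k (p i g))))"
      using dop_eq_trans[OF dop_slash_cong[OF G_SL2 p] dop_eq_sym[OF of_hop_slash[OF G_SL2]]] G by blast
    ultimately show "dop_eq (of_hop (slash_op k h (iota k (p i g)) + iota k (p i h))) (of_hop (iota k (p i (g ** h))))"
      using p[OF G(2), of i] p[OF mult_G[OF G], of i] by (simp add: dop_eq_def dop_add_def of_hop_simps)
  qed
  define X0 :: "real^2^2 \<Rightarrow> ('n, hop) mps" where
    "X0 g = Abs_mps (\<lambda>\<alpha>. \<Sum>i\<in>UNIV. if \<alpha> = unit_idx i then iota k (p i g) else 0)" for g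
  have sub: "subspace (range (iota k))" using lie_subspace_iota by (simp add: lie_subspace_def)
  have "\<exists>X. (\<forall>g\<in>G. X g \<in> series_in (range (iota k)) \<and> ord_ge 1 (X g) \<and> ord_ge 2 (X g - X0 g)) \<and>
    (\<forall>g\<in>G. \<forall>h\<in>G. mexp (X (g ** h)) = map_mps (slash_op k h) (mexp (X g)) * mexp (X h))"
  proof (rule lift_cocycle)
    fix g assume "g \<in> G"
    show "X0 g \<in> series_in (range (iota k))"
      unfolding series_in_def X0_def by (auto intro!: subspace_sum[OF sub] subspace_0[OF sub])
    have "(0 :: 'n \<Rightarrow> nat) \<noteq> unit_idx i" for i
      using deg_unit_idx[of i] by (metis deg_zero(2) zero_neq_one)
    then show "ord_ge 1 (X0 g)"
      unfolding ord_ge_1_iff by (simp add: X0_def)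
  next
    fix g h assume G: "g \<in> G" "h \<in> G"
    have lin: "linear (slash_op k h)" using slash_op_hom[OF G_SL2[OF G(2)]] by (simp add: algebra_hom_def)
    have "coef (map_mps (slash_op k h) (X0 g) + X0 h - X0 (g ** h)) \<alpha> =
        (\<Sum>i\<in>UNIV. if \<alpha> = unit_idx i then slash_op k h (iota k (p i g)) + iota k (p i h) - iota k (p i (g ** h)) else 0)" for \<alpha>
      unfolding X0_def coef_simps coef_map_mps coef_Abs linear_sum[OF lin] sum.distrib[symmetric] sum_subtractf[symmetric]
      by (intro sum.cong refl) (simp add: linear_0[OF lin])
    moreover have "slash_op k h (iota k (p i g)) + iota k (p i h) - iota k (p i (g ** h)) = 0" for i
      using p_cocycle[OF G, of i] by simp
    ultimately show "ord_ge 2 (map_mps (slash_op k h) (X0 g) + X0 h - X0 (g ** h))"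
      unfolding ord_ge_def by (simp only: if_cancel sum.neutral_const) simp
  qed
  then obtain X where X: "\<And>g. g \<in> G \<Longrightarrow> X g \<in> series_in (range (iota k))" "\<And>g. g \<in> G \<Longrightarrow> ord_ge 1 (X g)"
    "\<And>g. g \<in> G \<Longrightarrow> ord_ge 2 (X g - X0 g)"
    and X_mult: "\<And>g h. g \<in> G \<Longrightarrow> h \<in> G \<Longrightarrow> mexp (X (g ** h)) = map_mps (slash_op k h) (mexp (X g)) * mexp (X h)"
    by blast
  define A :: "real^2^2 \<Rightarrow> 'n dps" where "A g = (\<lambda>\<alpha>. of_hop (coef (mexp (X g)) \<alpha>))" for g
  have ps_sym: "ps_eq B C \<Longrightarrow> ps_eq C B" for B C :: "'n dps"
    by (auto simp: ps_eq_def intro: dop_eq_sym)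
  have A_refl: "ps_eq (A g) (\<lambda>\<alpha>. of_hop (coef (mexp (X g)) \<alpha>))" for g
    by (simp add: A_def ps_eq_def)
  have "in_Dk k (A g)" if g: "g \<in> G" for g
    unfolding in_Dk_def
  proof (intro exI conjI)
    show "in_drho k (\<lambda>\<alpha>. of_hop (coef (X g) \<alpha>))"
      unfolding in_drho_def
    proof (intro conjI allI)
      have "coef (X g) 0 = 0" using X(2)[OF g] by (simp add: ord_ge_1_iff[symmetric])
      then show "of_hop (coef (X g) (\<lambda>_. 0)) = dop_zero" by (simp add: of_hop_simps zero_fun_def)
      fix \<alpha>
      show "in_dk k (of_hop (coef (X g) \<alpha>))"
        using series_in_D[OF X(1)[OF g], of \<alpha>] unfolding in_dk_iff by (metis dop_eq_refl rangeE)
    qed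
    show "ps_eq (A g) (ps_exp (\<lambda>\<alpha>. of_hop (coef (X g) \<alpha>)))"
      unfolding A_def by (rule ps_sym[OF ps_exp_of_hop])
  qed
  moreover have "ps_eq (A (g ** h)) (ps_mult (ps_slash k (A g) h) (A h))" if G: "g \<in> G" "h \<in> G" for g h
    using ps_sym[OF ps_eq_mult[OF ps_slash_of_hop[OF G_SL2[OF G(2)] A_refl] A_refl]]
    by (simp add: A_def[of "g ** h"] X_mult[OF G])
  ultimately have "Z1_Dk G k A" by (simp add: Z1_Dk_def)
  moreover have "dop_eq (A g (\<lambda>_. 0)) dop_id" for g
    using of_hop_one_eq coef_mexp_0[of "X g"] by (simp add: A_def zero_fun_def)
  moreover have "dop_eq (A g (unit_idx i)) (a i g)" if g: "g \<in> G" for g i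
  proof -
    have nz: "unit_idx i \<noteq> (0 :: 'n \<Rightarrow> nat)"
      using deg_unit_idx[of i] by (metis deg_zero(2) zero_neq_one)
    \<comment> \<open>In degree 1 only the powers 0 and 1 of X enter, and the power 0 contributes
      nothing at a unit index.\<close>
    have "coef (mexp (X g)) (unit_idx i) = coef (X g) (unit_idx i)"
      using nz by (simp add: mexp_def coef_one)
    also have "\<dots> = coef (X0 g) (unit_idx i)"
      using X(3)[OF g] by (simp add: ord_ge_def coef_diff)
    also have "\<dots> = iota k (p i g)" by (simp add: X0_def)
    finally show ?thesis using dop_eq_sym[OF p[OF g]] by (simp add: A_def)
  qed
  ultimately show ?thesis by blast
qed

end
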